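(* Let $\Omega\subset\mathbb{R}^d$ be a bounded open Lipschitz set, let $p,q>1$, let $f\in (W^{1,p}(\Omega))^*$ satisfy $\int_\Omega f\,\mathrm{d}x\neq0$, and put $\gamma:=\frac1{q-1}$. For $\alpha>0$ let $$E_\alpha:=\inf\Big\{\tfrac1p\int_\Omega|\nabla u|^p\,\mathrm{d}x+\tfrac{\alpha}{q}\int_{\partial\Omega}|u|^q\,\mathrm{d}S-\int_\Omega fu\,\mathrm{d}x:\ u\in W^{1,p}(\Omega)\Big\},$$ and let $$K_f:=\inf\Big\{\tfrac1p\int_\Omega|\nabla v|^p\,\mathrm{d}x-\int_\Omega fv\,\mathrm{d}x:\ v\in W^{1,p}(\Omega),\ \int_{\partial\Omega}v\,\mathrm{d}S=0\Big\}.$$ Then, for every $\alpha>0$, $$-\frac{q-1}{q}\,\frac{\left|\int_\Omega f\,\mathrm{d}x\right|^{\frac{q}{q-1}}}{\mathcal{H}^{d-1}(\partial\Omega)^{\frac1{q-1}}}+\alpha^\gamma K_f\ \le\ \alpha^\gamma E_\alpha\ \le\ -\frac{q-1}{q}\,\frac{\left|\int_\Omega f\,\mathrm{d}x\right|^{\frac{q}{q-1}}}{\mathcal{H}^{d-1}(\partial\Omega)^{\frac1{q-1}}}.$$ In particular, $$E_\alpha=-\frac{1}{\alpha^\gamma}\,\frac{q-1}{q}\,\frac{\left|\int_\Omega f\,\mathrm{d}x\right|^{\frac{q}{q-1}}}{\mathcal{H}^{d-1}(\partial\Omega)^{\frac1{q-1}}}+o\left(\frac1{\alpha^\gamma}\right)\qquad\text{as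 }\alpha\to0^+.$$
   Context: $\mathcal{H}^{d-1}$ is the $(d-1)$-dimensional Hausdorff measure and $\mathrm{d}S$ denotes integration with respect to it on $\partial\Omega$; boundary values of functions in $W^{1,p}(\Omega)$ are traces. $\int_\Omega fu\,\mathrm{d}x$ denotes the duality pairing $\langle f,u\rangle$, and $\int_\Omega f\,\mathrm{d}x:=\langle f,1\rangle$. In $E_\alpha$ the boundary integral is $+\infty$ if the trace of $u$ is not in $L^q(\partial\Omega)$.
   Formalization: The "in particular" expansion of E_α is stated only when Ω is connected or K_f > −∞, since it fails otherwise (e.g. Ω=(0,1)∪(2,3), p=q=2, f the indicator of (0,1)); the two-sided bound is unrestricted. *)

theory Defs
  imports "HOL-Analysis.Analysis" "HOL-Library.Landau_Symbols"
begin

subsection \<open>Hausdorff measure\<close>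

text \<open>
  The normalisation is the one for which the \<open>k\<close>-dimensional Hausdorff measure agrees with
  Lebesgue measure on \<open>\<real>\<^sup>k\<close>. Empty covering sets contribute \<open>0\<close>; as \<open>0 ^ 0 = 1\<close>, this matters
  for \<open>k = 0\<close>, where one obtains the counting measure.
\<close>

definition hausdorff_outer :: "nat \<Rightarrow> 'a::metric_space set \<Rightarrow> ennreal" where
  "hausdorff_outer k A =
     (SUP \<delta>\<in>{0::real<..}.
        INF C\<in>{C :: nat \<Rightarrow> 'a set. A \<subseteq> (\<Union>i. C i) \<and> (\<forall>i. bounded (C i) \<and> diameter (C i) \<le> \<delta>)}.
          \<Sum>i. if C i = {} then 0
              else ennreal (unit_ball_vol (real k) * (diameter (C i) / 2) ^ k))"

definition hausdorff_measure :: "nat \<Rightarrow> 'a::metric_space measure" where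
  "hausdorff_measure k = measure_of UNIV (sets borel) (hausdorff_outer k)"

definition boundary_measure :: "'a::euclidean_space set \<Rightarrow> 'a measure" where
  "boundary_measure \<Omega> = restrict_space (hausdorff_measure (DIM('a) - 1)) (frontier \<Omega>)"


subsection \<open>Lipschitz boundary\<close>

text \<open>
  Near every boundary point, \<open>\<Omega>\<close> is the part of a ball lying strictly above the graph of a
  Lipschitz function on the hyperplane orthogonal to some unit vector \<open>e\<close>; the point
  \<open>y - (y \<bullet> e) *\<^sub>R e\<close> is the orthogonal projection of \<open>y\<close> to that hyperplane.
\<close>

definition lipschitz_boundary :: "'a::euclidean_space set \<Rightarrow> bool" where
  "lipschitz_boundary \<Omega> \<longleftrightarrow>
     (\<forall>x\<in>frontier \<Omega>. \<exists>e h L r. norm e = 1 \<and> r > 0 \<and> L-lipschitz_on {z. z \<bullet> e = 0} h \<and>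
        \<Omega> \<inter> ball x r = {y \<in> ball x r. (h (y - (y \<bullet> e) *\<^sub>R e) :: real) < y \<bullet> e})"


subsection \<open>Smooth functions\<close>

fun iterated_deriv :: "'a list \<Rightarrow> ('a::real_normed_vector \<Rightarrow> real) \<Rightarrow> 'a \<Rightarrow> real" where
  "iterated_deriv [] \<phi> = \<phi>"
| "iterated_deriv (v # vs) \<phi> = (\<lambda>x. frechet_derivative (iterated_deriv vs \<phi>) (at x) v)"

text \<open>
  Class \<open>C\<^sup>\<infinity>\<close> on the whole space: continuity of the iterated directional derivatives follows
  from their differentiability.
\<close>

definition smooth :: "('a::real_normed_vector \<Rightarrow> real) \<Rightarrow> bool" where
  "smooth \<phi> \<longleftrightarrow> (\<forall>vs x. iterated_deriv vs \<phi> differentiable (at x))"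

definition test_function :: "'a::euclidean_space set \<Rightarrow> ('a \<Rightarrow> real) \<Rightarrow> bool" where
  "test_function \<Omega> \<phi> \<longleftrightarrow>
     smooth \<phi> \<and> compact (closure {x. \<phi> x \<noteq> 0}) \<and> closure {x. \<phi> x \<noteq> 0} \<subseteq> \<Omega>"

definition gradient :: "('a::euclidean_space \<Rightarrow> real) \<Rightarrow> 'a \<Rightarrow> 'a" where
  "gradient \<phi> x = (\<Sum>b\<in>Basis. frechet_derivative \<phi> (at x) b *\<^sub>R b)"


subsection \<open>Lebesgue and Sobolev spaces\<close>

text \<open>
  Elements of \<open>L\<^sup>p\<close> and \<open>W\<^sup>1\<^sup>,\<^sup>p\<close> are represented by functions on the whole space, of which only
  the values on the underlying set, up to null sets, are relevant.
\<close>

definition Lp :: "real \<Rightarrow> 'a measure \<Rightarrow> ('a \<Rightarrow> 'b::euclidean_space) set" where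
  "Lp p M = {g \<in> borel_measurable M. integrable M (\<lambda>x. norm (g x) powr p)}"

definition Lp_norm :: "real \<Rightarrow> 'a measure \<Rightarrow> ('a \<Rightarrow> 'b::euclidean_space) \<Rightarrow> real" where
  "Lp_norm p M g = (LINT x|M. norm (g x) powr p) powr (1 / p)"

text \<open>
  \<open>u \<in> W\<^sup>1\<^sup>,\<^sup>p(\<Omega>)\<close> with weak gradient \<open>G\<close>; the latter is unique up to null sets.
\<close>

definition has_sobolev_gradient ::
    "real \<Rightarrow> 'a::euclidean_space set \<Rightarrow> ('a \<Rightarrow> real) \<Rightarrow> ('a \<Rightarrow> 'a) \<Rightarrow> bool" where
  "has_sobolev_gradient p \<Omega> u G \<longleftrightarrow>
     u \<in> Lp p (lebesgue_on \<Omega>) \<and> G \<in> Lp p (lebesgue_on \<Omega>) \<and>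
     (\<forall>\<phi>. test_function \<Omega> \<phi> \<longrightarrow> (\<forall>b\<in>Basis.
        (LINT x|lebesgue_on \<Omega>. u x * frechet_derivative \<phi> (at x) b) =
        - (LINT x|lebesgue_on \<Omega>. (G x \<bullet> b) * \<phi> x)))"

definition sobolev :: "real \<Rightarrow> 'a::euclidean_space set \<Rightarrow> ('a \<Rightarrow> real) set" where
  "sobolev p \<Omega> = {u. \<exists>G. has_sobolev_gradient p \<Omega> u G}"

text \<open>
  The topological dual of \<open>W\<^sup>1\<^sup>,\<^sup>p(\<Omega>)\<close>. Linearity and boundedness force the functional to take
  equal values on functions that agree almost everywhere in \<open>\<Omega>\<close>. Nothing is required of its
  values outside \<open>W\<^sup>1\<^sup>,\<^sup>p(\<Omega>)\<close>.
\<close>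

definition sobolev_dual ::
    "real \<Rightarrow> 'a::euclidean_space set \<Rightarrow> (('a \<Rightarrow> real) \<Rightarrow> real) set" where
  "sobolev_dual p \<Omega> = {f.
     (\<forall>u\<in>sobolev p \<Omega>. \<forall>v\<in>sobolev p \<Omega>. f (\<lambda>x. u x + v x) = f u + f v) \<and>
     (\<forall>c. \<forall>u\<in>sobolev p \<Omega>. f (\<lambda>x. c * u x) = c * f u) \<and>
     (\<exists>C. \<forall>u G. has_sobolev_gradient p \<Omega> u G \<longrightarrow>
        \<bar>f u\<bar> \<le> C * (Lp_norm p (lebesgue_on \<Omega>) u + Lp_norm p (lebesgue_on \<Omega>) G))}"

text \<open>
  The trace operator is the continuous extension of \<open>\<phi> \<mapsto> \<phi>|\<^bsub>\<partial>\<Omega>\<^esub>\<close> from \<open>C\<^sup>\<infinity>\<close> up to the boundary to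
  \<open>W\<^sup>1\<^sup>,\<^sup>p(\<Omega>)\<close>, with values in \<open>L\<^sup>p(\<partial>\<Omega>)\<close>. Here it is given by its graph: \<open>g\<close> is the trace of
  the function \<open>u\<close> with weak gradient \<open>G\<close>. On a bounded open set with Lipschitz boundary
  every \<open>u \<in> W\<^sup>1\<^sup>,\<^sup>p(\<Omega>)\<close> has exactly one trace, up to null sets of the surface measure.
\<close>

definition has_trace ::
    "real \<Rightarrow> 'a::euclidean_space set \<Rightarrow> ('a \<Rightarrow> real) \<Rightarrow> ('a \<Rightarrow> 'a) \<Rightarrow> ('a \<Rightarrow> real) \<Rightarrow> bool" where
  "has_trace p \<Omega> u G g \<longleftrightarrow>
     has_sobolev_gradient p \<Omega> u G \<and> g \<in> Lp p (boundary_measure \<Omega>) \<and>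
     (\<exists>\<phi> :: nat \<Rightarrow> 'a \<Rightarrow> real. (\<forall>n. smooth (\<phi> n)) \<and>
        (\<lambda>n. Lp_norm p (lebesgue_on \<Omega>) (\<lambda>x. \<phi> n x - u x)) \<longlonglongrightarrow> 0 \<and>
        (\<lambda>n. Lp_norm p (lebesgue_on \<Omega>) (\<lambda>x. gradient (\<phi> n) x - G x)) \<longlonglongrightarrow> 0 \<and>
        (\<lambda>n. Lp_norm p (boundary_measure \<Omega>) (\<lambda>x. \<phi> n x - g x)) \<longlonglongrightarrow> 0)"


subsection \<open>The two variational problems\<close>

text \<open>
  Both infima are taken over \<open>u \<in> W\<^sup>1\<^sup>,\<^sup>p(\<Omega>)\<close>, with \<open>G\<close> its weak gradient and \<open>g\<close> its trace. The
  boundary term of the Robin energy is a nonnegative Lebesgue integral, hence \<open>\<infinity>\<close> if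
  \<open>g\<close> is not in \<open>L\<^sup>q(\<partial>\<Omega>)\<close>.
\<close>

definition robin_energy ::
    "real \<Rightarrow> real \<Rightarrow> 'a::euclidean_space set \<Rightarrow> (('a \<Rightarrow> real) \<Rightarrow> real) \<Rightarrow> real \<Rightarrow> ereal" where
  "robin_energy p q \<Omega> f \<alpha> =
     Inf {ereal (1 / p * (LINT x|lebesgue_on \<Omega>. norm (G x) powr p))
          + ereal (\<alpha> / q) * enn2ereal (\<integral>\<^sup>+x. ennreal (\<bar>g x\<bar> powr q) \<partial>boundary_measure \<Omega>)
          - ereal (f u)
        | u G g. has_trace p \<Omega> u G g}"

definition mean_zero_energy ::
    "real \<Rightarrow> 'a::euclidean_space set \<Rightarrow> (('a \<Rightarrow> real) \<Rightarrow> real) \<Rightarrow> ereal" where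
  "mean_zero_energy p \<Omega> f =
     Inf {ereal (1 / p * (LINT x|lebesgue_on \<Omega>. norm (G x) powr p) - f v)
        | v G g. has_trace p \<Omega> v G g \<and> (LINT x|boundary_measure \<Omega>. g x) = 0}"

text \<open>
  The pairing of \<open>f\<close> with the constant function \<open>1\<close> plays the role of the integral of \<open>f\<close>.
\<close>

definition leading_coeff ::
    "real \<Rightarrow> 'a::euclidean_space set \<Rightarrow> (('a \<Rightarrow> real) \<Rightarrow> real) \<Rightarrow> real" where
  "leading_coeff q \<Omega> f =
     (q - 1) / q * (\<bar>f (\<lambda>_. 1)\<bar> powr (q / (q - 1)) /
       measure (hausdorff_measure (DIM('a) - 1)) (frontier \<Omega>) powr (1 / (q - 1)))"

end

theory Submission
  imports Defs
begin

text \<open>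
  The energy is determined up to a bounded error by splitting off constants. Write $f_1$ for the
  pairing of $f$ with the constant $1$ and $H$ for the surface measure of the boundary. On a constant
  $c$ the Robin energy is $\frac{\alpha}{q} |c|^q H - c f_1$, and minimising over $c$ gives exactly
  the leading term; this is the upper bound (\<open>robin_energy_le\<close>). Conversely, let $u$ have trace
  $g$ and let $c$ be the boundary mean of $g$. Then $u - c$ has the same gradient and is admissible
  for the mean zero problem, which bounds the part of the energy of $u$ that does not see $c$. The rest,
  $\frac{\alpha}{q} \int |g|^q - c f_1$, is the integral of $\frac{\alpha}{q} |g|^q - (f_1 / H) g$,
  and Young's inequality bounds the integrand from below by a constant whose integral is again the
  leading term (\<open>robin_energy_ge\<close>). Thus the remainder in the expansion lies between the mean zero
  energy and $0$; being bounded, it is negligible against $\alpha^{-\gamma}$.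

  Two facts about the domain have to be supplied. First, $H$ must be a positive real number and the
  Hausdorff measure must be countably additive on Borel sets. Second, on a connected domain the mean
  zero energy is finite, which is a Poincare inequality for functions with mean zero trace
  (\<open>poincare_mean_zero_trace\<close>). As gradients and traces are limits of those of smooth functions on
  the whole space, it suffices to prove inequalities for such functions $\phi$.

  Everything rests on translations. If all segments from a point $a$ of $A$ to $a + w$ lie in the domain,
  the $L^p$ distance over $A$ between $\phi$ and its translate by $w$ is at most a multiple of the
  $L^p$ norm of the gradient on the domain (\<open>C1_translation_estimate\<close>). Applied to small balls this
  propagates $L^p$ bounds along a connected open set; applied with an inward vector it carries them up
  to a Lipschitz boundary; and averaged over all $w$ it gives the Poincare inequality on one ball. A
  chart enters only as a Lipschitz function $F$ that, near a boundary point, is positive exactly in the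
  domain, and that grows with unit speed in some direction $e$.

  For traces, the Hausdorff measure of a part $S$ of the boundary is compared with the volume of a
  thickening of $S$ of radius $\epsilon$, divided by $\epsilon$. When the thickening is shifted
  inwards, it lies in a layer $0 < F < 2 M \epsilon$ of the domain, where $M$ is a Lipschitz constant
  of $F$. Pushing such a layer along $e$ covers each point of the domain for a time of order
  $\epsilon$ only, which turns the volume integrals into integrals of $\phi$ and its gradient over the
  domain (\<open>trace_inequality\<close>).
\<close>

section \<open>Hausdorff measure as a Borel measure\<close>

definition covering_cost :: "nat \<Rightarrow> 'a::metric_space set \<Rightarrow> ennreal" where
  "covering_cost k C = (if C = {} then 0 else ennreal (unit_ball_vol (real k) * (diameter C / 2) ^ k))"

definition fine_covers :: "real \<Rightarrow> 'a::metric_space set \<Rightarrow> (nat \<Rightarrow> 'a set) set" where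
  "fine_covers \<delta> A = {C. A \<subseteq> (\<Union>i. C i) \<and> (\<forall>i. bounded (C i) \<and> diameter (C i) \<le> \<delta>)}"

definition hausdorff_pre :: "nat \<Rightarrow> real \<Rightarrow> 'a::metric_space set \<Rightarrow> ennreal" where
  "hausdorff_pre k \<delta> A = (INF C\<in>fine_covers \<delta> A. \<Sum>i. covering_cost k (C i))"

lemma hausdorff_outer_eq_SUP_pre: "hausdorff_outer k A = (SUP \<delta>\<in>{0<..}. hausdorff_pre k \<delta> A)"
  unfolding hausdorff_outer_def hausdorff_pre_def covering_cost_def fine_covers_def by simp

lemma covering_cost_empty [simp]: "covering_cost k {} = 0"
  by (simp add: covering_cost_def)

lemma hausdorff_pre_le: "C \<in> fine_covers \<delta> A \<Longrightarrow> hausdorff_pre k \<delta> A \<le> (\<Sum>i. covering_cost k (C i))"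
  unfolding hausdorff_pre_def by (rule INF_lower)

lemma hausdorff_pre_mono: "A \<subseteq> B \<Longrightarrow> hausdorff_pre k \<delta> A \<le> hausdorff_pre k \<delta> B"
  unfolding hausdorff_pre_def fine_covers_def by (rule INF_superset_mono) auto

lemma hausdorff_pre_antimono: "\<delta> \<le> \<delta>' \<Longrightarrow> hausdorff_pre k \<delta>' A \<le> hausdorff_pre k \<delta> A"
  unfolding hausdorff_pre_def fine_covers_def by (rule INF_superset_mono) (auto intro: order_trans)

lemma hausdorff_pre_empty:
  assumes "0 < \<delta>"
  shows "hausdorff_pre k \<delta> {} = 0"
  using hausdorff_pre_le[of "\<lambda>_. {}" \<delta> "{}" k] assms by (simp add: fine_covers_def)

lemma hausdorff_pre_UN_le: "hausdorff_pre k \<delta> (\<Union>n. A n) \<le> (\<Sum>n::nat. hausdorff_pre k \<delta> (A n))"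
proof (rule ennreal_le_epsilon)
  fix e :: real assume e: "0 < e" "(\<Sum>n. hausdorff_pre k \<delta> (A n)) < top"
  then have "hausdorff_pre k \<delta> (A n) < hausdorff_pre k \<delta> (A n) + e * (1/2)^Suc n" for n
    by (auto simp add: less_top dest!: ennreal_suminf_lessD)
  then have "\<exists>C\<in>fine_covers \<delta> (A n). (\<Sum>i. covering_cost k (C i)) < hausdorff_pre k \<delta> (A n) + e * (1/2)^Suc n" for n
    unfolding hausdorff_pre_def INF_less_iff by blast
  then obtain B where B: "\<And>n. B n \<in> fine_covers \<delta> (A n)"
    and Ble: "\<And>n. (\<Sum>i. covering_cost k (B n i)) \<le> hausdorff_pre k \<delta> (A n) + e * (1/2)^Suc n"
    by (metis less_imp_le)
  define C where "C = case_prod B o prod_decode"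
  have "(\<Union>n. A n) \<subseteq> (\<Union>i. C i)"
    using B unfolding C_def fine_covers_def subset_eq
    by (auto simp: image_iff) (metis prod.case prod_encode_inverse UN_E)
  then have "C \<in> fine_covers \<delta> (\<Union>n. A n)"
    using B by (auto simp: fine_covers_def C_def split: prod.split)
  then have "hausdorff_pre k \<delta> (\<Union>n. A n) \<le> (\<Sum>i. covering_cost k (C i))"
    by (rule hausdorff_pre_le)
  also have "... = (\<Sum>i. (\<lambda>x. covering_cost k (case_prod B x)) (prod_decode i))"
    by (simp add: C_def)
  also have "... = (\<Sum>n. \<Sum>i. covering_cost k (B n i))"
    by (rule suminf_ennreal_2dimen) simp
  also have "... \<le> (\<Sum>n. hausdorff_pre k \<delta> (A n) + e * (1/2) ^ Suc n)"
    by (intro suminf_le allI Ble) auto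
  also have "... = (\<Sum>n. hausdorff_pre k \<delta> (A n)) + (\<Sum>n. ennreal e * ennreal ((1/2) ^ Suc n))"
    using \<open>0 < e\<close> by (subst suminf_add[symmetric])
      (auto simp del: ennreal_suminf_cmult simp add: ennreal_mult[symmetric])
  also have "... = (\<Sum>n. hausdorff_pre k \<delta> (A n)) + e"
    unfolding ennreal_suminf_cmult
    by (subst suminf_ennreal_eq[OF zero_le_power power_half_series]) auto
  finally show "hausdorff_pre k \<delta> (\<Union>n. A n) \<le> (\<Sum>n. hausdorff_pre k \<delta> (A n)) + e" .
qed

text \<open>
  A set of diameter at most \<open>\<delta>\<close> cannot meet both parts, so every cover splits into a cover of each.
\<close>

lemma hausdorff_pre_separated:
  assumes "0 < \<delta>" "\<delta> < \<eta>" and far: "\<And>x y. x \<in> A \<Longrightarrow> y \<in> B \<Longrightarrow> \<eta> \<le> dist x y"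
  shows "hausdorff_pre k \<delta> A + hausdorff_pre k \<delta> B \<le> hausdorff_pre k \<delta> (A \<union> B)"
  unfolding hausdorff_pre_def[of k \<delta> "A \<union> B"]
proof (rule INF_greatest)
  fix C assume C: "C \<in> fine_covers \<delta> (A \<union> B)"
  define P where "P X i = (if C i \<inter> X = {} then {} else C i)" for X i
  have PA: "P A \<in> fine_covers \<delta> A" and PB: "P B \<in> fine_covers \<delta> B"
    using C \<open>0 < \<delta>\<close> by (force simp: fine_covers_def P_def subset_eq)+
  have "C i \<inter> A = {} \<or> C i \<inter> B = {}" for i
  proof (rule ccontr)
    assume "\<not> ?thesis"
    then obtain x y where xy: "x \<in> C i" "x \<in> A" "y \<in> C i" "y \<in> B" by blast
    have "dist x y \<le> diameter (C i)"
      using C xy by (intro diameter_bounded_bound) (auto simp: fine_covers_def)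
    also have "... \<le> \<delta>" using C by (auto simp: fine_covers_def)
    finally show False using far[OF xy(2,4)] \<open>\<delta> < \<eta>\<close> by simp
  qed
  then have le: "covering_cost k (P A i) + covering_cost k (P B i) \<le> covering_cost k (C i)" for i
    by (auto simp: P_def)
  have "hausdorff_pre k \<delta> A + hausdorff_pre k \<delta> B
      \<le> (\<Sum>i. covering_cost k (P A i)) + (\<Sum>i. covering_cost k (P B i))"
    by (intro add_mono hausdorff_pre_le PA PB)
  also have "... = (\<Sum>i. covering_cost k (P A i) + covering_cost k (P B i))"
    by (rule suminf_add) auto
  also have "... \<le> (\<Sum>i. covering_cost k (C i))"
    by (intro suminf_le le) auto
  finally show "hausdorff_pre k \<delta> A + hausdorff_pre k \<delta> B \<le> (\<Sum>i. covering_cost k (C i))" .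
qed

text \<open>
  Monotonicity in the scale turns the supremum into a limit along a sequence, so that finite sums of Hausdorff measures can be estimated at a single scale.
\<close>

lemma hausdorff_pre_tendsto:
  "(\<lambda>n. hausdorff_pre k (c / real (Suc n)) A) \<longlonglongrightarrow> hausdorff_outer k A" if c: "c > 0"
proof -
  have "incseq (\<lambda>n. hausdorff_pre k (c / real (Suc n)) A)"
    using c by (intro incseq_SucI hausdorff_pre_antimono) (auto simp: field_simps)
  from LIMSEQ_SUP[OF this]
  have "(\<lambda>n. hausdorff_pre k (c / real (Suc n)) A) \<longlonglongrightarrow> (SUP n. hausdorff_pre k (c / real (Suc n)) A)" .
  also have "(SUP n. hausdorff_pre k (c / real (Suc n)) A) = hausdorff_outer k A"
    unfolding hausdorff_outer_eq_SUP_pre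
  proof (rule SUP_eq)
    fix n show "\<exists>\<delta>\<in>{0<..}. hausdorff_pre k (c / real (Suc n)) A \<le> hausdorff_pre k \<delta> A"
      using c by (intro bexI[of _ "c / real (Suc n)"]) auto
  next
    fix \<delta> :: real assume "\<delta> \<in> {0<..}"
    then obtain n where "inverse (real (Suc n)) < \<delta> / c"
      using reals_Archimedean[of "\<delta> / c"] c by auto
    then have "c / real (Suc n) \<le> \<delta>"
      using c by (auto simp: field_simps simp del: of_nat_Suc)
    then show "\<exists>n\<in>UNIV. hausdorff_pre k \<delta> A \<le> hausdorff_pre k (c / real (Suc n)) A"
      by (intro bexI[of _ n] hausdorff_pre_antimono) auto
  qed
  finally show ?thesis .
qed

lemma hausdorff_outer_mono: "A \<subseteq> B \<Longrightarrow> hausdorff_outer k A \<le> hausdorff_outer k B"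
  unfolding hausdorff_outer_eq_SUP_pre by (intro SUP_mono) (auto intro: hausdorff_pre_mono)

lemma hausdorff_outer_empty: "hausdorff_outer k {} = 0"
  unfolding hausdorff_outer_eq_SUP_pre by (simp add: hausdorff_pre_empty cong: SUP_cong_simp)

lemma hausdorff_outer_UN_le: "hausdorff_outer k (\<Union>n. A n) \<le> (\<Sum>n::nat. hausdorff_outer k (A n))"
  unfolding hausdorff_outer_eq_SUP_pre[of k "\<Union>n. A n"]
proof (rule SUP_least)
  fix \<delta> :: real assume "\<delta> \<in> {0<..}"
  then have "hausdorff_pre k \<delta> (A n) \<le> hausdorff_outer k (A n)" for n
    unfolding hausdorff_outer_eq_SUP_pre by (rule SUP_upper)
  then have "(\<Sum>n. hausdorff_pre k \<delta> (A n)) \<le> (\<Sum>n. hausdorff_outer k (A n))"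
    by (intro suminf_le) auto
  with hausdorff_pre_UN_le show "hausdorff_pre k \<delta> (\<Union>n. A n) \<le> (\<Sum>n. hausdorff_outer k (A n))"
    by (rule order_trans)
qed

lemma hausdorff_outer_separated:
  assumes "0 < \<eta>" and far: "\<And>x y. x \<in> A \<Longrightarrow> y \<in> B \<Longrightarrow> \<eta> \<le> dist x y"
  shows "hausdorff_outer k A + hausdorff_outer k B \<le> hausdorff_outer k (A \<union> B)"
proof (rule LIMSEQ_le)
  have c: "\<eta> / 2 > 0" using assms by simp
  show "(\<lambda>n. hausdorff_pre k ((\<eta>/2) / real (Suc n)) A + hausdorff_pre k ((\<eta>/2) / real (Suc n)) B)
    \<longlonglongrightarrow> hausdorff_outer k A + hausdorff_outer k B"
    by (intro tendsto_add hausdorff_pre_tendsto c)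
  show "(\<lambda>n. hausdorff_pre k ((\<eta>/2) / real (Suc n)) (A \<union> B)) \<longlonglongrightarrow> hausdorff_outer k (A \<union> B)"
    by (intro hausdorff_pre_tendsto c)
  have "hausdorff_pre k ((\<eta>/2) / real (Suc n)) A + hausdorff_pre k ((\<eta>/2) / real (Suc n)) B
      \<le> hausdorff_pre k ((\<eta>/2) / real (Suc n)) (A \<union> B)" for n
  proof -
    have "(\<eta>/2) / real (Suc n) \<le> (\<eta>/2) / 1" using c by (intro divide_left_mono) auto
    then have "(\<eta>/2) / real (Suc n) < \<eta>" using \<open>0 < \<eta>\<close> by linarith
    then show ?thesis using c far by (intro hausdorff_pre_separated[where \<eta> = \<eta>]) auto
  qed
  then show "\<exists>N. \<forall>n\<ge>N. hausdorff_pre k ((\<eta>/2) / real (Suc n)) A + hausdorff_pre k ((\<eta>/2) / real (Suc n)) B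
      \<le> hausdorff_pre k ((\<eta>/2) / real (Suc n)) (A \<union> B)" by blast
qed

text \<open>
  Caratheodory's criterion. The part of \<open>A - E\<close> at distance at least \<open>1 / n\<close> from \<open>E\<close> is
  separated from \<open>E\<close>, so the two measures add up. What remains of \<open>A - E\<close> is a union of thin annuli
  around \<open>E\<close>. Annuli with indices of equal parity are mutually separated, hence the measures of all
  annuli have sum at most twice that of \<open>A\<close>, and the tails of this series vanish.
\<close>

lemma metric_outer_measure_closed:
  fixes \<mu> :: "'a::metric_space set \<Rightarrow> ennreal"
  assumes empty: "\<mu> {} = 0"
    and mono: "\<And>A B. A \<subseteq> B \<Longrightarrow> \<mu> A \<le> \<mu> B"
    and UN_le: "\<And>A :: nat \<Rightarrow> 'a set. \<mu> (\<Union>n. A n) \<le> (\<Sum>n. \<mu> (A n))"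
    and separated: "\<And>A B \<eta>. 0 < \<eta> \<Longrightarrow> (\<And>x y. x \<in> A \<Longrightarrow> y \<in> B \<Longrightarrow> \<eta> \<le> dist x y) \<Longrightarrow> \<mu> A + \<mu> B \<le> \<mu> (A \<union> B)"
    and "closed E"
  shows "\<mu> (A \<inter> E) + \<mu> (A - E) \<le> \<mu> A"
proof (cases "\<mu> A = \<infinity> \<or> E = {}")
  case True
  then show ?thesis using empty by auto
next
  case False
  then have fin: "\<mu> A < \<infinity>" and "E \<noteq> {}" by (auto simp: less_top)
  define g where "g x = infdist x E" for x
  have g_lip: "g x \<le> g y + dist x y" for x y
    unfolding g_def by (rule infdist_triangle)
  have g_pos: "g x > 0" if "x \<notin> E" for x
    using that \<open>closed E\<close> \<open>E \<noteq> {}\<close> unfolding g_def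
    by (simp add: infdist_pos_not_in_closed)
  have g_zero: "g x = 0" if "x \<in> E" for x
    using that by (simp add: g_def)
  define U where "U n = {x\<in>A. 1 / real (Suc n) \<le> g x}" for n
  define R where "R k = {x\<in>A. 1 / real (k + 2) \<le> g x \<and> g x < 1 / real (k + 1)}" for k
  \<comment> \<open>Between the radii of \<open>R k\<close> and \<open>R (k + 2)\<close> lies the whole range of radii of \<open>R (k + 1)\<close>.\<close>
  have parity: "(\<Sum>j<m. \<mu> (R (2 * j + b))) \<le> \<mu> (\<Union>j<m. R (2 * j + b))" for m b
  proof (induction m)
    case 0 then show ?case by simp
  next
    case (Suc m)
    have "(\<Sum>j<Suc m. \<mu> (R (2 * j + b))) \<le> \<mu> (\<Union>j<m. R (2 * j + b)) + \<mu> (R (2 * m + b))"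
      using Suc by (simp add: add_right_mono)
    also have "... \<le> \<mu> ((\<Union>j<m. R (2 * j + b)) \<union> R (2 * m + b))"
    proof (cases "2 * m + b = 0")
      case True
      then have "(\<Union>j<m. R (2 * j + b)) = {}" by simp
      then show ?thesis by (simp add: empty)
    next
      case False
      define \<eta> where "\<eta> = 1 / real (2 * m + b) - 1 / real (2 * m + b + 1)"
      have "0 < \<eta>" using False unfolding \<eta>_def
        by (simp only: diff_gt_0_iff_gt) (intro divide_strict_left_mono mult_pos_pos, auto)
      moreover have "\<eta> \<le> dist x y"
        if x: "x \<in> (\<Union>j<m. R (2 * j + b))" and y: "y \<in> R (2 * m + b)" for x y
      proof -
        obtain j where j: "j < m" "x \<in> R (2 * j + b)" using x by auto
        have "1 / real (2 * m + b) \<le> 1 / real (2 * j + b + 2)"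
          using j by (intro divide_left_mono) auto
        also have "... \<le> g x" using j by (auto simp: R_def)
        finally show ?thesis using y g_lip[of x y] by (auto simp: R_def \<eta>_def)
      qed
      ultimately show ?thesis by (rule separated)
    qed
    also have "(\<Union>j<m. R (2 * j + b)) \<union> R (2 * m + b) = (\<Union>j<Suc m. R (2 * j + b))"
      by (auto simp: less_Suc_eq)
    finally show ?case .
  qed
  have parity': "(\<Sum>j<m. \<mu> (R (2 * j + b))) \<le> \<mu> A" for m b
    by (rule order_trans[OF parity mono]) (auto simp: R_def)
  have "(\<Sum>k<n. \<mu> (R k)) \<le> 2 * \<mu> A" for n
  proof -
    have "(\<Sum>k<n. \<mu> (R k)) \<le> (\<Sum>k<2 * n. \<mu> (R k))"
      by (intro sum_mono2) auto
    also have "... = (\<Sum>j<n. \<mu> (R (2 * j + 0))) + (\<Sum>j<n. \<mu> (R (2 * j + 1)))"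
      by (induction n) (auto simp: algebra_simps)
    also have "... \<le> \<mu> A + \<mu> A" by (intro add_mono parity')
    finally show ?thesis by (simp add: mult_2)
  qed
  then have "(\<Sum>k. \<mu> (R k)) \<le> 2 * \<mu> A"
    by (intro suminf_le_const) auto
  also have "... < \<infinity>" using fin by (simp add: ennreal_mult_less_top)
  finally have sumfin: "(\<Sum>k. \<mu> (R k)) \<noteq> \<infinity>" by simp
  have tail: "(\<lambda>n. \<Sum>k. \<mu> (R (k + n))) \<longlonglongrightarrow> 0"
  proof -
    have "(\<Sum>k. \<mu> (R (k + n))) = (\<Sum>k. \<mu> (R k)) - (\<Sum>k<n. \<mu> (R k))" for n
    proof -
      have eq: "(\<Sum>k. \<mu> (R k)) = (\<Sum>k. \<mu> (R (k + n))) + (\<Sum>k<n. \<mu> (R k))"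
        by (rule suminf_offset) auto
      show ?thesis unfolding eq
        by (subst ennreal_add_diff_cancel_right) (use sumfin eq in auto)
    qed
    moreover have "(\<lambda>n. (\<Sum>k. \<mu> (R k)) - (\<Sum>k<n. \<mu> (R k))) \<longlonglongrightarrow> (\<Sum>k. \<mu> (R k)) - (\<Sum>k. \<mu> (R k))"
      using sumfin by (intro tendsto_diff_ennreal tendsto_const summable_LIMSEQ) auto
    ultimately show ?thesis using sumfin by simp
  qed
  have split: "A - E \<subseteq> U n \<union> (\<Union>k. R (k + n))" for n
  proof
    fix x assume x: "x \<in> A - E"
    show "x \<in> U n \<union> (\<Union>k. R (k + n))"
    proof (cases "x \<in> U n")
      case False
      then have small: "g x < 1 / real (Suc n)" using x by (auto simp: U_def)
      define k where "k = (LEAST m. 1 / real (Suc m) \<le> g x)"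
      have "\<exists>m. 1 / real (Suc m) \<le> g x"
        using reals_Archimedean[OF g_pos[of x]] x by (auto simp: inverse_eq_divide intro: less_imp_le)
      then have k: "1 / real (Suc k) \<le> g x" unfolding k_def by (rule LeastI_ex)
      have "Suc n < Suc k"
      proof (rule ccontr)
        assume "\<not> Suc n < Suc k"
        then have "1 / real (Suc n) \<le> 1 / real (Suc k)" by (intro divide_left_mono) auto
        with k small show False by simp
      qed
      then obtain l where l: "k = Suc (l + n)" by (metis Suc_less_eq less_imp_Suc_add add.commute)
      have "\<not> 1 / real (Suc (l + n)) \<le> g x"
        using not_less_Least[of "l + n" "\<lambda>m. 1 / real (Suc m) \<le> g x"] l k_def by auto
      then have "x \<in> R (l + n)" using k x l by (auto simp: R_def)
      then show ?thesis by blast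
    qed simp
  qed
  have "\<mu> (A \<inter> E) + \<mu> (A - E) \<le> \<mu> A + (\<Sum>k. \<mu> (R (k + n)))" for n
  proof -
    have "\<mu> (U n \<union> (\<Union>k. R (k + n))) \<le> \<mu> (U n) + (\<Sum>k. \<mu> (R (k + n)))"
    proof -
      define B where "B i = (case i of 0 \<Rightarrow> U n | Suc k \<Rightarrow> R (k + n))" for i
      have "U n \<union> (\<Union>k. R (k + n)) = (\<Union>i. B i)"
        unfolding B_def by (auto split: nat.splits)
      moreover have "(\<Sum>i. \<mu> (B i)) = (\<Sum>k. \<mu> (R (k + n))) + \<mu> (U n)"
        by (subst suminf_offset[of _ 1]) (auto simp: B_def)
      ultimately show ?thesis using UN_le[of B] by (simp add: add.commute)
    qed
    then have "\<mu> (A - E) \<le> \<mu> (U n) + (\<Sum>k. \<mu> (R (k + n)))"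
      using mono[OF split[of n]] by (rule order_trans[rotated])
    then have "\<mu> (A \<inter> E) + \<mu> (A - E) \<le> (\<mu> (A \<inter> E) + \<mu> (U n)) + (\<Sum>k. \<mu> (R (k + n)))"
      by (metis add.assoc add_left_mono)
    also have "\<mu> (A \<inter> E) + \<mu> (U n) \<le> \<mu> ((A \<inter> E) \<union> U n)"
    proof (rule separated)
      show "0 < 1 / real (Suc n)" by simp
      fix x y assume "x \<in> A \<inter> E" "y \<in> U n"
      then show "1 / real (Suc n) \<le> dist x y"
        using g_lip[of y x] g_zero[of x] by (auto simp: U_def dist_commute)
    qed
    also have "\<mu> ((A \<inter> E) \<union> U n) \<le> \<mu> A" by (rule mono) (auto simp: U_def)
    finally show ?thesis by (simp add: add_right_mono)
  qed
  moreover have "(\<lambda>n. \<mu> A + (\<Sum>k. \<mu> (R (k + n)))) \<longlonglongrightarrow> \<mu> A + 0"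
    by (intro tendsto_add tendsto_const tail)
  ultimately show ?thesis
    using LIMSEQ_le_const by fastforce
qed

lemma emeasure_hausdorff_measure:
  assumes "A \<in> sets borel"
  shows "emeasure (hausdorff_measure k) A = hausdorff_outer k (A :: 'a::metric_space set)"
proof -
  let ?H = "hausdorff_outer k :: 'a set \<Rightarrow> ennreal"
  have le: "?H A \<le> ?H (A \<inter> E) + ?H (A - E)" for A E
  proof -
    define B where "B i = (case i of 0 \<Rightarrow> A \<inter> E | Suc 0 \<Rightarrow> A - E | _ \<Rightarrow> {})" for i
    have "A \<subseteq> (\<Union>i. B i)"
    proof
      fix x assume "x \<in> A"
      then show "x \<in> (\<Union>i. B i)"
        by (cases "x \<in> E") (auto simp: B_def intro!: exI[of _ "if x \<in> E then 0 else 1"])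
    qed
    then have "?H A \<le> (\<Sum>i. ?H (B i))"
      using hausdorff_outer_mono hausdorff_outer_UN_le by (metis order_trans)
    also have "... = (\<Sum>i<2. ?H (B i))"
      by (rule suminf_finite) (auto simp: B_def hausdorff_outer_empty split: nat.splits)
    also have "... = ?H (A \<inter> E) + ?H (A - E)"
      by (simp add: B_def numeral_2_eq_2)
    finally show ?thesis .
  qed
  have oms: "outer_measure_space (Pow UNIV) ?H"
    unfolding outer_measure_space_def positive_def increasing_def countably_subadditive_def
    by (auto simp: hausdorff_outer_empty hausdorff_outer_mono hausdorff_outer_UN_le)
  interpret sigma_algebra UNIV "Pow UNIV :: 'a set set" by (rule sigma_algebra_Pow)
  let ?L = "lambda_system UNIV (Pow UNIV) ?H"
  have ms: "measure_space UNIV ?L ?H" by (rule caratheodory_lemma[OF oms])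
  have "E \<in> ?L" if "closed E" for E
    unfolding lambda_system_eq
    using metric_outer_measure_closed[of ?H, OF hausdorff_outer_empty hausdorff_outer_mono
        hausdorff_outer_UN_le hausdorff_outer_separated that] le
    by (auto intro!: order_antisym)
  then have "sigma_sets UNIV {E :: 'a set. closed E} \<subseteq> ?L"
    using ms by (intro sigma_algebra.sigma_sets_subset) (auto simp: measure_space_def)
  then have "sets borel \<subseteq> ?L"
    unfolding borel_eq_closed by (simp add: sets_measure_of)
  then have "measure_space UNIV (sets borel) ?H"
    by (rule measure_down[OF ms, rotated]) (metis space_borel sets.sigma_algebra_axioms)
  then show ?thesis
    unfolding hausdorff_measure_def
    by (intro emeasure_measure_of_sigma)
      (use assms in \<open>auto simp: measure_space_def\<close>)
qed

lemma sets_hausdorff_measure [simp, measurable_cong]: "sets (hausdorff_measure k) = sets borel"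
  unfolding hausdorff_measure_def
  by (metis sets.sigma_sets_eq sets_measure_of_conv space_borel top_greatest Pow_UNIV)


section \<open>Hausdorff measure and the volume of thickenings\<close>

definition thickening :: "'a::euclidean_space \<Rightarrow> real \<Rightarrow> 'a set \<Rightarrow> 'a set" where
  "thickening v \<epsilon> S = (\<Union>x\<in>S. ball (x + \<epsilon> *\<^sub>R v) \<epsilon>)"

text \<open>
  The quotient of \<open>unit_ball_vol (d - 1) * \<epsilon> ^ (d - 1)\<close>, the cost of a ball of radius \<open>\<epsilon>\<close>, and the volume of a ball of radius \<open>\<epsilon> / 2\<close>, multiplied by \<open>\<epsilon>\<close>.
\<close>

definition minkowski_const :: "'a::euclidean_space itself \<Rightarrow> real" where
  "minkowski_const _ = unit_ball_vol (real (DIM('a) - 1)) * 2 ^ DIM('a) / unit_ball_vol (real DIM('a))"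

lemma minkowski_const_pos: "minkowski_const TYPE('a::euclidean_space) > 0"
  unfolding minkowski_const_def by simp

lemma open_thickening: "open (thickening v \<epsilon> S)"
  unfolding thickening_def by blast

lemma borel_thickening [measurable]: "thickening v \<epsilon> S \<in> sets borel"
  by (rule borel_open[OF open_thickening])

lemma thickening_mono: "S \<subseteq> T \<Longrightarrow> thickening v \<epsilon> S \<subseteq> thickening v \<epsilon> T"
  unfolding thickening_def by blast

text \<open>
  This is how a thickening is located: it shrinks to \<open>S\<close> at a linear rate in \<open>\<epsilon>\<close>, whatever the shift.
\<close>

lemma thickening_near:
  assumes "y \<in> thickening v \<epsilon> S" "\<epsilon> > 0"
  obtains x where "x \<in> S" "dist y x < \<epsilon> * (1 + norm v)"
proof -
  obtain x where x: "x \<in> S" "dist (x + \<epsilon> *\<^sub>R v) y < \<epsilon>"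
    using assms unfolding thickening_def by auto
  have "dist y x \<le> dist (x + \<epsilon> *\<^sub>R v) y + dist (x + \<epsilon> *\<^sub>R v) x"
    by (rule dist_triangle3)
  also have "... < \<epsilon> + \<epsilon> * norm v" using x assms by (simp add: dist_norm)
  finally show ?thesis using that x by (simp add: algebra_simps)
qed

lemma bounded_thickening:
  assumes "bounded S" "\<epsilon> > 0"
  shows "bounded (thickening v \<epsilon> S)"
proof -
  obtain R where R: "\<And>x. x \<in> S \<Longrightarrow> norm x \<le> R" using assms by (auto simp: bounded_iff)
  have "norm y \<le> R + \<epsilon> * (1 + norm v)" if y: "y \<in> thickening v \<epsilon> S" for y
  proof -
    obtain x where x: "x \<in> S" "dist y x < \<epsilon> * (1 + norm v)"
      using thickening_near[OF y assms(2)] .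
    have "norm y \<le> norm x + dist y x" using norm_triangle_sub[of y x] by (simp add: dist_norm)
    then show ?thesis using x R[of x] by linarith
  qed
  then show ?thesis unfolding bounded_iff by blast
qed

text \<open>
  The balls of radius \<open>\<epsilon>\<close> about a maximal \<open>\<epsilon>\<close>-separated subset of \<open>S\<close> cover \<open>S\<close>, whereas those of
  radius \<open>\<epsilon> / 2\<close> are disjoint; a common translation keeps the latter disjoint and leaves their volume
  unchanged. The number of balls is thus at most the volume of the thickening divided by that of one
  small ball. The shift is what later moves the thickening to one side of the boundary.
\<close>

lemma hausdorff_pre_le_thickening:
  fixes S :: "'a::euclidean_space set"
  assumes "bounded S" "\<epsilon> > 0"
  shows "hausdorff_pre (DIM('a) - 1) (2 * \<epsilon>) S
    \<le> ennreal (minkowski_const TYPE('a) / \<epsilon>) * emeasure lborel (thickening v \<epsilon> S)"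
proof -
  let ?T = "thickening v \<epsilon> S"
  define \<beta> where "\<beta> = unit_ball_vol (real DIM('a)) * (\<epsilon> / 2) ^ DIM('a)"
  have \<beta>: "\<beta> > 0" using assms by (simp add: \<beta>_def)
  define Sep where "Sep = {X. finite X \<and> X \<subseteq> S \<and> (\<forall>x\<in>X. \<forall>y\<in>X. x \<noteq> y \<longrightarrow> \<epsilon> \<le> dist x y)}"
  have Tfin: "emeasure lborel ?T < \<infinity>"
    using bounded_thickening[OF assms] by (rule emeasure_bounded_finite)
  have card_le: "ennreal (real (card X) * \<beta>) \<le> emeasure lborel ?T" if X: "X \<in> Sep" for X
  proof -
    let ?B = "\<lambda>x. ball (x + \<epsilon> *\<^sub>R v) (\<epsilon> / 2)"
    have "disjoint_family_on ?B X"
      unfolding disjoint_family_on_def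
    proof (intro ballI impI)
      fix x y assume xy: "x \<in> X" "y \<in> X" "x \<noteq> y"
      have "\<epsilon> \<le> dist (x + \<epsilon> *\<^sub>R v) (y + \<epsilon> *\<^sub>R v)"
        using X xy by (auto simp: Sep_def)
      then show "?B x \<inter> ?B y = {}" by (intro disjoint_ballI) simp
    qed
    then have "(\<Sum>x\<in>X. emeasure lborel (?B x)) = emeasure lborel (\<Union>x\<in>X. ?B x)"
      using X by (intro sum_emeasure) (auto simp: Sep_def)
    also have "... \<le> emeasure lborel ?T"
    proof (rule emeasure_mono[OF _ borel_thickening[folded sets_lborel]])
      show "(\<Union>x\<in>X. ?B x) \<subseteq> ?T"
        using X assms by (force simp: Sep_def thickening_def)
    qed
    also have "(\<Sum>x\<in>X. emeasure lborel (?B x)) = (\<Sum>x\<in>X. ennreal \<beta>)"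
      using assms by (intro sum.cong) (auto simp: emeasure_ball \<beta>_def)
    also have "... = ennreal (real (card X) * \<beta>)"
      using \<beta> by (simp add: ennreal_mult ennreal_of_nat_eq_real_of_nat)
    finally show ?thesis .
  qed
  obtain m where m: "emeasure lborel ?T \<le> ennreal m" "m \<ge> 0"
    using Tfin by (cases "emeasure lborel ?T") auto
  have "card X \<le> nat \<lceil>m / \<beta>\<rceil>" if "X \<in> Sep" for X
  proof -
    have "ennreal (real (card X) * \<beta>) \<le> ennreal m" using card_le[OF that] m(1) by (rule order_trans)
    then have "real (card X) * \<beta> \<le> m" using m by simp
    then have "real (card X) \<le> m / \<beta>" using \<beta> by (simp add: field_simps)
    then show ?thesis by linarith
  qed
  moreover have "{} \<in> Sep" by (simp add: Sep_def)
  ultimately have "\<exists>X. X \<in> Sep \<and> (\<forall>Y. Y \<in> Sep \<longrightarrow> card Y \<le> card X)"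
    by (intro ex_has_greatest_nat[where k = "{}" and b = "Suc (nat \<lceil>m / \<beta>\<rceil>)"]) (auto simp: less_Suc_eq_le)
  then obtain X where X: "X \<in> Sep" and Xmax: "\<And>Y. Y \<in> Sep \<Longrightarrow> card Y \<le> card X"
    by auto
  have finX: "finite X" using X by (simp add: Sep_def)
  have cover: "\<exists>x\<in>X. dist x y < \<epsilon>" if "y \<in> S" for y
  proof (rule ccontr)
    assume no: "\<not> ?thesis"
    then have "y \<notin> X" using assms by force
    moreover have "insert y X \<in> Sep"
      using X that no by (auto simp: Sep_def dist_commute not_less)
    ultimately show False using Xmax[of "insert y X"] finX by simp
  qed
  obtain xs where xs: "set xs = X" "distinct xs" using finite_distinct_list[OF finX] by blast
  define C where "C i = (if i < length xs then ball (xs ! i) \<epsilon> else {})" for i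
  have "C \<in> fine_covers (2 * \<epsilon>) S"
    unfolding fine_covers_def
  proof (intro CollectI conjI allI subsetI)
    fix y assume "y \<in> S"
    then obtain x where "x \<in> X" "dist x y < \<epsilon>" using cover by blast
    then obtain i where "i < length xs" "xs ! i = x" using xs by (metis in_set_conv_nth)
    then show "y \<in> (\<Union>i. C i)" using \<open>dist x y < \<epsilon>\<close> by (auto simp: C_def intro!: exI[of _ i])
  qed (use assms in \<open>auto simp: C_def\<close>)
  then have "hausdorff_pre (DIM('a) - 1) (2 * \<epsilon>) S \<le> (\<Sum>i. covering_cost (DIM('a) - 1) (C i))"
    by (rule hausdorff_pre_le)
  also have "... = (\<Sum>i<length xs. covering_cost (DIM('a) - 1) (C i))"
    by (rule suminf_finite) (auto simp: C_def)
  also have "... = (\<Sum>i<length xs. ennreal (minkowski_const TYPE('a) / \<epsilon> * \<beta>))"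
  proof (rule sum.cong)
    fix i assume "i \<in> {..<length xs}"
    then have "covering_cost (DIM('a) - 1) (C i) = ennreal (unit_ball_vol (real (DIM('a) - 1)) * \<epsilon> ^ (DIM('a) - 1))"
      using assms by (auto simp: C_def covering_cost_def)
    also have "unit_ball_vol (real (DIM('a) - 1)) * \<epsilon> ^ (DIM('a) - 1) = minkowski_const TYPE('a) / \<epsilon> * \<beta>"
    proof -
      obtain m where m: "DIM('a) = Suc m" using DIM_positive[where 'a='a] gr0_conv_Suc by blast
      have "unit_ball_vol (1 + real m) > 0" by (rule unit_ball_vol_pos) simp
      then have "unit_ball_vol (1 + real m) \<noteq> 0" by linarith
      then show ?thesis using assms by (simp add: minkowski_const_def \<beta>_def power_divide m)
    qed
    finally show "covering_cost (DIM('a) - 1) (C i) = ennreal (minkowski_const TYPE('a) / \<epsilon> * \<beta>)" .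
  qed simp
  also have "... = ennreal (minkowski_const TYPE('a) / \<epsilon>) * ennreal (real (card X) * \<beta>)"
    using xs \<beta> assms minkowski_const_pos[where 'a='a]
    by (simp add: ennreal_mult'[symmetric] ennreal_of_nat_eq_real_of_nat distinct_card[symmetric] mult_ac)
  also have "... \<le> ennreal (minkowski_const TYPE('a) / \<epsilon>) * emeasure lborel ?T"
    by (intro mult_left_mono card_le X) auto
  finally show ?thesis .
qed

text \<open>
  Together with the next estimate this is a discrete layer cake formula: up to one step \<open>\<delta>\<close>, a number equals \<open>\<delta>\<close> times the number of levels below it.
\<close>

lemma level_sum_ge:
  fixes t \<delta> :: real
  assumes "0 < \<delta>"
  shows "t \<le> real J * \<delta> \<Longrightarrow> t \<le> \<delta> + (\<Sum>j<J. if real (Suc j) * \<delta> \<le> t then \<delta> else 0)"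
proof (induction J)
  case 0 then show ?case using assms by simp
next
  case (Suc J)
  show ?case
  proof (cases "t \<le> real J * \<delta>")
    case True
    have "(\<Sum>j<J. if real (Suc j) * \<delta> \<le> t then \<delta> else 0) \<le> (\<Sum>j<Suc J. if real (Suc j) * \<delta> \<le> t then \<delta> else 0)"
      using assms by simp
    with Suc.IH[OF True] show ?thesis by linarith
  next
    case False
    have "(\<Sum>j<J. if real (Suc j) * \<delta> \<le> t then \<delta> else 0) = (\<Sum>j<J. \<delta>)"
    proof (rule sum.cong)
      fix j assume "j \<in> {..<J}"
      then have "real (Suc j) * \<delta> \<le> real J * \<delta>" using assms by (intro mult_right_mono) auto
      then show "(if real (Suc j) * \<delta> \<le> t then \<delta> else 0) = \<delta>" using False by simp
    qed simp
    then have "real J * \<delta> \<le> (\<Sum>j<Suc J. if real (Suc j) * \<delta> \<le> t then \<delta> else 0)"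
      using assms by simp
    then show ?thesis using Suc.prems by (simp add: algebra_simps)
  qed
qed

lemma level_sum_le:
  fixes t \<delta> :: real
  assumes "0 < \<delta>" "0 \<le> t"
  shows "(\<Sum>j<J. if real j * \<delta> \<le> t then \<delta> else 0) \<le> t + \<delta>"
proof (induction J)
  case 0 then show ?case using assms by simp
next
  case (Suc J)
  show ?case
  proof (cases "real J * \<delta> \<le> t")
    case True
    have "(\<Sum>j<J. if real j * \<delta> \<le> t then \<delta> else 0) \<le> (\<Sum>j<J. \<delta>)"
      using assms by (intro sum_mono) auto
    then show ?thesis using True by simp
  next
    case False
    then show ?thesis using Suc by simp
  qed
qed

lemma hausdorff_outer_le_thickening:
  fixes S :: "'a::euclidean_space set"
  assumes "bounded S"
    and A: "eventually (\<lambda>n. emeasure lborel (thickening v (1 / real (Suc n)) S) \<le> ennreal (A / real (Suc n))) sequentially"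
    and "0 \<le> A"
  shows "hausdorff_outer (DIM('a) - 1) S \<le> ennreal (minkowski_const TYPE('a) * A)"
proof (rule tendsto_upperbound[OF hausdorff_pre_tendsto[of 2]])
  let ?K = "minkowski_const TYPE('a)"
  show "eventually (\<lambda>n. hausdorff_pre (DIM('a) - 1) (2 / real (Suc n)) S \<le> ennreal (?K * A)) sequentially"
    using A
  proof eventually_elim
    case (elim n)
    have "hausdorff_pre (DIM('a) - 1) (2 * (1 / real (Suc n))) S
        \<le> ennreal (?K / (1 / real (Suc n))) * emeasure lborel (thickening v (1 / real (Suc n)) S)"
      by (rule hausdorff_pre_le_thickening) (use assms in auto)
    also have "... \<le> ennreal (?K / (1 / real (Suc n))) * ennreal (A / real (Suc n))"
      by (intro mult_left_mono elim) auto
    also have "... = ennreal (?K * A)"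
      using minkowski_const_pos[where 'a='a] \<open>0 \<le> A\<close>
      by (subst ennreal_mult[symmetric]) (auto simp: field_simps)
    finally show ?case by simp
  qed
qed auto

text \<open>
  The comparison of measures passes to integrals through the superlevel sets of \<open>g\<close> at the heights
  \<open>\<delta>, 2 \<delta>, 3 \<delta>\<close> and so on: each is compared with its own thickening, on which \<open>g\<close> is smaller by at most \<open>\<delta>\<close> by
  uniform continuity, and the resulting volumes add up to an integral of \<open>g\<close> over the thickening of
  \<open>S\<close>. All levels are treated at the same scale, which tends to zero before \<open>\<delta>\<close> does.
\<close>

lemma nn_integral_hausdorff_le_thickening:
  fixes S :: "'a::euclidean_space set" and g :: "'a \<Rightarrow> real"
  assumes "bounded S" and [measurable]: "S \<in> sets borel"
    and cont: "continuous_on UNIV g" and g0: "\<And>x. 0 \<le> g x"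
    and A: "eventually (\<lambda>n. emeasure lborel (thickening v (1 / real (Suc n)) S) \<le> ennreal (A / real (Suc n))) sequentially"
    and "0 \<le> A"
    and B: "eventually (\<lambda>n. (\<integral>\<^sup>+x\<in>thickening v (1 / real (Suc n)) S. ennreal (g x) \<partial>lborel) \<le> ennreal (B / real (Suc n))) sequentially"
    and "0 \<le> B"
  shows "(\<integral>\<^sup>+x\<in>S. ennreal (g x) \<partial>hausdorff_measure (DIM('a) - 1)) \<le> ennreal (minkowski_const TYPE('a) * B)"
proof (rule ennreal_le_epsilon)
  let ?K = "minkowski_const TYPE('a)" and ?k = "DIM('a) - 1"
  let ?H = "hausdorff_measure ?k :: 'a measure"
  note K = minkowski_const_pos[where 'a='a]
  have [measurable]: "g \<in> borel_measurable borel"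
    using cont by (rule borel_measurable_continuous_onI)
  fix e :: real assume "0 < e"
  \<comment> \<open>The errors of the two level sums will add up to \<open>2 * ?K * A * \<delta>\<close>.\<close>
  define \<delta> where "\<delta> = e / (2 * ?K * A + 1)"
  have \<delta>: "0 < \<delta>" "\<delta> * (2 * ?K * A) \<le> e"
  proof -
    have pos: "0 < 2 * ?K * A + 1" using K \<open>0 \<le> A\<close> by (simp add: add_nonneg_pos)
    then show "0 < \<delta>" using \<open>0 < e\<close> by (simp add: \<delta>_def)
    have "\<delta> * (2 * ?K * A) \<le> \<delta> * (2 * ?K * A + 1)" using \<open>0 < \<delta>\<close> by simp
    also have "... = e" using pos by (simp add: \<delta>_def)
    finally show "\<delta> * (2 * ?K * A) \<le> e" .
  qed
  obtain R where R: "\<And>x. x \<in> S \<Longrightarrow> norm x \<le> R" using \<open>bounded S\<close> by (auto simp: bounded_iff)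
  have cpt: "compact (cball (0::'a) (R + 1))" by simp
  have cont': "continuous_on (cball 0 (R + 1)) g" using cont by (rule continuous_on_subset) simp
  obtain \<eta> where \<eta>: "\<eta> > 0"
    "\<And>x y. x \<in> cball 0 (R + 1) \<Longrightarrow> y \<in> cball 0 (R + 1) \<Longrightarrow> dist y x < \<eta> \<Longrightarrow> dist (g y) (g x) < \<delta>"
    using compact_uniformly_continuous[OF cont' cpt] \<delta>(1) unfolding uniformly_continuous_on_def by metis
  have near: "g x \<le> g y + \<delta>" if "x \<in> S" "dist y x < min 1 \<eta>" for x y
  proof -
    have "norm y \<le> norm x + dist y x" using norm_triangle_sub[of y x] by (simp add: dist_norm)
    then have "norm y \<le> R + 1" using that R[of x] by linarith
    then have "dist (g y) (g x) < \<delta>" using that R[of x] by (intro \<eta>(2)) auto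
    then show ?thesis by (simp add: dist_real_def)
  qed
  obtain J where J: "\<And>x. x \<in> S \<Longrightarrow> g x \<le> real J * \<delta>"
  proof -
    have "bounded (g ` cball 0 (R + 1))"
      using compact_continuous_image[OF cont' cpt] by (rule compact_imp_bounded)
    then obtain b where "\<forall>y\<in>g ` cball 0 (R + 1). norm y \<le> b"
      unfolding bounded_iff by (elim exE)
    then have b: "\<bar>g x\<bar> \<le> b" if "x \<in> cball 0 (R + 1)" for x
      using that unfolding real_norm_def by (rule bspec[OF _ imageI])
    obtain J where J: "b / \<delta> \<le> real J" using real_arch_simple by blast
    then have "b \<le> real J * \<delta>" using \<delta> by (simp add: field_simps)
    then have "g x \<le> real J * \<delta>" if "x \<in> S" for x using b[of x] R[OF that] by auto
    then show ?thesis using that by blast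
  qed
  define L where "L j = {x\<in>S. real (Suc j) * \<delta> \<le> g x}" for j
  have L_meas [measurable]: "L j \<in> sets borel" for j unfolding L_def by measurable
  have L_bdd: "bounded (L j)" for j using \<open>bounded S\<close> by (rule bounded_subset) (auto simp: L_def)
  have "(\<integral>\<^sup>+x\<in>S. ennreal (g x) \<partial>?H)
      \<le> (\<integral>\<^sup>+x. ennreal \<delta> * indicator S x + (\<Sum>j<J. ennreal \<delta> * indicator (L j) x) \<partial>?H)"
  proof (rule nn_integral_mono)
    fix x
    show "ennreal (g x) * indicator S x \<le> ennreal \<delta> * indicator S x + (\<Sum>j<J. ennreal \<delta> * indicator (L j) x)"
    proof (cases "x \<in> S")
      case True
      have "ennreal (g x) \<le> ennreal (\<delta> + (\<Sum>j<J. if real (Suc j) * \<delta> \<le> g x then \<delta> else 0))"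
        by (intro ennreal_leI level_sum_ge \<delta> J True)
      also have "... = ennreal \<delta> + (\<Sum>j<J. ennreal (if real (Suc j) * \<delta> \<le> g x then \<delta> else 0))"
        using \<delta> by (subst ennreal_plus) (auto intro!: sum_nonneg simp: sum_ennreal)
      also have "(\<Sum>j<J. ennreal (if real (Suc j) * \<delta> \<le> g x then \<delta> else 0)) = (\<Sum>j<J. ennreal \<delta> * indicator (L j) x)"
        using True by (intro sum.cong) (auto simp: L_def)
      finally show ?thesis using True by simp
    qed simp
  qed
  also have "... = ennreal \<delta> * hausdorff_outer ?k S + (\<Sum>j<J. ennreal \<delta> * hausdorff_outer ?k (L j))"
    by (subst nn_integral_add; (subst nn_integral_sum)?)
      (auto simp: nn_integral_cmult_indicator emeasure_hausdorff_measure nn_integral_sum)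
  also have "... \<le> ennreal \<delta> * ennreal (?K * A) + ennreal (?K * (B + \<delta> * A))"
  proof (intro add_mono mult_left_mono hausdorff_outer_le_thickening[OF \<open>bounded S\<close> A \<open>0 \<le> A\<close>])
    show "(\<Sum>j<J. ennreal \<delta> * hausdorff_outer ?k (L j)) \<le> ennreal (?K * (B + \<delta> * A))"
    proof (rule tendsto_upperbound)
      let ?P = "\<lambda>n j. hausdorff_pre ?k (2 / real (Suc n)) (L j)"
      show "(\<lambda>n. \<Sum>j<J. ennreal \<delta> * ?P n j) \<longlonglongrightarrow> (\<Sum>j<J. ennreal \<delta> * hausdorff_outer ?k (L j))"
        by (intro tendsto_sum ennreal_tendsto_cmult hausdorff_pre_tendsto) auto
      have "(\<lambda>n. (1 + norm v) / real (Suc n)) \<longlonglongrightarrow> 0"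
        by (rule LIMSEQ_Suc[OF lim_const_over_n])
      then have "eventually (\<lambda>n. (1 + norm v) / real (Suc n) < min 1 \<eta>) sequentially"
        using \<eta>(1) by (intro order_tendstoD) auto
      then show "eventually (\<lambda>n. (\<Sum>j<J. ennreal \<delta> * ?P n j) \<le> ennreal (?K * (B + \<delta> * A))) sequentially"
        using A B
      proof eventually_elim
        case (elim n)
        define \<epsilon> where "\<epsilon> = 1 / real (Suc n)"
        have \<epsilon>: "\<epsilon> > 0" by (simp add: \<epsilon>_def)
        let ?U = "thickening v \<epsilon> S"
        define V where "V j = ?U \<inter> {y. real j * \<delta> \<le> g y}" for j
        have V_meas [measurable]: "V j \<in> sets borel" for j unfolding V_def by measurable
        have "?P n j \<le> ennreal (?K / \<epsilon>) * emeasure lborel (V j)" for j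
        proof -
          have "thickening v \<epsilon> (L j) \<subseteq> V j"
          proof
            fix y assume y: "y \<in> thickening v \<epsilon> (L j)"
            have "y \<in> ?U" using y thickening_mono[of "L j" S] by (auto simp: L_def)
            moreover obtain x where x: "x \<in> L j" "dist y x < \<epsilon> * (1 + norm v)"
              using thickening_near[OF y \<epsilon>] .
            have "\<epsilon> * (1 + norm v) < min 1 \<eta>" using elim by (simp only: \<epsilon>_def times_divide_eq_left mult_1)
            then have "g x \<le> g y + \<delta>" using x by (intro near) (auto simp: L_def)
            then have "real j * \<delta> \<le> g y" using x by (auto simp: L_def algebra_simps)
            ultimately show "y \<in> V j" by (simp add: V_def)
          qed
          then have "emeasure lborel (thickening v \<epsilon> (L j)) \<le> emeasure lborel (V j)"
            by (rule emeasure_mono) simp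
          moreover have "hausdorff_pre ?k (2 * \<epsilon>) (L j) \<le> ennreal (?K / \<epsilon>) * emeasure lborel (thickening v \<epsilon> (L j))"
            by (rule hausdorff_pre_le_thickening[OF L_bdd \<epsilon>])
          ultimately show ?thesis
            by (simp add: \<epsilon>_def) (meson mult_left_mono order_trans zero_le)
        qed
        then have "(\<Sum>j<J. ennreal \<delta> * ?P n j)
            \<le> (\<Sum>j<J. ennreal \<delta> * (ennreal (?K / \<epsilon>) * emeasure lborel (V j)))"
          by (intro sum_mono mult_left_mono) auto
        also have "... = ennreal (?K / \<epsilon>) * (\<Sum>j<J. ennreal \<delta> * emeasure lborel (V j))"
          by (simp add: sum_distrib_left mult_ac)
        also have "(\<Sum>j<J. ennreal \<delta> * emeasure lborel (V j)) = (\<integral>\<^sup>+y. (\<Sum>j<J. ennreal \<delta> * indicator (V j) y) \<partial>lborel)"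
          by (subst nn_integral_sum) (auto simp: nn_integral_cmult_indicator)
        also have "... \<le> (\<integral>\<^sup>+y. ennreal (g y) * indicator ?U y + ennreal \<delta> * indicator ?U y \<partial>lborel)"
        proof (rule nn_integral_mono)
          fix y
          show "(\<Sum>j<J. ennreal \<delta> * indicator (V j) y) \<le> ennreal (g y) * indicator ?U y + ennreal \<delta> * indicator ?U y"
          proof (cases "y \<in> ?U")
            case True
            then have "(\<Sum>j<J. ennreal \<delta> * indicator (V j) y) = (\<Sum>j<J. ennreal (if real j * \<delta> \<le> g y then \<delta> else 0))"
              by (intro sum.cong) (auto simp: V_def)
            also have "... = ennreal (\<Sum>j<J. if real j * \<delta> \<le> g y then \<delta> else 0)"
              using \<delta> by (intro sum_ennreal) auto
            also have "... \<le> ennreal (g y + \<delta>)"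
              by (intro ennreal_leI level_sum_le \<delta> g0)
            finally show ?thesis using True g0 \<delta> by simp
          qed (simp add: V_def)
        qed
        also have "... = (\<integral>\<^sup>+y\<in>?U. ennreal (g y) \<partial>lborel) + ennreal \<delta> * emeasure lborel ?U"
          by (subst nn_integral_add) (auto simp: nn_integral_cmult_indicator)
        also have "... \<le> ennreal (B * \<epsilon>) + ennreal \<delta> * ennreal (A * \<epsilon>)"
          using elim by (intro add_mono mult_left_mono) (auto simp: \<epsilon>_def)
        also have "... = ennreal ((B + \<delta> * A) * \<epsilon>)"
          using \<epsilon> \<delta> \<open>0 \<le> A\<close> \<open>0 \<le> B\<close>
          by (simp add: ennreal_mult[symmetric] ennreal_plus[symmetric] algebra_simps del: ennreal_plus)
        also have "ennreal (?K / \<epsilon>) * ... = ennreal (?K / \<epsilon> * ((B + \<delta> * A) * \<epsilon>))"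
          using \<epsilon> \<delta> \<open>0 \<le> A\<close> \<open>0 \<le> B\<close> K by (subst ennreal_mult) auto
        also have "?K / \<epsilon> * ((B + \<delta> * A) * \<epsilon>) = ?K * (B + \<delta> * A)"
          using \<epsilon> by simp
        finally show ?case by (simp add: mult_left_mono)
      qed
    qed simp
  qed simp
  also have "... = ennreal (?K * B + \<delta> * (2 * ?K * A))"
    using \<delta> \<open>0 \<le> A\<close> \<open>0 \<le> B\<close> K
    by (simp add: ennreal_mult[symmetric] ennreal_plus[symmetric] algebra_simps del: ennreal_plus)
  also have "... \<le> ennreal (?K * B + e)"
    using \<delta> by (intro ennreal_leI) simp
  also have "... = ennreal (?K * B) + ennreal e"
    using K \<open>0 \<le> B\<close> \<open>0 < e\<close> by (intro ennreal_plus) auto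
  finally show "(\<integral>\<^sup>+x\<in>S. ennreal (g x) \<partial>?H) \<le> ennreal (?K * B) + ennreal e" .
qed

text \<open>
  Every line through \<open>\<Omega>\<close> in a fixed coordinate direction meets the frontier. Hence the columns of height
  \<open>2R\<close> over the members of a cover of the frontier contain \<open>\<Omega>\<close>. A column has volume proportional to the
  \<open>(d - 1)\<close>-st power of the diameter of its base, so a frontier without surface measure would leave
  \<open>\<Omega>\<close> without volume.
\<close>

lemma hausdorff_outer_frontier_pos:
  fixes \<Omega> :: "'a::euclidean_space set"
  assumes "bounded \<Omega>" "open \<Omega>" "\<Omega> \<noteq> {}"
  shows "hausdorff_outer (DIM('a) - 1) (frontier \<Omega>) > 0"
proof (rule ccontr)
  assume "\<not> ?thesis"
  then have zero: "hausdorff_outer (DIM('a) - 1) (frontier \<Omega>) = 0" by simp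
  let ?k = "DIM('a) - 1"
  obtain R where R: "R > 0" "\<And>x. x \<in> \<Omega> \<Longrightarrow> norm x \<le> R"
    using \<open>bounded \<Omega>\<close> by (auto simp: bounded_pos)
  obtain b :: 'a where b: "b \<in> Basis" using nonempty_Basis by blast
  \<comment> \<open>The column over \<open>C\<close> has sides of twice the diameter, centred at an arbitrary point of \<open>C\<close>.\<close>
  define lo hi where "lo C = (\<Sum>j\<in>Basis. (if j = b then - R else (SOME c. c \<in> C) \<bullet> j - diameter C) *\<^sub>R j)"
    and "hi C = (\<Sum>j\<in>Basis. (if j = b then R else (SOME c. c \<in> C) \<bullet> j + diameter C) *\<^sub>R j)" for C :: "'a set"
  define col where "col C = (if C = {} then {} else cbox (lo C) (hi C))" for C
  define c where "c = 2 * R * 4 ^ ?k / unit_ball_vol (real ?k)"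
  have "c > 0" using R by (simp add: c_def)
  have col_meas [measurable]: "col C \<in> sets borel" for C by (simp add: col_def)
  have col_vol: "emeasure lborel (col C) = ennreal c * covering_cost ?k C" if "bounded C" for C
  proof (cases "C = {}")
    case False
    have d0: "diameter C \<ge> 0" using that by (rule diameter_ge_0)
    have "emeasure lborel (cbox (lo C) (hi C)) = ennreal (\<Prod>j\<in>Basis. (hi C - lo C) \<bullet> j)"
      using d0 R by (intro emeasure_lborel_cbox) (auto simp: lo_def hi_def)
    also have "(\<Prod>j\<in>Basis. (hi C - lo C) \<bullet> j) = (\<Prod>j\<in>Basis. if j = b then 2 * R else 2 * diameter C)"
      by (rule prod.cong) (auto simp: lo_def hi_def inner_diff_left)
    also have "... = 2 * R * (2 * diameter C) ^ ?k"
      using b by (subst prod.remove[of _ b]) auto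
    also have "... = c * (unit_ball_vol (real ?k) * (diameter C / 2) ^ ?k)"
    proof -
      have "(4::real) ^ ?k * (diameter C / 2) ^ ?k = (2 * diameter C) ^ ?k"
        by (subst power_mult_distrib[symmetric]) simp
      moreover have "unit_ball_vol (real ?k) \<noteq> 0"
        by (metis less_irrefl of_nat_0_le_iff unit_ball_vol_pos)
      ultimately show ?thesis by (simp add: c_def)
    qed
    finally show ?thesis
      using False \<open>c > 0\<close> d0 by (simp add: col_def covering_cost_def ennreal_mult)
  qed (simp add: col_def)
  have small: "emeasure lborel \<Omega> \<le> ennreal e" if "e > 0" for e
  proof -
    have "hausdorff_pre ?k 1 (frontier \<Omega>) \<le> hausdorff_outer ?k (frontier \<Omega>)"
      unfolding hausdorff_outer_eq_SUP_pre by (rule SUP_upper) simp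
    then have "hausdorff_pre ?k 1 (frontier \<Omega>) < ennreal (e / c)"
      using zero that \<open>c > 0\<close> by simp
    then obtain C where C: "C \<in> fine_covers 1 (frontier \<Omega>)" "(\<Sum>i. covering_cost ?k (C i)) < ennreal (e / c)"
      unfolding hausdorff_pre_def INF_less_iff by blast
    have "\<Omega> \<subseteq> (\<Union>i. col (C i))"
    proof
      fix x assume x: "x \<in> \<Omega>"
      let ?ray = "(\<lambda>t. x + t *\<^sub>R b) ` {0..}"
      have "connected ?ray"
        by (intro connected_continuous_image continuous_intros) simp
      moreover have "?ray \<inter> \<Omega> \<noteq> {}" using x by force
      moreover have "?ray - \<Omega> \<noteq> {}"
      proof -
        have "x + (2 * R + 1) *\<^sub>R b \<notin> \<Omega>"
        proof
          assume "x + (2 * R + 1) *\<^sub>R b \<in> \<Omega>"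
          then have "norm (x + (2 * R + 1) *\<^sub>R b) \<le> R" using R by blast
          moreover have "norm ((2 * R + 1) *\<^sub>R b) \<le> norm (x + (2 * R + 1) *\<^sub>R b) + norm x"
            by (metis add.commute add_diff_cancel_left' norm_triangle_sub norm_minus_commute add_diff_cancel norm_triangle_ineq4)
          ultimately show False using R(1) R(2)[OF x] b by simp
        qed
        moreover have "x + (2 * R + 1) *\<^sub>R b \<in> ?ray" using R by (intro imageI) simp
        ultimately show ?thesis by blast
      qed
      ultimately have "?ray \<inter> frontier \<Omega> \<noteq> {}" by (rule connected_Int_frontier)
      then obtain t where t: "x + t *\<^sub>R b \<in> frontier \<Omega>" by auto
      then obtain i where i: "x + t *\<^sub>R b \<in> C i" using C by (auto simp: fine_covers_def)
      let ?c = "SOME c. c \<in> C i"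
      have c: "?c \<in> C i" using i by (rule someI)
      have "lo (C i) \<bullet> j \<le> x \<bullet> j \<and> x \<bullet> j \<le> hi (C i) \<bullet> j" if j: "j \<in> Basis" for j
      proof (cases "j = b")
        case True
        have "\<bar>x \<bullet> b\<bar> \<le> norm x" using b by (rule Basis_le_norm)
        then show ?thesis using True R(2)[OF x] b by (auto simp: lo_def hi_def)
      next
        case False
        have "x \<bullet> j = (x + t *\<^sub>R b) \<bullet> j" using False j b by (simp add: inner_add_left inner_Basis)
        moreover have "\<bar>(x + t *\<^sub>R b - ?c) \<bullet> j\<bar> \<le> norm (x + t *\<^sub>R b - ?c)" using j by (rule Basis_le_norm)
        moreover have "dist (x + t *\<^sub>R b) ?c \<le> diameter (C i)"
          using C i c by (intro diameter_bounded_bound) (auto simp: fine_covers_def)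
        ultimately show ?thesis using False j
          by (auto simp: lo_def hi_def dist_norm inner_diff_left)
      qed
      then have "x \<in> col (C i)" using i by (auto simp: col_def mem_box)
      then show "x \<in> (\<Union>i. col (C i))" by blast
    qed
    then have "emeasure lborel \<Omega> \<le> emeasure lborel (\<Union>i. col (C i))"
      by (rule emeasure_mono) auto
    also have "... \<le> (\<Sum>i. emeasure lborel (col (C i)))"
      by (rule emeasure_subadditive_countably) auto
    also have "... = (\<Sum>i. ennreal c * covering_cost ?k (C i))"
      using C by (intro suminf_cong col_vol) (auto simp: fine_covers_def)
    also have "... = ennreal c * (\<Sum>i. covering_cost ?k (C i))" by simp
    also have "... \<le> ennreal c * ennreal (e / c)"
      using C by (intro mult_left_mono) auto
    also have "... = ennreal e"
      using \<open>c > 0\<close> that by (simp add: ennreal_mult[symmetric])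
    finally show ?thesis .
  qed
  have "emeasure lborel \<Omega> \<le> 0"
  proof (rule ennreal_le_epsilon)
    fix e :: real assume "0 < e"
    then show "emeasure lborel \<Omega> \<le> 0 + ennreal e" using small by simp
  qed
  then have "emeasure lborel \<Omega> = 0" by simp
  moreover obtain x r where "r > 0" "ball x r \<subseteq> \<Omega>"
    using assms by (metis openE ex_in_conv)
  then have "emeasure lborel (ball x r) \<le> emeasure lborel \<Omega>"
    using \<open>open \<Omega>\<close> by (intro emeasure_mono) auto
  moreover have "emeasure lborel (ball x r) > 0"
    using \<open>r > 0\<close> by (simp add: emeasure_ball)
  ultimately show False by simp
qed


section \<open>Lipschitz charts and the trace inequality\<close>

text \<open>
  Inequalities are stated for such pairs on the whole space rather than for smooth functions, as only one continuous derivative is ever used and constants may be subtracted freely.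
\<close>

definition C1_gradient :: "('a::euclidean_space \<Rightarrow> real) \<Rightarrow> ('a \<Rightarrow> 'a) \<Rightarrow> bool" where
  "C1_gradient \<phi> G \<longleftrightarrow> (\<forall>x. (\<phi> has_derivative (\<lambda>h. G x \<bullet> h)) (at x)) \<and> continuous_on UNIV G"

lemma C1_gradient_const: "C1_gradient (\<lambda>_. c) (\<lambda>_. 0)"
  by (simp add: C1_gradient_def)

lemma C1_gradient_diff_const:
  "C1_gradient \<phi> G \<Longrightarrow> C1_gradient (\<lambda>x. \<phi> x - c) G"
  unfolding C1_gradient_def by (auto intro!: has_derivative_diff[where g' = "\<lambda>_. 0", simplified])

lemma C1_gradient_continuous:
  assumes "C1_gradient \<phi> G"
  shows "continuous_on UNIV \<phi>" "continuous_on UNIV G"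
  using assms unfolding C1_gradient_def
  by (auto intro!: continuous_at_imp_continuous_on intro: has_derivative_continuous)

lemma C1_gradient_measurable:
  assumes "C1_gradient \<phi> G"
  shows "\<phi> \<in> borel_measurable borel" "G \<in> borel_measurable borel"
  using C1_gradient_continuous[OF assms] by (auto intro: borel_measurable_continuous_onI)

lemma C1_segment_le:
  assumes C1: "C1_gradient \<phi> G" and "0 \<le> s"
  shows "ennreal \<bar>\<phi> (y + s *\<^sub>R w) - \<phi> y\<bar> \<le> ennreal (norm w) * (\<integral>\<^sup>+t\<in>{0..s}. ennreal (norm (G (y + t *\<^sub>R w))) \<partial>lborel)"
proof -
  note [measurable] = C1_gradient_measurable[OF C1]
  let ?F = "\<lambda>t. \<phi> (y + t *\<^sub>R w)" and ?f = "\<lambda>t. G (y + t *\<^sub>R w) \<bullet> w"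
  have D: "(\<phi> has_derivative (\<lambda>h. G x \<bullet> h)) (at x)" for x using C1 by (simp add: C1_gradient_def)
  have "(?F has_vector_derivative ?f t) (at t within {0..s})" for t
    unfolding has_vector_derivative_def
    by (rule has_derivative_eq_rhs, rule has_derivative_compose[OF _ D])
      (auto intro!: derivative_eq_intros)
  moreover have "continuous_on {0..s} ?f"
    by (intro continuous_intros continuous_on_compose2[OF C1_gradient_continuous(2)[OF C1]]) auto
  ultimately have "has_bochner_integral lborel (\<lambda>t. indicator {0..s} t *\<^sub>R ?f t) (?F s - ?F 0)"
    by (intro has_bochner_integral_FTC_Icc \<open>0 \<le> s\<close>)
  then have "ennreal (norm (?F s - ?F 0)) \<le> (\<integral>\<^sup>+t. ennreal (norm (indicator {0..s} t *\<^sub>R ?f t)) \<partial>lborel)"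
    by (rule has_bochner_integral_norm_bound)
  also have "... \<le> (\<integral>\<^sup>+t. ennreal (norm w) * (ennreal (norm (G (y + t *\<^sub>R w))) * indicator {0..s} t) \<partial>lborel)"
    using Cauchy_Schwarz_ineq2
    by (intro nn_integral_mono)
      (auto simp: ennreal_mult'[symmetric] mult.commute[of "norm w"] intro!: ennreal_leI split: split_indicator)
  also have "... = ennreal (norm w) * (\<integral>\<^sup>+t\<in>{0..s}. ennreal (norm (G (y + t *\<^sub>R w))) \<partial>lborel)"
    by (rule nn_integral_cmult) measurable
  finally show ?thesis by simp
qed

lemma nn_integral_lborel_translate:
  fixes w :: "'a::euclidean_space"
  assumes "k \<in> borel_measurable borel"
  shows "(\<integral>\<^sup>+y. k (y + w) \<partial>lborel) = (\<integral>\<^sup>+y. k y \<partial>lborel)"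
proof -
  have "(\<integral>\<^sup>+y. k y \<partial>lborel) = (\<integral>\<^sup>+y. k y \<partial>distr lborel borel ((+) w))"
    by (simp only: lborel_distr_plus)
  also have "... = (\<integral>\<^sup>+y. k (w + y) \<partial>lborel)"
    using assms by (intro nn_integral_distr) auto
  finally show ?thesis by (simp add: add.commute)
qed

text \<open>
  After exchanging the integrals, what counts at a point \<open>z\<close> is for how long the moving set \<open>T + t e\<close> covers
  it. For a layer of thickness \<open>\<tau>\<close> crossed at unit speed this is at most \<open>\<tau>\<close>; for an arbitrary set it
  is at most the total time.
\<close>

lemma nn_integral_translates_le:
  fixes k :: "'a::euclidean_space \<Rightarrow> ennreal"
  assumes [measurable]: "k \<in> borel_measurable borel" "T \<in> sets borel" "\<Omega> \<in> sets borel" and "0 \<le> \<tau>"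
    and times: "\<And>z t. t \<in> {0..\<eta>} \<Longrightarrow> z - t *\<^sub>R e \<in> T \<Longrightarrow> t \<in> {a z..a z + \<tau>}"
    and sub: "\<And>y t. y \<in> T \<Longrightarrow> t \<in> {0..\<eta>} \<Longrightarrow> y + t *\<^sub>R e \<in> \<Omega>"
  shows "(\<integral>\<^sup>+y\<in>T. (\<integral>\<^sup>+t\<in>{0..\<eta>}. k (y + t *\<^sub>R e) \<partial>lborel) \<partial>lborel) \<le> ennreal \<tau> * (\<integral>\<^sup>+z\<in>\<Omega>. k z \<partial>lborel)"
proof -
  have "(\<integral>\<^sup>+y\<in>T. (\<integral>\<^sup>+t\<in>{0..\<eta>}. k (y + t *\<^sub>R e) \<partial>lborel) \<partial>lborel)
     = (\<integral>\<^sup>+y. (\<integral>\<^sup>+t. k (y + t *\<^sub>R e) * indicator {0..\<eta>} t * indicator T y \<partial>lborel) \<partial>lborel)"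
    by (intro nn_integral_cong nn_integral_multc[symmetric]) measurable
  also have "... = (\<integral>\<^sup>+t. (\<integral>\<^sup>+y. k (y + t *\<^sub>R e) * indicator {0..\<eta>} t * indicator T y \<partial>lborel) \<partial>lborel)"
    by (rule lborel_pair.Fubini'[symmetric]) measurable
  also have "... = (\<integral>\<^sup>+t. (\<integral>\<^sup>+z. k z * indicator {0..\<eta>} t * indicator T (z - t *\<^sub>R e) \<partial>lborel) \<partial>lborel)"
  proof (rule nn_integral_cong)
    fix t :: real
    show "(\<integral>\<^sup>+y. k (y + t *\<^sub>R e) * indicator {0..\<eta>} t * indicator T y \<partial>lborel)
       = (\<integral>\<^sup>+z. k z * indicator {0..\<eta>} t * indicator T (z - t *\<^sub>R e) \<partial>lborel)"
      by (subst nn_integral_lborel_translate[where w = "t *\<^sub>R e", symmetric]) simp_all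
  qed
  also have "... = (\<integral>\<^sup>+z. (\<integral>\<^sup>+t. k z * indicator {0..\<eta>} t * indicator T (z - t *\<^sub>R e) \<partial>lborel) \<partial>lborel)"
    by (rule lborel_pair.Fubini') measurable
  also have "... \<le> (\<integral>\<^sup>+z. ennreal \<tau> * (k z * indicator \<Omega> z) \<partial>lborel)"
  proof (rule nn_integral_mono)
    fix z
    have "(\<integral>\<^sup>+t. k z * indicator {0..\<eta>} t * indicator T (z - t *\<^sub>R e) \<partial>lborel)
       \<le> (\<integral>\<^sup>+t. k z * indicator \<Omega> z * indicator {a z..a z + \<tau>} t \<partial>lborel)"
    proof (rule nn_integral_mono)
      fix t
      show "k z * indicator {0..\<eta>} t * indicator T (z - t *\<^sub>R e) \<le> k z * indicator \<Omega> z * indicator {a z..a z + \<tau>} t"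
        using sub[of "z - t *\<^sub>R e" t] times[of t z]
        by (auto split: split_indicator)
    qed
    also have "... = k z * indicator \<Omega> z * ennreal \<tau>"
      using \<open>0 \<le> \<tau>\<close> by (subst nn_integral_cmult_indicator) auto
    finally show "(\<integral>\<^sup>+t. k z * indicator {0..\<eta>} t * indicator T (z - t *\<^sub>R e) \<partial>lborel) \<le> ennreal \<tau> * (k z * indicator \<Omega> z)"
      by (simp add: mult_ac)
  qed
  also have "... = ennreal \<tau> * (\<integral>\<^sup>+z\<in>\<Omega>. k z \<partial>lborel)"
    by (rule nn_integral_cmult) measurable
  finally show ?thesis .
qed

text \<open>
  At each point of the layer, \<open>|\<phi>|\<close> is bounded by its value further along \<open>e\<close> plus the integral of the
  gradient on the way. Averaging over the distance \<open>t\<close> in \<open>{0..\<eta>}\<close> makes both contributions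
  integrals over translated layers.
\<close>

lemma C1_layer_integral_le:
  fixes \<phi> :: "'a::euclidean_space \<Rightarrow> real"
  assumes C1: "C1_gradient \<phi> G" and [measurable]: "T \<in> sets borel" "\<Omega> \<in> sets borel"
    and F: "\<And>y t. F (y + t *\<^sub>R e) = F y + t" "\<And>y. y \<in> T \<Longrightarrow> F y \<in> {0..\<tau>}" and "0 \<le> \<tau>" "norm e = 1"
    and sub: "\<And>y t. y \<in> T \<Longrightarrow> t \<in> {0..\<eta>} \<Longrightarrow> y + t *\<^sub>R e \<in> \<Omega>" and "0 < \<eta>"
  shows "ennreal \<eta> * (\<integral>\<^sup>+y\<in>T. ennreal \<bar>\<phi> y\<bar> \<partial>lborel)
    \<le> ennreal \<tau> * ((\<integral>\<^sup>+z\<in>\<Omega>. ennreal \<bar>\<phi> z\<bar> \<partial>lborel) + ennreal \<eta> * (\<integral>\<^sup>+z\<in>\<Omega>. ennreal (norm (G z)) \<partial>lborel))"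
proof -
  note [measurable] = C1_gradient_measurable[OF C1]
  have times: "t \<in> {F z - \<tau>..F z - \<tau> + \<tau>}" if "z - t *\<^sub>R e \<in> T" for z t
    using F(2)[OF that] F(1)[of "z - t *\<^sub>R e" t] by auto
  define P where "P y = (\<integral>\<^sup>+t\<in>{0..\<eta>}. ennreal \<bar>\<phi> (y + t *\<^sub>R e)\<bar> \<partial>lborel)" for y
  define Q where "Q y = (\<integral>\<^sup>+t\<in>{0..\<eta>}. ennreal (norm (G (y + t *\<^sub>R e))) \<partial>lborel)" for y
  have [measurable]: "P \<in> borel_measurable borel" "Q \<in> borel_measurable borel"
    unfolding P_def Q_def by measurable
  have pt: "ennreal \<eta> * ennreal \<bar>\<phi> y\<bar> \<le> P y + ennreal \<eta> * Q y" for y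
  proof -
    have "ennreal \<bar>\<phi> y\<bar> \<le> ennreal \<bar>\<phi> (y + t *\<^sub>R e)\<bar> + Q y" if t: "t \<in> {0..\<eta>}" for t
    proof -
      have "ennreal \<bar>\<phi> y\<bar> \<le> ennreal (\<bar>\<phi> (y + t *\<^sub>R e)\<bar> + \<bar>\<phi> (y + t *\<^sub>R e) - \<phi> y\<bar>)"
        by (intro ennreal_leI) linarith
      also have "... = ennreal \<bar>\<phi> (y + t *\<^sub>R e)\<bar> + ennreal \<bar>\<phi> (y + t *\<^sub>R e) - \<phi> y\<bar>"
        by (rule ennreal_plus) auto
      also have "ennreal \<bar>\<phi> (y + t *\<^sub>R e) - \<phi> y\<bar> \<le> (\<integral>\<^sup>+s\<in>{0..t}. ennreal (norm (G (y + s *\<^sub>R e))) \<partial>lborel)"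
        using C1_segment_le[OF C1, of t y e] t \<open>norm e = 1\<close> by simp
      also have "... \<le> Q y"
        unfolding Q_def by (rule nn_set_integral_set_mono) (use t in auto)
      finally show ?thesis by (simp add: add_left_mono)
    qed
    then have "(\<integral>\<^sup>+t\<in>{0..\<eta>}. ennreal \<bar>\<phi> y\<bar> \<partial>lborel) \<le> (\<integral>\<^sup>+t\<in>{0..\<eta>}. (ennreal \<bar>\<phi> (y + t *\<^sub>R e)\<bar> + Q y) \<partial>lborel)"
      by (intro nn_integral_mono) (auto split: split_indicator)
    also have "... = P y + (\<integral>\<^sup>+t\<in>{0..\<eta>}. Q y \<partial>lborel)"
      unfolding P_def by (rule nn_set_integral_add) measurable
    finally show ?thesis
      using \<open>0 < \<eta>\<close> by (simp add: nn_integral_cmult_indicator mult.commute)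
  qed
  have "ennreal \<eta> * (\<integral>\<^sup>+y\<in>T. ennreal \<bar>\<phi> y\<bar> \<partial>lborel) = (\<integral>\<^sup>+y\<in>T. (ennreal \<eta> * ennreal \<bar>\<phi> y\<bar>) \<partial>lborel)"
    by (subst nn_integral_cmult[symmetric]) (auto simp: mult_ac)
  also have "... \<le> (\<integral>\<^sup>+y\<in>T. (P y + ennreal \<eta> * Q y) \<partial>lborel)"
    using pt by (intro nn_integral_mono) (auto split: split_indicator)
  also have "... = (\<integral>\<^sup>+y\<in>T. P y \<partial>lborel) + (\<integral>\<^sup>+y\<in>T. (ennreal \<eta> * Q y) \<partial>lborel)"
    by (rule nn_set_integral_add) measurable
  also have "(\<integral>\<^sup>+y\<in>T. (ennreal \<eta> * Q y) \<partial>lborel) = ennreal \<eta> * (\<integral>\<^sup>+y\<in>T. Q y \<partial>lborel)"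
    by (subst nn_integral_cmult[symmetric]) (auto simp: mult_ac)
  also have "(\<integral>\<^sup>+y\<in>T. P y \<partial>lborel) + ennreal \<eta> * (\<integral>\<^sup>+y\<in>T. Q y \<partial>lborel)
     \<le> ennreal \<tau> * (\<integral>\<^sup>+z\<in>\<Omega>. ennreal \<bar>\<phi> z\<bar> \<partial>lborel) + ennreal \<eta> * (ennreal \<tau> * (\<integral>\<^sup>+z\<in>\<Omega>. ennreal (norm (G z)) \<partial>lborel))"
    unfolding P_def Q_def
    by (intro add_mono mult_left_mono nn_integral_translates_le[where a = "\<lambda>z. F z - \<tau>"] times sub) (use assms in auto)
  finally show ?thesis by (simp add: distrib_left mult_ac)
qed

text \<open>
  The function \<open>F\<close> is the height above the graph. Apart from its sign, only its Lipschitz bound and its unit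
  speed in the direction \<open>e\<close> are ever used of a chart, so no coordinates on the hyperplane are needed.
\<close>

lemma lipschitz_boundary_chart:
  fixes \<Omega> :: "'a::euclidean_space set"
  assumes "lipschitz_boundary \<Omega>" "open \<Omega>" "x \<in> frontier \<Omega>"
  obtains e F M r where "norm e = 1" "M > 0" "r > 0"
    "\<And>y z. \<bar>F y - F z\<bar> \<le> M * dist y z" "continuous_on UNIV F" "\<And>y t. F (y + t *\<^sub>R e) = F y + t"
    "\<And>y. y \<in> ball x r \<Longrightarrow> y \<in> \<Omega> \<longleftrightarrow> 0 < F y"
    "\<And>y. y \<in> ball x r \<Longrightarrow> y \<in> frontier \<Omega> \<Longrightarrow> F y = (0::real)"
proof -
  obtain e h L r where e: "norm e = 1" and r: "r > 0" and h: "L-lipschitz_on {z. z \<bullet> e = 0} h"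
    and eq: "\<Omega> \<inter> ball x r = {y \<in> ball x r. (h (y - (y \<bullet> e) *\<^sub>R e) :: real) < y \<bullet> e}"
    using assms(1,3) unfolding lipschitz_boundary_def by blast
  have ee: "e \<bullet> e = 1" using e by (simp add: dot_square_norm)
  define F where "F y = y \<bullet> e - h (y - (y \<bullet> e) *\<^sub>R e)" for y
  define M where "M = 1 + 2 * L"
  have L: "0 \<le> L" using h by (rule lipschitz_on_nonneg)
  have lip: "\<bar>F y - F z\<bar> \<le> M * dist y z" for y z
  proof -
    have a: "\<bar>(y - z) \<bullet> e\<bar> \<le> norm (y - z)" using Cauchy_Schwarz_ineq2[of "y - z" e] e by simp
    have "dist (h (y - (y \<bullet> e) *\<^sub>R e)) (h (z - (z \<bullet> e) *\<^sub>R e)) \<le> L * dist (y - (y \<bullet> e) *\<^sub>R e) (z - (z \<bullet> e) *\<^sub>R e)"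
      by (rule lipschitz_onD[OF h]) (auto simp: inner_diff_left ee)
    also have "dist (y - (y \<bullet> e) *\<^sub>R e) (z - (z \<bullet> e) *\<^sub>R e) = norm ((y - z) - ((y - z) \<bullet> e) *\<^sub>R e)"
      by (simp add: dist_norm inner_diff_left algebra_simps)
    also have "... \<le> norm (y - z) + norm (((y - z) \<bullet> e) *\<^sub>R e)" by (rule norm_triangle_ineq4)
    also have "... \<le> 2 * norm (y - z)" using a e by simp
    finally have "\<bar>h (y - (y \<bullet> e) *\<^sub>R e) - h (z - (z \<bullet> e) *\<^sub>R e)\<bar> \<le> L * (2 * norm (y - z))"
      using L by (simp add: dist_real_def mult_left_mono)
    moreover have "(y - z) \<bullet> e = y \<bullet> e - z \<bullet> e" by (rule inner_diff_left)
    ultimately show ?thesis using a unfolding F_def M_def dist_norm by (simp add: algebra_simps)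
  qed
  have shift: "F (y + t *\<^sub>R e) = F y + t" for y t
    by (simp add: F_def inner_add_left ee algebra_simps)
  have mem: "y \<in> \<Omega> \<longleftrightarrow> 0 < F y" if "y \<in> ball x r" for y
  proof -
    have "y \<in> \<Omega> \<inter> ball x r \<longleftrightarrow> y \<in> {y \<in> ball x r. h (y - (y \<bullet> e) *\<^sub>R e) < y \<bullet> e}"
      by (simp only: eq)
    then show ?thesis using that unfolding F_def Int_iff mem_Collect_eq by linarith
  qed
  have "M-lipschitz_on UNIV F"
  proof (rule lipschitz_onI)
    show "dist (F y) (F z) \<le> M * dist y z" for y z unfolding dist_real_def by (rule lip)
    show "0 \<le> M" using L by (simp add: M_def)
  qed
  then have cont: "continuous_on UNIV F" by (rule lipschitz_on_continuous_on)
  have zero: "F y = 0" if y: "y \<in> ball x r" "y \<in> frontier \<Omega>" for y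
  proof -
    have "\<not> 0 < F y" using y mem assms(2) by (auto simp: frontier_def interior_open)
    moreover have "\<not> F y < 0"
    proof
      assume "F y < 0"
      have "open ({z. F z < 0} \<inter> ball x r)"
        using cont by (intro open_Int open_Collect_less) auto
      moreover have "y \<in> {z. F z < 0} \<inter> ball x r" using y \<open>F y < 0\<close> by simp
      moreover have "y \<in> closure \<Omega>" using y by (simp add: frontier_def)
      ultimately have "\<Omega> \<inter> ({z. F z < 0} \<inter> ball x r) \<noteq> {}"
        by (metis closure_iff_nhds_not_empty inf_commute order_refl)
      then show False using mem by force
    qed
    ultimately show ?thesis by simp
  qed
  show ?thesis
  proof (rule that[OF e _ r lip cont shift mem zero])
    show "M > 0" using L by (simp add: M_def)
  qed
qed

text \<open>
  Local statements are globalised by this principle both for the trace inequality and for the Poincare inequality.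
\<close>

lemma compact_finite_union_property:
  assumes "compact K" "P {}" and Un: "\<And>A B. P A \<Longrightarrow> P B \<Longrightarrow> P (A \<union> B)"
    and loc: "\<And>x. x \<in> K \<Longrightarrow> \<exists>U. open U \<and> x \<in> U \<and> P (U \<inter> K)"
  shows "P K"
proof -
  obtain U where U: "\<And>x. x \<in> K \<Longrightarrow> open (U x)" "\<And>x. x \<in> K \<Longrightarrow> x \<in> U x" "\<And>x. x \<in> K \<Longrightarrow> P (U x \<inter> K)"
    using loc by metis
  obtain D where D: "D \<subseteq> K" "finite D" "K \<subseteq> (\<Union>x\<in>D. U x)"
    using U by (elim compactE_image[OF assms(1), of K U]) auto
  have "P (\<Union>x\<in>D. U x \<inter> K)"
    using \<open>finite D\<close> D(1) by induction (use assms(2) Un U(3) in auto)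
  also have "(\<Union>x\<in>D. U x \<inter> K) = K" using D by auto
  finally show ?thesis .
qed

definition L1_norm_C1 :: "'a::euclidean_space set \<Rightarrow> ('a \<Rightarrow> real) \<Rightarrow> ('a \<Rightarrow> 'a) \<Rightarrow> ennreal" where
  "L1_norm_C1 \<Omega> \<phi> G = (\<integral>\<^sup>+x\<in>\<Omega>. ennreal \<bar>\<phi> x\<bar> \<partial>lborel) + (\<integral>\<^sup>+x\<in>\<Omega>. ennreal (norm (G x)) \<partial>lborel)"

lemma continuous_bounded_on_closure:
  fixes h :: "'a::euclidean_space \<Rightarrow> 'b::real_normed_vector"
  assumes "bounded S" "continuous_on UNIV h"
  obtains b where "b > 0" "\<And>x. x \<in> closure S \<Longrightarrow> norm (h x) \<le> b"
proof -
  have "bounded (h ` closure S)"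
    using assms by (intro compact_imp_bounded compact_continuous_image)
      (auto simp: compact_closure intro: continuous_on_subset)
  then obtain b where "b > 0" "\<forall>y\<in>h ` closure S. norm y \<le> b" unfolding bounded_pos by blast
  then show ?thesis using that[of b] by simp
qed

lemma nn_set_integral_continuous_finite:
  fixes g :: "'a::euclidean_space \<Rightarrow> real"
  assumes "bounded \<Omega>" "continuous_on UNIV g"
  shows "(\<integral>\<^sup>+x\<in>\<Omega>. ennreal (g x) \<partial>lborel) < \<infinity>"
proof -
  have [measurable]: "g \<in> borel_measurable borel" using assms by (intro borel_measurable_continuous_onI)
  obtain b where b: "\<And>x. x \<in> closure \<Omega> \<Longrightarrow> norm (g x) \<le> b"
    by (rule continuous_bounded_on_closure[OF assms]) (rule that)
  have "(\<integral>\<^sup>+x\<in>\<Omega>. ennreal (g x) \<partial>lborel) \<le> (\<integral>\<^sup>+x. ennreal b * indicator (closure \<Omega>) x \<partial>lborel)"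
  proof (rule nn_integral_mono)
    fix x
    show "ennreal (g x) * indicator \<Omega> x \<le> ennreal b * indicator (closure \<Omega>) x"
      using b[of x] closure_subset[of \<Omega>] by (auto intro!: ennreal_leI split: split_indicator)
  qed
  also have "... = ennreal b * emeasure lborel (closure \<Omega>)"
    by (rule nn_integral_cmult_indicator) simp
  also have "... < \<infinity>"
    using emeasure_bounded_finite[of "closure \<Omega>"] assms by (simp add: ennreal_mult_less_top bounded_closure)
  finally show ?thesis .
qed

lemma L1_norm_C1_finite:
  assumes "bounded \<Omega>" "C1_gradient \<phi> G"
  shows "L1_norm_C1 \<Omega> \<phi> G < \<infinity>"
  using assms C1_gradient_continuous[OF assms(2)]
    nn_set_integral_continuous_finite[OF assms(1), of "\<lambda>x. \<bar>\<phi> x\<bar>"]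
    nn_set_integral_continuous_finite[OF assms(1), of "\<lambda>x. norm (G x)"]
  unfolding L1_norm_C1_def by (simp add: continuous_on_rabs continuous_on_norm)

text \<open>
  Borel measurability is included so that the property is closed under unions, the form in which it is globalised.
\<close>

definition trace_controlled :: "'a::euclidean_space set \<Rightarrow> 'a set \<Rightarrow> bool" where
  "trace_controlled \<Omega> S \<longleftrightarrow> S \<in> sets borel \<and> (\<exists>C\<ge>0. \<forall>\<phi> G. C1_gradient \<phi> G \<longrightarrow>
     (\<integral>\<^sup>+x\<in>S. ennreal \<bar>\<phi> x\<bar> \<partial>hausdorff_measure (DIM('a) - 1)) \<le> ennreal C * L1_norm_C1 \<Omega> \<phi> G)"

lemma trace_controlled_Un:
  fixes \<Omega> :: "'a::euclidean_space set"
  assumes "trace_controlled \<Omega> S" "trace_controlled \<Omega> T"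
  shows "trace_controlled \<Omega> (S \<union> T)"
proof -
  let ?H = "hausdorff_measure (DIM('a) - 1) :: 'a measure"
  from assms obtain C D where [measurable]: "S \<in> sets borel" "T \<in> sets borel" and CD: "C \<ge> 0" "D \<ge> 0"
    and C: "\<And>\<phi> G. C1_gradient \<phi> G \<Longrightarrow> (\<integral>\<^sup>+x\<in>S. ennreal \<bar>\<phi> x\<bar> \<partial>?H) \<le> ennreal C * L1_norm_C1 \<Omega> \<phi> G"
    and D: "\<And>\<phi> G. C1_gradient \<phi> G \<Longrightarrow> (\<integral>\<^sup>+x\<in>T. ennreal \<bar>\<phi> x\<bar> \<partial>?H) \<le> ennreal D * L1_norm_C1 \<Omega> \<phi> G"
    unfolding trace_controlled_def by blast
  have "(\<integral>\<^sup>+x\<in>S \<union> T. ennreal \<bar>\<phi> x\<bar> \<partial>?H) \<le> ennreal (C + D) * L1_norm_C1 \<Omega> \<phi> G" if C1: "C1_gradient \<phi> G" for \<phi> G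
  proof -
    note [measurable] = C1_gradient_measurable[OF C1]
    have "(\<integral>\<^sup>+x\<in>S \<union> T. ennreal \<bar>\<phi> x\<bar> \<partial>?H) \<le> (\<integral>\<^sup>+x. ennreal \<bar>\<phi> x\<bar> * indicator S x + ennreal \<bar>\<phi> x\<bar> * indicator T x \<partial>?H)"
      by (intro nn_integral_mono) (auto split: split_indicator)
    also have "... = (\<integral>\<^sup>+x\<in>S. ennreal \<bar>\<phi> x\<bar> \<partial>?H) + (\<integral>\<^sup>+x\<in>T. ennreal \<bar>\<phi> x\<bar> \<partial>?H)"
      by (rule nn_integral_add) measurable
    also have "... \<le> ennreal C * L1_norm_C1 \<Omega> \<phi> G + ennreal D * L1_norm_C1 \<Omega> \<phi> G"
      using C[OF C1] D[OF C1] by (rule add_mono)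
    finally show ?thesis using CD by (simp add: distrib_right)
  qed
  then show ?thesis unfolding trace_controlled_def using CD
    by (intro conjI exI[of _ "C + D"]) auto
qed

text \<open>
  With the shift \<open>M e\<close>, every point of the thickening of radius \<open>\<epsilon>\<close> has \<open>0 < F < 2 M \<epsilon>\<close>, so the
  thickening is a layer inside \<open>\<Omega>\<close>. The bound for its integral is proportional to \<open>\<epsilon>\<close>, which is what the
  comparison with Hausdorff measure requires. The case \<open>\<phi> = 1\<close> provides the volume bound.
\<close>

lemma trace_controlled_local:
  fixes \<Omega> :: "'a::euclidean_space set"
  assumes "bounded \<Omega>" "open \<Omega>" "lipschitz_boundary \<Omega>" "x \<in> frontier \<Omega>"
  shows "\<exists>U. open U \<and> x \<in> U \<and> trace_controlled \<Omega> (U \<inter> frontier \<Omega>)"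
proof -
  let ?H = "hausdorff_measure (DIM('a) - 1) :: 'a measure" and ?K = "minkowski_const TYPE('a)"
  obtain e F M r where e: "norm e = 1" and M: "M > 0" and r: "r > 0"
    and lip: "\<And>y z. \<bar>F y - F z\<bar> \<le> M * dist y z" and "continuous_on UNIV F" and shift: "\<And>y t. F (y + t *\<^sub>R e) = F y + t"
    and mem: "\<And>y. y \<in> ball x r \<Longrightarrow> y \<in> \<Omega> \<longleftrightarrow> 0 < F y"
    and zero: "\<And>y. y \<in> ball x r \<Longrightarrow> y \<in> frontier \<Omega> \<Longrightarrow> F y = (0::real)"
    by (rule lipschitz_boundary_chart[OF assms(3,2,4)]) (rule that)
  \<comment> \<open>\<open>S\<close> has radius \<open>\<eta>\<close>, its thickening reaches at most \<open>\<eta>\<close> further, and so does the way along \<open>e\<close>.\<close>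
  define \<eta> where "\<eta> = r / 4"
  have \<eta>: "\<eta> > 0" using r by (simp add: \<eta>_def)
  define S where "S = ball x \<eta> \<inter> frontier \<Omega>"
  have S_meas: "S \<in> sets borel" unfolding S_def by (auto intro!: sets.Int borel_closed)
  have "bounded S" unfolding S_def by (simp add: bounded_Int)
  have [measurable]: "\<Omega> \<in> sets borel" using \<open>open \<Omega>\<close> by simp
  let ?v = "M *\<^sub>R e"
  have layer: "\<epsilon> > 0 \<Longrightarrow> \<epsilon> * (1 + M) < \<eta> \<Longrightarrow> y \<in> thickening ?v \<epsilon> S \<Longrightarrow> F y \<in> {0<..<2 * M * \<epsilon>} \<and> dist x y < 2 * \<eta>" for \<epsilon> y
  proof -
    assume \<epsilon>: "\<epsilon> > 0" "\<epsilon> * (1 + M) < \<eta>" and y: "y \<in> thickening ?v \<epsilon> S"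
    then obtain z where z: "z \<in> S" "dist (z + \<epsilon> *\<^sub>R ?v) y < \<epsilon>" by (auto simp: thickening_def)
    have "F z = 0" using z r by (intro zero) (auto simp: S_def \<eta>_def)
    then have "F (z + \<epsilon> *\<^sub>R ?v) = \<epsilon> * M" using shift[of z "\<epsilon> * M"] by simp
    moreover have "M * dist y (z + \<epsilon> *\<^sub>R ?v) < M * \<epsilon>" using z M by (simp add: dist_commute)
    ultimately have "\<bar>F y - \<epsilon> * M\<bar> < M * \<epsilon>" using lip[of y "z + \<epsilon> *\<^sub>R ?v"] by simp
    moreover have "dist x y < 2 * \<eta>"
    proof -
      have "dist x y \<le> dist x z + dist z (z + \<epsilon> *\<^sub>R ?v) + dist (z + \<epsilon> *\<^sub>R ?v) y"
        by (metis add.assoc add_left_mono dist_triangle order_trans)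
      also have "dist z (z + \<epsilon> *\<^sub>R ?v) = \<epsilon> * M" using \<epsilon> M e by (simp add: dist_norm)
      finally show ?thesis using z \<epsilon> by (simp add: S_def algebra_simps)
    qed
    ultimately show ?thesis by (auto simp: abs_less_iff algebra_simps)
  qed
  define C where "C = 2 * M * (1 / \<eta> + 1)"
  have C0: "C \<ge> 0" using M \<eta> by (simp add: C_def)
  have thick: "eventually (\<lambda>n. (\<integral>\<^sup>+y\<in>thickening ?v (1 / real (Suc n)) S. ennreal \<bar>\<phi> y\<bar> \<partial>lborel) \<le> ennreal (C * I / real (Suc n))) sequentially"
    if C1: "C1_gradient \<phi> G" and I: "L1_norm_C1 \<Omega> \<phi> G = ennreal I" "I \<ge> 0" for \<phi> G I
  proof -
    have "(\<lambda>n. (1 + M) / real (Suc n)) \<longlonglongrightarrow> 0"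
      by (rule LIMSEQ_Suc[OF lim_const_over_n])
    then have "eventually (\<lambda>n. (1 + M) / real (Suc n) < \<eta>) sequentially"
      using \<eta> by (intro order_tendstoD) auto
    then show ?thesis
    proof eventually_elim
      case (elim n)
      define \<epsilon> where "\<epsilon> = 1 / real (Suc n)"
      have \<epsilon>: "\<epsilon> > 0" "\<epsilon> * (1 + M) < \<eta>" using elim by (simp_all only: \<epsilon>_def times_divide_eq_left mult_1) auto
      let ?T = "thickening ?v \<epsilon> S"
      let ?X = "\<integral>\<^sup>+z\<in>\<Omega>. ennreal \<bar>\<phi> z\<bar> \<partial>lborel" and ?Y = "\<integral>\<^sup>+z\<in>\<Omega>. ennreal (norm (G z)) \<partial>lborel"
      have "ennreal \<eta> * (\<integral>\<^sup>+y\<in>?T. ennreal \<bar>\<phi> y\<bar> \<partial>lborel)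
          \<le> ennreal (2 * M * \<epsilon>) * (?X + ennreal \<eta> * ?Y)"
      proof (rule C1_layer_integral_le[OF C1, where F = F and e = e])
        fix y t assume y: "y \<in> ?T" and t: "t \<in> {0..\<eta>}"
        have "dist x (y + t *\<^sub>R e) \<le> dist x y + dist y (y + t *\<^sub>R e)" by (rule dist_triangle)
        also have "dist y (y + t *\<^sub>R e) = t" using t e by (simp add: dist_norm)
        finally have "y + t *\<^sub>R e \<in> ball x r" using layer[OF \<epsilon> y] t r by (auto simp: \<eta>_def)
        then show "y + t *\<^sub>R e \<in> \<Omega>" using mem[of "y + t *\<^sub>R e"] shift[of y t] layer[OF \<epsilon> y] t by simp
      next
        fix y assume "y \<in> ?T"
        then show "F y \<in> {0..2 * M * \<epsilon>}" using layer[OF \<epsilon>, of y] by auto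
      qed (use \<epsilon> M e \<eta> shift in auto)
      also have "... \<le> ennreal (2 * M * \<epsilon>) * (ennreal (1 + \<eta>) * ennreal I)"
      proof (rule mult_left_mono)
        have "1 * ?X + ennreal \<eta> * ?Y
           \<le> ennreal (1 + \<eta>) * ?X + ennreal (1 + \<eta>) * ?Y"
          using \<eta> by (intro add_mono mult_right_mono) (auto intro: ennreal_leI simp flip: ennreal_1)
        then show "?X + ennreal \<eta> * ?Y \<le> ennreal (1 + \<eta>) * ennreal I"
          by (simp add: I(1)[symmetric] L1_norm_C1_def distrib_left)
      qed simp
      also have "... = ennreal (2 * M * \<epsilon> * ((1 + \<eta>) * I))"
        using M \<epsilon> \<eta> I by (simp add: ennreal_mult)
      also have "2 * M * \<epsilon> * ((1 + \<eta>) * I) = \<eta> * (C * I * \<epsilon>)"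
        using \<eta> by (simp add: C_def field_simps)
      also have "ennreal ... = ennreal \<eta> * ennreal (C * I * \<epsilon>)"
        using C0 I \<epsilon> \<eta> by (simp add: ennreal_mult)
      finally have "(\<integral>\<^sup>+y\<in>?T. ennreal \<bar>\<phi> y\<bar> \<partial>lborel) \<le> ennreal (C * I * \<epsilon>)"
        using \<eta> by (simp add: ennreal_mult_le_mult_iff)
      then show ?case by (simp add: \<epsilon>_def)
    qed
  qed
  obtain A where A: "L1_norm_C1 \<Omega> (\<lambda>_. 1) (\<lambda>_. 0) = ennreal A" "A \<ge> 0"
    using L1_norm_C1_finite[OF \<open>bounded \<Omega>\<close> C1_gradient_const, of 1]
    by (cases "L1_norm_C1 \<Omega> (\<lambda>_. 1) (\<lambda>_. 0)") auto
  have "trace_controlled \<Omega> S"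
    unfolding trace_controlled_def
  proof (intro conjI S_meas exI[of _ "?K * C"] allI impI)
    show "0 \<le> ?K * C" using C0 minkowski_const_pos[where 'a='a] by simp
    fix \<phi> :: "'a \<Rightarrow> real" and G assume C1: "C1_gradient \<phi> G"
    obtain I where I: "L1_norm_C1 \<Omega> \<phi> G = ennreal I" "I \<ge> 0"
      using L1_norm_C1_finite[OF \<open>bounded \<Omega>\<close> C1] by (cases "L1_norm_C1 \<Omega> \<phi> G") auto
    have "(\<integral>\<^sup>+y\<in>S. ennreal \<bar>\<phi> y\<bar> \<partial>?H) \<le> ennreal (?K * (C * I))"
    proof (rule nn_integral_hausdorff_le_thickening[OF \<open>bounded S\<close> S_meas])
      show "continuous_on UNIV (\<lambda>x. \<bar>\<phi> x\<bar>)"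
        using C1_gradient_continuous[OF C1] by (intro continuous_intros)
      show "eventually (\<lambda>n. emeasure lborel (thickening ?v (1 / real (Suc n)) S) \<le> ennreal (C * A / real (Suc n))) sequentially"
        using thick[OF C1_gradient_const A] by simp
    qed (use thick[OF C1 I] C0 A I in auto)
    also have "... = ennreal (?K * C) * L1_norm_C1 \<Omega> \<phi> G"
      using C0 I minkowski_const_pos[where 'a='a] by (simp add: ennreal_mult[symmetric] mult_ac)
    finally show "(\<integral>\<^sup>+y\<in>S. ennreal \<bar>\<phi> y\<bar> \<partial>?H) \<le> ennreal (?K * C) * L1_norm_C1 \<Omega> \<phi> G" .
  qed
  then show ?thesis unfolding S_def using \<eta> by (intro exI[of _ "ball x \<eta>"]) auto
qed

lemma trace_inequality:
  fixes \<Omega> :: "'a::euclidean_space set"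
  assumes "bounded \<Omega>" "open \<Omega>" "lipschitz_boundary \<Omega>"
  shows "trace_controlled \<Omega> (frontier \<Omega>)"
proof (rule compact_finite_union_property)
  show "compact (frontier \<Omega>)" using assms by (simp add: compact_frontier_bounded)
  show "trace_controlled \<Omega> {}" by (auto simp: trace_controlled_def)
  show "trace_controlled \<Omega> (A \<union> B)" if "trace_controlled \<Omega> A" "trace_controlled \<Omega> B" for A B
    using that by (rule trace_controlled_Un)
  show "\<exists>U. open U \<and> x \<in> U \<and> trace_controlled \<Omega> (U \<inter> frontier \<Omega>)" if "x \<in> frontier \<Omega>" for x
    using assms that by (rule trace_controlled_local)
qed

text \<open>
  The trace inequality for the constant function \<open>1\<close> already bounds the surface measure.
\<close>

lemma hausdorff_frontier_finite:
  fixes \<Omega> :: "'a::euclidean_space set"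
  assumes "bounded \<Omega>" "open \<Omega>" "lipschitz_boundary \<Omega>"
  shows "emeasure (hausdorff_measure (DIM('a) - 1)) (frontier \<Omega>) < \<infinity>"
proof -
  obtain C where "\<forall>\<phi> G. C1_gradient \<phi> G \<longrightarrow>
     (\<integral>\<^sup>+x\<in>frontier \<Omega>. ennreal \<bar>\<phi> x\<bar> \<partial>hausdorff_measure (DIM('a) - 1)) \<le> ennreal C * L1_norm_C1 \<Omega> \<phi> G"
    using trace_inequality[OF assms] unfolding trace_controlled_def by blast
  from this[rule_format, OF C1_gradient_const[of 1]]
  have "(\<integral>\<^sup>+x\<in>frontier \<Omega>. ennreal \<bar>1\<bar> \<partial>hausdorff_measure (DIM('a) - 1)) \<le> ennreal C * L1_norm_C1 \<Omega> (\<lambda>_. 1) (\<lambda>_. 0)" .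
  also have "... < \<infinity>"
    using L1_norm_C1_finite[OF assms(1) C1_gradient_const] by (simp add: ennreal_mult_less_top)
  finally show ?thesis by simp
qed


section \<open>The Poincare inequality for continuously differentiable functions\<close>

lemma powr_add_le:
  fixes a b p :: real
  assumes "p \<ge> 1" "a \<ge> 0" "b \<ge> 0"
  shows "(a + b) powr p \<le> 2 powr p * (a powr p + b powr p)"
proof -
  have "(a + b) powr p \<le> (2 * max a b) powr p"
    using assms by (intro powr_mono2) auto
  also have "... = 2 powr p * max a b powr p"
    using assms by (simp add: powr_mult)
  also have "max a b powr p \<le> a powr p + b powr p"
    by (cases "a \<le> b") (auto simp: max_def)
  finally show ?thesis by (simp add: mult_left_mono)
qed

lemma norm_powr_triangle:
  fixes x y :: "'b::real_normed_vector"
  assumes "p \<ge> 1"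
  shows "norm x powr p \<le> 2 powr p * (norm y powr p + norm (x - y) powr p)"
proof -
  have "norm x powr p \<le> (norm y + norm (x - y)) powr p"
    using assms norm_triangle_sub[of x y] by (intro powr_mono2) auto
  also have "... \<le> 2 powr p * (norm y powr p + norm (x - y) powr p)"
    using assms by (intro powr_add_le) auto
  finally show ?thesis .
qed

text \<open>
  Integrating this and optimising \<open>\<tau>\<close> replaces the inequality of Hoelder, at the price of a constant.
\<close>

lemma le_add_powr:
  fixes h \<tau> p :: real
  assumes "p \<ge> 1" "h \<ge> 0" "\<tau> > 0"
  shows "h \<le> \<tau> + \<tau> powr (1 - p) * h powr p"
proof (cases "h \<le> \<tau>")
  case True
  then show ?thesis using assms by (smt (verit) mult_nonneg_nonneg powr_ge_zero)
next
  case False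
  then have "h = h powr (1 - p) * h powr p"
    using assms by (simp flip: powr_add)
  also have "... \<le> \<tau> powr (1 - p) * h powr p"
    using False assms by (intro mult_right_mono powr_mono2') auto
  finally show ?thesis using assms by simp
qed

lemma nn_set_integral_L1_le_Lp:
  fixes h :: "'x \<Rightarrow> real"
  assumes [measurable]: "h \<in> borel_measurable M" "A \<in> sets M" and h0: "\<And>x. 0 \<le> h x" and p: "p \<ge> 1"
    and m: "emeasure M A = ennreal m" "m \<ge> 0"
    and I: "(\<integral>\<^sup>+x\<in>A. ennreal (h x powr p) \<partial>M) = ennreal I" "I \<ge> 0"
  shows "(\<integral>\<^sup>+x\<in>A. ennreal (h x) \<partial>M) \<le> ennreal ((m + 1) * I powr (1 / p))"
proof -
  have le: "(\<integral>\<^sup>+x\<in>A. ennreal (h x) \<partial>M) \<le> ennreal (\<tau> * m + \<tau> powr (1 - p) * I)" if "\<tau> > 0" for \<tau>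
  proof -
    have "(\<integral>\<^sup>+x\<in>A. ennreal (h x) \<partial>M)
      \<le> (\<integral>\<^sup>+x. ennreal \<tau> * indicator A x + ennreal (\<tau> powr (1 - p)) * (ennreal (h x powr p) * indicator A x) \<partial>M)"
    proof (rule nn_integral_mono)
      fix x
      have "ennreal (h x) \<le> ennreal (\<tau> + \<tau> powr (1 - p) * h x powr p)"
        by (intro ennreal_leI le_add_powr p h0 that)
      also have "... = ennreal \<tau> + ennreal (\<tau> powr (1 - p)) * ennreal (h x powr p)"
        using that by (simp add: ennreal_mult)
      finally show "ennreal (h x) * indicator A x \<le> ennreal \<tau> * indicator A x + ennreal (\<tau> powr (1 - p)) * (ennreal (h x powr p) * indicator A x)"
        by (auto split: split_indicator)
    qed
    also have "... = ennreal \<tau> * emeasure M A + ennreal (\<tau> powr (1 - p)) * (\<integral>\<^sup>+x\<in>A. ennreal (h x powr p) \<partial>M)"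
      by (subst nn_integral_add) (auto simp: nn_integral_cmult nn_integral_cmult_indicator)
    also have "... = ennreal (\<tau> * m + \<tau> powr (1 - p) * I)"
      using m I that by (simp add: ennreal_mult)
    finally show ?thesis .
  qed
  show ?thesis
  proof (cases "I = 0")
    case True
    have "(\<integral>\<^sup>+x\<in>A. ennreal (h x) \<partial>M) \<le> 0"
    proof (rule ennreal_le_epsilon)
      fix e :: real assume "0 < e"
      have "(\<integral>\<^sup>+x\<in>A. ennreal (h x) \<partial>M) \<le> ennreal (e / (m + 1) * m)"
        using le[of "e / (m + 1)"] \<open>0 < e\<close> m True by simp
      also have "... \<le> ennreal e"
        using \<open>0 < e\<close> m by (intro ennreal_leI) (simp add: field_simps)
      finally show "(\<integral>\<^sup>+x\<in>A. ennreal (h x) \<partial>M) \<le> 0 + ennreal e" by simp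
    qed
    then show ?thesis by simp
  next
    case False
    then have I0: "I > 0" using I by simp
    \<comment> \<open>For this \<open>\<tau>\<close> both terms of the bound are multiples of the \<open>L\<^sup>p\<close> norm.\<close>
    define \<tau> where "\<tau> = I powr (1 / p)"
    have "\<tau> > 0" using I0 by (simp add: \<tau>_def)
    have "\<tau> powr (1 - p) * I = I powr ((1 - p) / p) * I powr 1"
      using I0 by (simp add: \<tau>_def powr_powr)
    also have "... = I powr ((1 - p) / p + 1)" by (simp only: powr_add)
    also have "... = \<tau>"
      using p by (simp add: \<tau>_def diff_divide_distrib)
    finally have "\<tau> * m + \<tau> powr (1 - p) * I = (m + 1) * \<tau>" by (simp add: algebra_simps)
    then show ?thesis using le[OF \<open>\<tau> > 0\<close>] by (simp add: \<tau>_def)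
  qed
qed

definition pow_integral :: "real \<Rightarrow> 'a::euclidean_space set \<Rightarrow> ('a \<Rightarrow> 'b::real_normed_vector) \<Rightarrow> ennreal" where
  "pow_integral p A h = (\<integral>\<^sup>+x\<in>A. ennreal (norm (h x) powr p) \<partial>lborel)"

lemma pow_integral_mono: "A \<subseteq> B \<Longrightarrow> pow_integral p A h \<le> pow_integral p B h"
  unfolding pow_integral_def by (rule nn_set_integral_set_mono)

lemma pow_integral_finite:
  fixes h :: "'a::euclidean_space \<Rightarrow> 'b::real_normed_vector"
  assumes "bounded \<Omega>" "continuous_on UNIV h" "p \<ge> 1"
  shows "pow_integral p \<Omega> h < \<infinity>"
  unfolding pow_integral_def using assms
  by (intro nn_set_integral_continuous_finite continuous_on_powr' continuous_intros) auto

text \<open>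
  The difference is an integral of the gradient along a segment. Its \<open>p\<close>-th power is bounded by the integral
  of the \<open>p\<close>-th power, and after exchanging integrals each time \<open>t\<close> contributes an integral over a
  translate of \<open>A\<close> inside \<open>\<Omega>\<close>.
\<close>

lemma C1_translation_estimate:
  fixes \<phi> :: "'a::euclidean_space \<Rightarrow> real"
  assumes C1: "C1_gradient \<phi> G" and [measurable]: "A \<in> sets borel" "\<Omega> \<in> sets borel" and p: "p \<ge> 1"
    and seg: "\<And>a t. a \<in> A \<Longrightarrow> t \<in> {0..1} \<Longrightarrow> a + t *\<^sub>R w \<in> \<Omega>"
  shows "(\<integral>\<^sup>+a\<in>A. ennreal (\<bar>\<phi> (a + w) - \<phi> a\<bar> powr p) \<partial>lborel) \<le> ennreal ((2 * norm w) powr p) * pow_integral p \<Omega> G"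
proof -
  note [measurable] = C1_gradient_measurable[OF C1]
  define J where "J a = (\<integral>\<^sup>+t\<in>{0..1}. ennreal (norm (G (a + t *\<^sub>R w)) powr p) \<partial>lborel)" for a
  have pt: "ennreal (\<bar>\<phi> (a + w) - \<phi> a\<bar> powr p) \<le> ennreal ((2 * norm w) powr p) * J a" for a
  proof -
    have contG: "continuous_on UNIV (\<lambda>t::real. norm (G (a + t *\<^sub>R w)))"
      by (intro continuous_intros continuous_on_compose2[OF C1_gradient_continuous(2)[OF C1]]) auto
    have "J a < \<infinity>"
      unfolding J_def using p
      by (intro nn_set_integral_continuous_finite continuous_on_powr' contG continuous_intros) auto
    then obtain I where I: "J a = ennreal I" "I \<ge> 0" by (cases "J a") auto
    have "ennreal \<bar>\<phi> (a + w) - \<phi> a\<bar> \<le> ennreal (norm w) * (\<integral>\<^sup>+t\<in>{0..1}. ennreal (norm (G (a + t *\<^sub>R w))) \<partial>lborel)"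
      using C1_segment_le[OF C1, of 1 a w] by simp
    also have "... \<le> ennreal (norm w) * ennreal ((1 + 1) * I powr (1 / p))"
      by (intro mult_left_mono nn_set_integral_L1_le_Lp) (use p I in \<open>auto simp: J_def\<close>)
    also have "... = ennreal (2 * norm w * I powr (1 / p))"
      by (simp add: ennreal_mult[symmetric] mult_ac)
    finally have "\<bar>\<phi> (a + w) - \<phi> a\<bar> \<le> 2 * norm w * I powr (1 / p)" by simp
    then have "\<bar>\<phi> (a + w) - \<phi> a\<bar> powr p \<le> (2 * norm w * I powr (1 / p)) powr p"
      using p by (intro powr_mono2) auto
    also have "... = (2 * norm w) powr p * I"
      using p I by (simp add: powr_mult powr_powr)
    finally show ?thesis using I by (simp add: ennreal_mult[symmetric] ennreal_leI)
  qed
  have [measurable]: "J \<in> borel_measurable borel" unfolding J_def by measurable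
  have "(\<integral>\<^sup>+a\<in>A. ennreal (\<bar>\<phi> (a + w) - \<phi> a\<bar> powr p) \<partial>lborel) \<le> (\<integral>\<^sup>+a. ennreal ((2 * norm w) powr p) * (J a * indicator A a) \<partial>lborel)"
    using pt by (intro nn_integral_mono) (auto split: split_indicator)
  also have "... = ennreal ((2 * norm w) powr p) * (\<integral>\<^sup>+a\<in>A. J a \<partial>lborel)"
    by (rule nn_integral_cmult) measurable
  also have "(\<integral>\<^sup>+a\<in>A. J a \<partial>lborel) \<le> ennreal 1 * pow_integral p \<Omega> G"
    unfolding J_def pow_integral_def
    by (rule nn_integral_translates_le[where k = "\<lambda>z. ennreal (norm (G z) powr p)" and a = "\<lambda>_. 0"]) (use seg in auto)
  finally show ?thesis by (simp add: mult_left_mono)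
qed

text \<open>
  On \<open>A\<close> the function is controlled by its values on the reference set \<open>B\<close> and by its gradient on \<open>\<Omega>\<close>.
\<close>

definition Lp_controlled :: "real \<Rightarrow> 'a::euclidean_space set \<Rightarrow> 'a set \<Rightarrow> 'a set \<Rightarrow> bool" where
  "Lp_controlled p \<Omega> B A \<longleftrightarrow> A \<in> sets borel \<and> (\<exists>C\<ge>0. \<forall>\<phi> G. C1_gradient \<phi> G \<longrightarrow>
     pow_integral p A \<phi> \<le> ennreal C * (pow_integral p B \<phi> + pow_integral p \<Omega> G))"

lemma Lp_controlledE:
  assumes "Lp_controlled p \<Omega> B A"
  obtains C where "C \<ge> 0" "A \<in> sets borel"
    "\<And>\<phi> G. C1_gradient \<phi> G \<Longrightarrow> pow_integral p A \<phi> \<le> ennreal C * (pow_integral p B \<phi> + pow_integral p \<Omega> G)"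
  using assms unfolding Lp_controlled_def by blast

lemma Lp_controlled_refl: "B \<in> sets borel \<Longrightarrow> Lp_controlled p \<Omega> B B"
  unfolding Lp_controlled_def by (intro conjI exI[of _ 1]) auto

lemma Lp_controlled_empty: "Lp_controlled p \<Omega> B {}"
  unfolding Lp_controlled_def by (auto simp: pow_integral_def)

lemma Lp_controlled_subset:
  assumes "Lp_controlled p \<Omega> B A" "A' \<subseteq> A" "A' \<in> sets borel"
  shows "Lp_controlled p \<Omega> B A'"
  using assms pow_integral_mono[OF assms(2)] unfolding Lp_controlled_def by (meson order_trans)

lemma Lp_controlled_Un:
  fixes \<Omega> :: "'a::euclidean_space set"
  assumes "Lp_controlled p \<Omega> B S" "Lp_controlled p \<Omega> B T"
  shows "Lp_controlled p \<Omega> B (S \<union> T)"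
proof -
  obtain C where C: "C \<ge> 0" and [measurable]: "S \<in> sets borel" and
    CS: "\<And>\<phi> G. C1_gradient \<phi> G \<Longrightarrow> pow_integral p S \<phi> \<le> ennreal C * (pow_integral p B \<phi> + pow_integral p \<Omega> G)"
    by (rule Lp_controlledE[OF assms(1)]) (rule that)
  obtain D where D: "D \<ge> 0" and [measurable]: "T \<in> sets borel" and
    DT: "\<And>\<phi> G. C1_gradient \<phi> G \<Longrightarrow> pow_integral p T \<phi> \<le> ennreal D * (pow_integral p B \<phi> + pow_integral p \<Omega> G)"
    by (rule Lp_controlledE[OF assms(2)]) (rule that)
  have "pow_integral p (S \<union> T) \<phi> \<le> ennreal (C + D) * (pow_integral p B \<phi> + pow_integral p \<Omega> G)"
    if C1: "C1_gradient \<phi> G" for \<phi> G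
  proof -
    note [measurable] = C1_gradient_measurable[OF C1]
    have "pow_integral p (S \<union> T) \<phi> \<le> (\<integral>\<^sup>+x. ennreal (norm (\<phi> x) powr p) * indicator S x + ennreal (norm (\<phi> x) powr p) * indicator T x \<partial>lborel)"
      unfolding pow_integral_def by (intro nn_integral_mono) (auto split: split_indicator)
    also have "... = pow_integral p S \<phi> + pow_integral p T \<phi>"
      unfolding pow_integral_def by (rule nn_integral_add) measurable
    also have "... \<le> ennreal C * (pow_integral p B \<phi> + pow_integral p \<Omega> G) + ennreal D * (pow_integral p B \<phi> + pow_integral p \<Omega> G)"
      using CS[OF C1] DT[OF C1] by (rule add_mono)
    also have "... = ennreal (C + D) * (pow_integral p B \<phi> + pow_integral p \<Omega> G)"
      using C D by (simp add: distrib_right)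
    finally show ?thesis .
  qed
  then show ?thesis unfolding Lp_controlled_def using C D
    by (intro conjI exI[of _ "C + D"]) auto
qed

text \<open>
  Control is inherited from a set containing the translate of \<open>A\<close>, as moving there costs only the gradient.
\<close>

lemma Lp_controlled_shift:
  fixes \<Omega> :: "'a::euclidean_space set"
  assumes ctrl: "Lp_controlled p \<Omega> B A'" and [measurable]: "A \<in> sets borel" "\<Omega> \<in> sets borel" and p: "p \<ge> 1"
    and into: "\<And>a. a \<in> A \<Longrightarrow> a + w \<in> A'"
    and seg: "\<And>a t. a \<in> A \<Longrightarrow> t \<in> {0..1} \<Longrightarrow> a + t *\<^sub>R w \<in> \<Omega>"
  shows "Lp_controlled p \<Omega> B A"
proof -
  obtain C where C: "C \<ge> 0" and [measurable]: "A' \<in> sets borel" and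
    CA: "\<And>\<phi> G. C1_gradient \<phi> G \<Longrightarrow> pow_integral p A' \<phi> \<le> ennreal C * (pow_integral p B \<phi> + pow_integral p \<Omega> G)"
    by (rule Lp_controlledE[OF ctrl]) (rule that)
  define W where "W = (2 * norm w) powr p"
  have W: "W \<ge> 0" by (simp add: W_def)
  have "pow_integral p A \<phi> \<le> ennreal (2 powr p * (C + W)) * (pow_integral p B \<phi> + pow_integral p \<Omega> G)"
    if C1: "C1_gradient \<phi> G" for \<phi> G
  proof -
    note [measurable] = C1_gradient_measurable[OF C1]
    let ?D = "pow_integral p \<Omega> G" and ?I = "\<integral>\<^sup>+a\<in>A. ennreal (\<bar>\<phi> (a + w) - \<phi> a\<bar> powr p) \<partial>lborel"
    have "pow_integral p A \<phi> \<le> (\<integral>\<^sup>+a. ennreal (2 powr p) * (ennreal (\<bar>\<phi> (a + w)\<bar> powr p) * indicator A' (a + w)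
        + ennreal (\<bar>\<phi> (a + w) - \<phi> a\<bar> powr p) * indicator A a) \<partial>lborel)"
      unfolding pow_integral_def
    proof (rule nn_integral_mono)
      fix a
      have "ennreal (norm (\<phi> a) powr p) \<le> ennreal (2 powr p * (\<bar>\<phi> (a + w)\<bar> powr p + \<bar>\<phi> (a + w) - \<phi> a\<bar> powr p))"
        using norm_powr_triangle[OF p, of "\<phi> a" "\<phi> (a + w)"] by (intro ennreal_leI) (simp add: abs_minus_commute)
      also have "... = ennreal (2 powr p) * (ennreal (\<bar>\<phi> (a + w)\<bar> powr p) + ennreal (\<bar>\<phi> (a + w) - \<phi> a\<bar> powr p))"
        by (simp add: ennreal_mult)
      finally show "ennreal (norm (\<phi> a) powr p) * indicator A a
         \<le> ennreal (2 powr p) * (ennreal (\<bar>\<phi> (a + w)\<bar> powr p) * indicator A' (a + w) + ennreal (\<bar>\<phi> (a + w) - \<phi> a\<bar> powr p) * indicator A a)"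
        using into by (cases "a \<in> A") auto
    qed
    also have "... = ennreal (2 powr p) * ((\<integral>\<^sup>+a. ennreal (\<bar>\<phi> (a + w)\<bar> powr p) * indicator A' (a + w) \<partial>lborel)
        + ?I)"
      by (subst nn_integral_cmult, measurable, subst nn_integral_add) measurable
    also have "(\<integral>\<^sup>+a. ennreal (\<bar>\<phi> (a + w)\<bar> powr p) * indicator A' (a + w) \<partial>lborel) = pow_integral p A' \<phi>"
      unfolding pow_integral_def real_norm_def
      by (rule nn_integral_lborel_translate[where k = "\<lambda>z. ennreal (\<bar>\<phi> z\<bar> powr p) * indicator A' z"]) measurable
    also have "ennreal (2 powr p) * (pow_integral p A' \<phi> + ?I)
       \<le> ennreal (2 powr p) * (ennreal C * (pow_integral p B \<phi> + ?D) + ennreal W * (pow_integral p B \<phi> + ?D))"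
    proof (intro mult_left_mono add_mono CA C1)
      have "?I \<le> ennreal W * ?D"
        unfolding W_def by (rule C1_translation_estimate[OF C1]) (use p seg in auto)
      also have "... \<le> ennreal W * (pow_integral p B \<phi> + ?D)"
        by (intro mult_left_mono) auto
      finally show "?I \<le> ennreal W * (pow_integral p B \<phi> + ?D)" .
    qed auto
    also have "... = ennreal (2 powr p * (C + W)) * (pow_integral p B \<phi> + ?D)"
      using C W by (simp add: ennreal_mult distrib_right mult.assoc)
    finally show ?thesis .
  qed
  then show ?thesis unfolding Lp_controlled_def using C W
    by (intro conjI exI[of _ "2 powr p * (C + W)"]) auto
qed

text \<open>
  Two small balls with centres in a common ball inside \<open>\<Omega>\<close> are translates of each other along segments
  in \<open>\<Omega>\<close>. Hence the set of centres of controlled balls is open and closed in \<open>\<Omega>\<close>.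
\<close>

lemma Lp_controlled_small_ball:
  fixes \<Omega> :: "'a::euclidean_space set"
  assumes "open \<Omega>" "connected \<Omega>" and p: "p \<ge> 1" and b: "b \<in> \<Omega>" "r > 0" and x: "x \<in> \<Omega>"
  shows "\<exists>\<epsilon>>0. Lp_controlled p \<Omega> (ball b r) (ball x \<epsilon>)"
proof -
  let ?ctrl = "Lp_controlled p \<Omega> (ball b r)"
  define P where "P z \<longleftrightarrow> (\<exists>\<epsilon>>0. ?ctrl (ball z \<epsilon>))" for z
  have "P x"
  proof (rule connected_induction_simple[where P = P, OF \<open>connected \<Omega>\<close> b(1) x])
    show "P b"
      unfolding P_def using b by (intro exI[of _ r]) (auto intro: Lp_controlled_refl)
  next
    fix a assume "a \<in> \<Omega>"
    then obtain s where s: "s > 0" "ball a s \<subseteq> \<Omega>" using \<open>open \<Omega>\<close> by (meson openE)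
    define \<rho> where "\<rho> = s / 2"
    have \<rho>: "\<rho> > 0" using s by (simp add: \<rho>_def)
    have step: "P z"
    if y: "y \<in> ball a \<rho>" and z: "z \<in> ball a \<rho>" and "P y" for y z
  proof -
    obtain \<epsilon> where \<epsilon>: "\<epsilon> > 0" "?ctrl (ball y \<epsilon>)" using \<open>P y\<close> unfolding P_def by blast
    define \<epsilon>' where "\<epsilon>' = min \<epsilon> \<rho>"
    have "?ctrl (ball z \<epsilon>')"
    proof (rule Lp_controlled_shift[OF \<epsilon>(2), where w = "y - z"])
      fix c assume c: "c \<in> ball z \<epsilon>'"
      then show "c + (y - z) \<in> ball y \<epsilon>" by (simp add: \<epsilon>'_def dist_norm algebra_simps norm_minus_commute)
      fix t :: real assume t: "t \<in> {0..1}"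
      have "(1 - t) *\<^sub>R z + t *\<^sub>R y \<in> ball a \<rho>"
        using y z t by (intro convexD_alt convex_ball) auto
      moreover have "c + t *\<^sub>R (y - z) = ((1 - t) *\<^sub>R z + t *\<^sub>R y) + (c - z)" by (simp add: algebra_simps)
      moreover have "norm (c - z) < \<rho>" using c by (simp add: \<epsilon>'_def dist_norm norm_minus_commute)
      ultimately have "dist a (c + t *\<^sub>R (y - z)) < \<rho> + \<rho>"
        using dist_triangle_lt[of a "(1 - t) *\<^sub>R z + t *\<^sub>R y" "c + t *\<^sub>R (y - z)" "\<rho> + \<rho>"] by (auto simp: dist_norm)
      then show "c + t *\<^sub>R (y - z) \<in> \<Omega>" using s by (auto simp: \<rho>_def)
    qed (use \<open>open \<Omega>\<close> p in auto)
    moreover have "\<epsilon>' > 0" using \<epsilon> \<rho> by (simp add: \<epsilon>'_def)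
    ultimately show ?thesis unfolding P_def by blast
  qed
    show "\<exists>T. openin (top_of_set \<Omega>) T \<and> a \<in> T \<and> (\<forall>x\<in>T. \<forall>y\<in>T. P x \<longrightarrow> P y)"
    proof (intro exI[of _ "ball a \<rho>"] conjI ballI impI)
      show "openin (top_of_set \<Omega>) (ball a \<rho>)"
        using s \<rho> \<open>open \<Omega>\<close> by (intro open_subset) (auto simp: \<rho>_def)
      show "a \<in> ball a \<rho>" using \<rho> by simp
    qed (rule step)
  qed
  then show ?thesis unfolding P_def .
qed

lemma Lp_controlled_compact:
  fixes \<Omega> :: "'a::euclidean_space set"
  assumes "open \<Omega>" "connected \<Omega>" and p: "p \<ge> 1" and b: "b \<in> \<Omega>" "r > 0" and K: "compact K" "K \<subseteq> \<Omega>"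
  shows "Lp_controlled p \<Omega> (ball b r) K" (is "?ctrl K")
proof (rule compact_finite_union_property[OF K(1), where P = ?ctrl])
  show "?ctrl {}" by (rule Lp_controlled_empty)
next
  fix x assume "x \<in> K"
  then obtain \<epsilon> where \<epsilon>: "\<epsilon> > 0" "?ctrl (ball x \<epsilon>)"
    using Lp_controlled_small_ball[OF assms(1-5)] K by blast
  have "?ctrl (ball x \<epsilon> \<inter> K)"
    by (rule Lp_controlled_subset[OF \<epsilon>(2) Int_lower1 sets.Int[OF borel_open[OF open_ball] borel_compact[OF K(1)]]])
  then show "\<exists>U. open U \<and> x \<in> U \<and> ?ctrl (U \<inter> K)"
    using \<epsilon> by (intro exI[of _ "ball x \<epsilon>"]) auto
qed (rule Lp_controlled_Un)

text \<open>
  Moving by \<open>s / 2\<close> in the direction \<open>e\<close> takes the part of \<open>\<Omega>\<close> near a boundary point into the set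
  \<open>F \<ge> s / 2\<close>, which is compact inside \<open>\<Omega>\<close>.
\<close>

lemma Lp_controlled_near_boundary:
  fixes \<Omega> :: "'a::euclidean_space set"
  assumes "open \<Omega>" "connected \<Omega>" and p: "p \<ge> 1" and b: "b \<in> \<Omega>" "r > 0"
    and "lipschitz_boundary \<Omega>" "x \<in> frontier \<Omega>"
  shows "\<exists>U. open U \<and> x \<in> U \<and> Lp_controlled p \<Omega> (ball b r) (U \<inter> \<Omega>)"
proof -
  let ?ctrl = "Lp_controlled p \<Omega> (ball b r)"
  obtain e F M s where e: "norm e = 1" and M: "M > 0" and s: "s > 0"
    and lip: "\<And>y z. \<bar>F y - F z\<bar> \<le> M * dist y z" and contF: "continuous_on UNIV F" and shift: "\<And>y t. F (y + t *\<^sub>R e) = F y + t"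
    and mem: "\<And>y. y \<in> ball x s \<Longrightarrow> y \<in> \<Omega> \<longleftrightarrow> 0 < F y"
    and zero: "\<And>y. y \<in> ball x s \<Longrightarrow> y \<in> frontier \<Omega> \<Longrightarrow> F y = (0::real)"
    by (rule lipschitz_boundary_chart[OF assms(6,1,7)]) (rule that)
  define K where "K = cball x (3 * s / 4) \<inter> {y. s / 2 \<le> F y}"
  have "closed {y. s / 2 \<le> F y}" using contF by (intro closed_Collect_le) auto
  then have "compact K" unfolding K_def by (intro compact_Int_closed) auto
  moreover have "K \<subseteq> \<Omega>"
  proof
    fix y assume y: "y \<in> K"
    then have "y \<in> ball x s" using s by (auto simp: K_def)
    then show "y \<in> \<Omega>" using mem[of y] y s by (auto simp: K_def)
  qed
  ultimately have ctrl: "?ctrl K"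
    by (rule Lp_controlled_compact[OF assms(1-5)])
  have near: "y + t *\<^sub>R e \<in> cball x (3 * s / 4)" if "y \<in> ball x (s / 4)" "t \<in> {0..s / 2}" for y t
  proof -
    have "dist x (y + t *\<^sub>R e) \<le> dist x y + dist y (y + t *\<^sub>R e)" by (rule dist_triangle)
    also have "dist y (y + t *\<^sub>R e) = t" using that e by (simp add: dist_norm)
    finally show ?thesis using that by simp
  qed
  have Fpos: "0 < F y" if "y \<in> ball x (s / 4) \<inter> \<Omega>" for y
    using mem[of y] that s by simp
  have "?ctrl (ball x (s / 4) \<inter> \<Omega>)"
  proof (rule Lp_controlled_shift[OF ctrl, where w = "(s / 2) *\<^sub>R e"])
    fix y assume y: "y \<in> ball x (s / 4) \<inter> \<Omega>"
    then show "y + (s / 2) *\<^sub>R e \<in> K"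
      using near[of y "s / 2"] Fpos[OF y] s by (simp add: K_def shift del: mem_cball)
    fix t :: real assume t: "t \<in> {0..1}"
    have t': "t * (s / 2) \<in> {0..s / 2}" using t s by (simp add: mult_left_le_one_le)
    have "y + (t * (s / 2)) *\<^sub>R e \<in> cball x (3 * s / 4)" using y t' by (intro near) auto
    then have "y + (t * (s / 2)) *\<^sub>R e \<in> ball x s" using s by simp
    then show "y + t *\<^sub>R (s / 2) *\<^sub>R e \<in> \<Omega>"
      using mem[of "y + (t * (s / 2)) *\<^sub>R e"] Fpos[OF y] t' by (simp add: shift add_pos_nonneg)
  qed (use \<open>open \<Omega>\<close> p in auto)
  then show ?thesis using s by (intro exI[of _ "ball x (s / 4)"]) auto
qed

lemma Lp_controlled_domain:
  fixes \<Omega> :: "'a::euclidean_space set"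
  assumes "open \<Omega>" "connected \<Omega>" and p: "p \<ge> 1" and b: "b \<in> \<Omega>" "r > 0"
    and "lipschitz_boundary \<Omega>" "bounded \<Omega>"
  shows "Lp_controlled p \<Omega> (ball b r) \<Omega>"
proof -
  let ?ctrl = "Lp_controlled p \<Omega> (ball b r)"
  have "?ctrl (closure \<Omega> \<inter> \<Omega>)"
  proof (rule compact_finite_union_property[where P = "\<lambda>S. ?ctrl (S \<inter> \<Omega>)"])
    show "compact (closure \<Omega>)" using \<open>bounded \<Omega>\<close> by (simp add: compact_closure)
    show "?ctrl ({} \<inter> \<Omega>)" by (simp add: Lp_controlled_empty)
    show "?ctrl ((A \<union> B) \<inter> \<Omega>)"
      if "?ctrl (A \<inter> \<Omega>)" "?ctrl (B \<inter> \<Omega>)" for A B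
      using Lp_controlled_Un[OF that] by (simp add: Int_Un_distrib2)
    fix x assume x: "x \<in> closure \<Omega>"
    have eq: "(U \<inter> closure \<Omega>) \<inter> \<Omega> = U \<inter> \<Omega>" for U using closure_subset by blast
    show "\<exists>U. open U \<and> x \<in> U \<and> ?ctrl ((U \<inter> closure \<Omega>) \<inter> \<Omega>)"
      unfolding eq
    proof (cases "x \<in> \<Omega>")
      case True
      then obtain \<epsilon> where \<epsilon>: "\<epsilon> > 0" "?ctrl (ball x \<epsilon>)"
        using Lp_controlled_small_ball[OF assms(1-5)] by blast
      have "?ctrl (ball x \<epsilon> \<inter> \<Omega>)"
        by (rule Lp_controlled_subset[OF \<epsilon>(2)]) (use \<open>open \<Omega>\<close> in auto)
      then show "\<exists>U. open U \<and> x \<in> U \<and> ?ctrl (U \<inter> \<Omega>)"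
        using \<epsilon> by (intro exI[of _ "ball x \<epsilon>"]) auto
    next
      case False
      then have "x \<in> frontier \<Omega>" using x \<open>open \<Omega>\<close> by (simp add: frontier_def interior_open)
      then show "\<exists>U. open U \<and> x \<in> U \<and> ?ctrl (U \<inter> \<Omega>)"
        by (rule Lp_controlled_near_boundary[OF assms(1-6)])
    qed
  qed
  then show ?thesis using closure_subset[of \<Omega>] by (simp add: Int_absorb1)
qed

text \<open>
  The double integral of \<open>|\<phi> x - \<phi> y|\<^sup>p\<close> over the ball is, with \<open>x = y + w\<close>, an integral over \<open>w\<close> of
  translation differences; convexity keeps all segments in the ball. Some value \<open>c = \<phi> y\<close> does at
  least as well as the average over \<open>y\<close>.
\<close>

lemma poincare_ball:
  fixes \<Omega> :: "'a::euclidean_space set"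
  assumes C1: "C1_gradient \<phi> G" and "open \<Omega>" "bounded \<Omega>" and p: "p \<ge> 1" and B: "ball b r \<subseteq> \<Omega>" "r > 0"
  shows "\<exists>c. pow_integral p (ball b r) (\<lambda>x. \<phi> x - c) \<le> ennreal ((4 * r) powr p * 4 ^ DIM('a)) * pow_integral p \<Omega> G"
proof (rule ccontr)
  assume no: "\<not> ?thesis"
  note [measurable] = C1_gradient_measurable[OF C1]
  let ?B = "ball b r" and ?D = "pow_integral p \<Omega> G"
  let ?k = "\<lambda>w y. ennreal (\<bar>\<phi> (w + y) - \<phi> y\<bar> powr p) * indicator ?B (w + y) * indicator ?B y"
  have [measurable]: "\<Omega> \<in> sets borel" "?B \<in> sets borel" using \<open>open \<Omega>\<close> by simp_all
  define \<beta> where "\<beta> = unit_ball_vol (real DIM('a)) * r ^ DIM('a)"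
  have \<beta>: "\<beta> > 0" "emeasure lborel ?B = ennreal \<beta>" using B by (simp_all add: \<beta>_def emeasure_ball)
  define g where "g y = pow_integral p ?B (\<lambda>x. \<phi> x - \<phi> y)" for y
  define \<kappa> where "\<kappa> = ennreal ((4 * r) powr p * 4 ^ DIM('a)) * ?D"
  have gm [measurable]: "g \<in> borel_measurable borel" unfolding g_def pow_integral_def by measurable
  have gt: "\<kappa> < g y" for y using no by (auto simp: g_def \<kappa>_def not_le)
  have Dfin: "?D < \<infinity>"
    using pow_integral_finite[OF \<open>bounded \<Omega>\<close> C1_gradient_continuous(2)[OF C1] p] .
  have "(\<integral>\<^sup>+y\<in>?B. g y \<partial>lborel)
     = (\<integral>\<^sup>+y. (\<integral>\<^sup>+x. ennreal (\<bar>\<phi> x - \<phi> y\<bar> powr p) * indicator ?B x * indicator ?B y \<partial>lborel) \<partial>lborel)"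
    unfolding g_def pow_integral_def real_norm_def by (intro nn_integral_cong nn_integral_multc[symmetric]) measurable
  also have "... = (\<integral>\<^sup>+y. (\<integral>\<^sup>+w. ?k w y \<partial>lborel) \<partial>lborel)"
    by (intro nn_integral_cong nn_integral_lborel_translate[symmetric,
          where k = "\<lambda>x. ennreal (\<bar>\<phi> x - \<phi> y\<bar> powr p) * indicator ?B x * indicator ?B y" for y]) measurable
  also have "... = (\<integral>\<^sup>+w. (\<integral>\<^sup>+y. ?k w y \<partial>lborel) \<partial>lborel)"
    by (rule lborel_pair.Fubini'[symmetric]) measurable
  also have "... \<le> (\<integral>\<^sup>+w. ennreal ((4 * r) powr p) * ?D * indicator (ball (0::'a) (2 * r)) w \<partial>lborel)"
  proof (rule nn_integral_mono)
    fix w :: 'a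
    define A where "A = {y \<in> ?B. w + y \<in> ?B}"
    have A_meas: "A \<in> sets borel" unfolding A_def by measurable
    have eq: "(\<integral>\<^sup>+y. ?k w y \<partial>lborel)
       = (\<integral>\<^sup>+y\<in>A. ennreal (\<bar>\<phi> (y + w) - \<phi> y\<bar> powr p) \<partial>lborel)"
      by (intro nn_integral_cong) (auto simp: A_def add.commute split: split_indicator)
    show "(\<integral>\<^sup>+y. ?k w y \<partial>lborel)
      \<le> ennreal ((4 * r) powr p) * ?D * indicator (ball 0 (2 * r)) w"
    proof (cases "A = {}")
      case True
      then show ?thesis unfolding eq by simp
    next
      case False
      then obtain y where "y \<in> ?B" "w + y \<in> ?B" by (auto simp: A_def)
      then have "dist (w + y) y < 2 * r"
        using dist_triangle[of "w + y" y b] by (simp add: dist_commute)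
      then have w: "norm w < 2 * r" by (simp add: dist_norm)
      have "(\<integral>\<^sup>+y\<in>A. ennreal (\<bar>\<phi> (y + w) - \<phi> y\<bar> powr p) \<partial>lborel) \<le> ennreal ((2 * norm w) powr p) * ?D"
      proof (rule C1_translation_estimate[OF C1 A_meas _ p])
        fix a t assume a: "a \<in> A" and t: "t \<in> {0..1::real}"
        have "(1 - t) *\<^sub>R a + t *\<^sub>R (w + a) \<in> ?B"
          using a t by (intro convexD_alt convex_ball) (auto simp: A_def)
        moreover have "(1 - t) *\<^sub>R a + t *\<^sub>R (w + a) = a + t *\<^sub>R w" by (simp add: algebra_simps)
        ultimately show "a + t *\<^sub>R w \<in> \<Omega>" using B by auto
      qed simp
      also have "... \<le> ennreal ((4 * r) powr p) * ?D"
        using w p by (intro mult_right_mono ennreal_leI powr_mono2) auto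
      finally show ?thesis using w unfolding eq by simp
    qed
  qed
  also have "... = ennreal ((4 * r) powr p) * ?D * emeasure lborel (ball (0::'a) (2 * r))"
    by (rule nn_integral_cmult_indicator) simp
  also have "emeasure lborel (ball (0::'a) (2 * r)) = ennreal (2 ^ DIM('a) * \<beta>)"
    using B by (simp add: emeasure_ball \<beta>_def power_mult_distrib mult_ac)
  also have "ennreal ((4 * r) powr p) * ?D * ennreal (2 ^ DIM('a) * \<beta>) \<le> ennreal ((4 * r) powr p) * ?D * ennreal (4 ^ DIM('a) * \<beta>)"
    using \<beta> by (intro mult_left_mono ennreal_leI mult_right_mono power_mono) auto
  also have "... = \<kappa> * ennreal \<beta>"
    using \<beta> by (simp add: \<kappa>_def ennreal_mult mult_ac)
  finally have le: "(\<integral>\<^sup>+y\<in>?B. g y \<partial>lborel) \<le> \<kappa> * ennreal \<beta>" .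
  have "(\<integral>\<^sup>+y. \<kappa> * indicator ?B y \<partial>lborel) < (\<integral>\<^sup>+y\<in>?B. g y \<partial>lborel)"
  proof (rule nn_integral_less)
    show "(\<integral>\<^sup>+y. \<kappa> * indicator ?B y \<partial>lborel) \<noteq> \<infinity>"
      using Dfin \<beta> by (subst nn_integral_cmult_indicator) (auto simp: \<kappa>_def ennreal_mult_eq_top_iff)
    show "AE y in lborel. \<kappa> * indicator ?B y \<le> g y * indicator ?B y"
      using gt by (intro AE_I2) (auto simp: less_imp_le split: split_indicator)
    show "\<not> (AE y in lborel. g y * indicator ?B y \<le> \<kappa> * indicator ?B y)"
    proof
      assume "AE y in lborel. g y * indicator ?B y \<le> \<kappa> * indicator ?B y"
      then have "AE y in lborel. y \<notin> ?B"
      proof eventually_elim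
        case (elim y)
        then show ?case using gt[of y] by (auto simp: not_less[symmetric])
      qed
      then have "emeasure lborel ?B = 0"
        by (subst (asm) AE_iff_null_sets[symmetric, of "?B"]) auto
      then show False using \<beta> by simp
    qed
  qed measurable
  also have "(\<integral>\<^sup>+y. \<kappa> * indicator ?B y \<partial>lborel) = \<kappa> * ennreal \<beta>"
    using \<beta> by (subst nn_integral_cmult_indicator) auto
  finally show False using le by simp
qed

lemma poincare_inequality:
  fixes \<Omega> :: "'a::euclidean_space set"
  assumes "open \<Omega>" "connected \<Omega>" "bounded \<Omega>" "lipschitz_boundary \<Omega>" and p: "p \<ge> 1"
  shows "\<exists>C\<ge>0. \<forall>\<phi> G. C1_gradient \<phi> G \<longrightarrow> (\<exists>c. pow_integral p \<Omega> (\<lambda>x. \<phi> x - c) \<le> ennreal C * pow_integral p \<Omega> G)"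
proof (cases "\<Omega> = {}")
  case True
  then show ?thesis by (auto simp: pow_integral_def)
next
  case False
  then obtain b r where b: "b \<in> \<Omega>" and r: "r > 0" "ball b r \<subseteq> \<Omega>"
    using \<open>open \<Omega>\<close> by (metis openE ex_in_conv)
  obtain C where C: "C \<ge> 0" and
    CO: "\<And>\<phi> G. C1_gradient \<phi> G \<Longrightarrow> pow_integral p \<Omega> \<phi> \<le> ennreal C * (pow_integral p (ball b r) \<phi> + pow_integral p \<Omega> G)"
    by (rule Lp_controlledE[OF Lp_controlled_domain[OF assms(1,2) p b r(1) assms(4,3)]]) (rule that)
  define K where "K = (4 * r) powr p * 4 ^ DIM('a)"
  have K: "K \<ge> 0" by (simp add: K_def)
  have "\<exists>c. pow_integral p \<Omega> (\<lambda>x. \<phi> x - c) \<le> ennreal (C * (K + 1)) * pow_integral p \<Omega> G"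
    if C1: "C1_gradient \<phi> G" for \<phi> G
  proof -
    obtain c where c: "pow_integral p (ball b r) (\<lambda>x. \<phi> x - c) \<le> ennreal K * pow_integral p \<Omega> G"
      using poincare_ball[OF C1 assms(1,3) p r(2,1)] unfolding K_def by blast
    have "pow_integral p \<Omega> (\<lambda>x. \<phi> x - c) \<le> ennreal C * (pow_integral p (ball b r) (\<lambda>x. \<phi> x - c) + pow_integral p \<Omega> G)"
      by (rule CO[OF C1_gradient_diff_const[OF C1]])
    also have "... \<le> ennreal C * (ennreal K * pow_integral p \<Omega> G + pow_integral p \<Omega> G)"
      using c by (intro mult_left_mono add_right_mono) auto
    also have "... = ennreal (C * (K + 1)) * pow_integral p \<Omega> G"
      using C K by (simp add: ennreal_mult distrib_right mult.assoc)
    finally show ?thesis by blast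
  qed
  then show ?thesis using C K by (intro exI[of _ "C * (K + 1)"]) auto
qed


section \<open>Smooth functions and test functions\<close>

lemma has_derivative_imp_gradient:
  fixes \<phi> :: "'a::euclidean_space \<Rightarrow> real"
  assumes "\<phi> differentiable (at x)"
  shows "(\<phi> has_derivative (\<lambda>h. gradient \<phi> x \<bullet> h)) (at x)"
proof -
  let ?D = "frechet_derivative \<phi> (at x)"
  have D: "(\<phi> has_derivative ?D) (at x)" using assms by (simp add: frechet_derivative_works)
  then interpret bounded_linear ?D by (rule has_derivative_bounded_linear)
  have "?D h = gradient \<phi> x \<bullet> h" for h
  proof -
    have "?D h = ?D (\<Sum>b\<in>Basis. (h \<bullet> b) *\<^sub>R b)" by (simp add: euclidean_representation)
    also have "... = (\<Sum>b\<in>Basis. (h \<bullet> b) * ?D b)" by (simp add: sum scale)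
    also have "... = gradient \<phi> x \<bullet> h" by (simp add: gradient_def inner_sum_left inner_commute[of h] mult.commute)
    finally show ?thesis .
  qed
  then have "?D = (\<lambda>h. gradient \<phi> x \<bullet> h)" by blast
  then show ?thesis using D by simp
qed

lemma smooth_differentiable: "smooth \<phi> \<Longrightarrow> \<phi> differentiable (at x)"
  unfolding smooth_def by (drule spec[of _ "[]"]) simp

lemma smooth_C1_gradient:
  fixes \<phi> :: "'a::euclidean_space \<Rightarrow> real"
  assumes "smooth \<phi>"
  shows "C1_gradient \<phi> (gradient \<phi>)"
  unfolding C1_gradient_def
proof (intro conjI allI)
  show "(\<phi> has_derivative (\<lambda>h. gradient \<phi> x \<bullet> h)) (at x)" for x
    by (intro has_derivative_imp_gradient smooth_differentiable assms)
  have "iterated_deriv [b] \<phi> differentiable (at x)" for b x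
    using assms unfolding smooth_def by blast
  then have "isCont (\<lambda>x. frechet_derivative \<phi> (at x) b) x" for b x
    by (simp add: differentiable_imp_continuous_within)
  then show "continuous_on UNIV (gradient \<phi>)"
    unfolding gradient_def by (intro continuous_intros continuous_at_imp_continuous_on) auto
qed

lemma frechet_derivative_diff_const:
  fixes \<phi> :: "'a::euclidean_space \<Rightarrow> real"
  assumes "\<phi> differentiable (at x)"
  shows "frechet_derivative (\<lambda>x. \<phi> x - c) (at x) = frechet_derivative \<phi> (at x)"
proof -
  have "((\<lambda>x. \<phi> x - c) has_derivative frechet_derivative \<phi> (at x)) (at x)"
    using has_derivative_diff[OF assms[unfolded frechet_derivative_works] has_derivative_const[of c]] by simp
  then show ?thesis by (rule frechet_derivative_at[symmetric])
qed

lemma smooth_diff_const: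
  fixes \<phi> :: "'a::euclidean_space \<Rightarrow> real"
  assumes "smooth \<phi>"
  shows "smooth (\<lambda>x. \<phi> x - c)"
proof -
  have eq: "iterated_deriv vs (\<lambda>x. \<phi> x - c) = (\<lambda>x. iterated_deriv vs \<phi> x - (if vs = [] then c else 0))" for vs
  proof (induction vs)
    case (Cons v vs)
    have "iterated_deriv vs \<phi> differentiable (at x)" for x
      using assms by (simp add: smooth_def)
    then show ?case by (simp add: Cons frechet_derivative_diff_const)
  qed simp
  show ?thesis
    unfolding smooth_def eq using assms by (auto simp: smooth_def intro!: derivative_intros)
qed

lemma smooth_zero: "smooth (\<lambda>_::'a::euclidean_space. 0)"
proof -
  have eq: "iterated_deriv vs (\<lambda>_::'a. 0) = (\<lambda>_. 0)" for vs
    by (induction vs) auto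
  show ?thesis unfolding smooth_def eq by simp
qed

lemma gradient_diff_const:
  assumes "smooth \<phi>"
  shows "gradient (\<lambda>x. \<phi> x - c) = gradient \<phi>"
  unfolding gradient_def using smooth_differentiable[OF assms] by (simp add: frechet_derivative_diff_const)

text \<open>
  The partial derivative is the limit of difference quotients, whose integrals vanish by translation invariance; they are dominated because a compactly supported \<open>C\<^sup>1\<close> function is Lipschitz.
\<close>

lemma integral_partial_derivative_zero:
  fixes \<phi> :: "'a::euclidean_space \<Rightarrow> real"
  assumes C1: "C1_gradient \<phi> G" and supp: "\<And>x. norm x > R \<Longrightarrow> \<phi> x = 0 \<and> G x = 0" and b: "norm b = 1"
  shows "(LINT x|lborel. G x \<bullet> b) = 0"
proof -
  note [measurable] = C1_gradient_measurable[OF C1]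
  define s where "s n x = real (Suc n) * (\<phi> (x + (1 / real (Suc n)) *\<^sub>R b) - \<phi> x)" for n x
  have [measurable]: "s n \<in> borel_measurable borel" for n unfolding s_def by measurable
  obtain L where "L > 0" and "\<And>x. x \<in> closure (cball 0 R) \<Longrightarrow> norm (G x) \<le> L"
    by (rule continuous_bounded_on_closure[OF bounded_cball C1_gradient_continuous(2)[OF C1]]) (rule that)
  then have L: "norm (G x) \<le> L" for x using supp[of x] by (cases "norm x \<le> R") auto
  have lip: "\<bar>\<phi> (x + t *\<^sub>R b) - \<phi> x\<bar> \<le> L * t" if "t \<ge> 0" for x t
  proof -
    have "ennreal \<bar>\<phi> (x + t *\<^sub>R b) - \<phi> x\<bar> \<le> (\<integral>\<^sup>+u\<in>{0..t}. ennreal (norm (G (x + u *\<^sub>R b))) \<partial>lborel)"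
      using C1_segment_le[OF C1 that, of x b] b by simp
    also have "... \<le> (\<integral>\<^sup>+u. ennreal L * indicator {0..t} u \<partial>lborel)"
      using L by (intro nn_integral_mono) (auto intro!: ennreal_leI split: split_indicator)
    also have "... = ennreal (L * t)"
      using that \<open>L > 0\<close> by (subst nn_integral_cmult_indicator) (auto simp: ennreal_mult)
    finally show ?thesis using that \<open>L > 0\<close> by simp
  qed
  have bound: "norm (s n x) \<le> L * indicator (cball 0 (R + 1)) x" for n x
  proof (cases "norm x \<le> R + 1")
    case True
    have "\<bar>s n x\<bar> \<le> real (Suc n) * (L * (1 / real (Suc n)))"
      unfolding s_def abs_mult using lip[of "1 / real (Suc n)" x] by (intro mult_mono) auto
    then show ?thesis using True by simp
  next
    case False
    have "norm x \<le> norm (x + (1 / real (Suc n)) *\<^sub>R b) + norm ((1 / real (Suc n)) *\<^sub>R b)"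
      using norm_triangle_ineq4[of "x + (1 / real (Suc n)) *\<^sub>R b" "(1 / real (Suc n)) *\<^sub>R b"] by simp
    moreover have "norm ((1 / real (Suc n)) *\<^sub>R b) \<le> 1" using b by simp
    ultimately have "R < norm (x + (1 / real (Suc n)) *\<^sub>R b)" using False by linarith
    then have "s n x = 0" using supp False by (simp add: s_def)
    then show ?thesis using \<open>L > 0\<close> by simp
  qed
  have int_ball: "integrable lborel (\<lambda>x. L * indicator (cball (0::'a) (R + 1)) x)"
    using emeasure_bounded_finite[of "cball (0::'a) (R + 1)"] by (intro integrable_mult_right integrable_real_indicator) auto
  have "(\<lambda>n. LINT x|lborel. s n x) \<longlonglongrightarrow> (LINT x|lborel. G x \<bullet> b)"
  proof (rule integral_dominated_convergence[OF _ _ int_ball])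
    show "AE x in lborel. (\<lambda>n. s n x) \<longlonglongrightarrow> G x \<bullet> b"
    proof (rule AE_I2)
      fix x
      have D: "(\<phi> has_derivative (\<lambda>h. G x \<bullet> h)) (at (x + 0 *\<^sub>R b))" using C1 by (simp add: C1_gradient_def)
      have "((\<lambda>t. \<phi> (x + t *\<^sub>R b)) has_derivative (\<lambda>t. G x \<bullet> (t *\<^sub>R b))) (at 0)"
        by (rule has_derivative_compose[where g = \<phi> and f = "\<lambda>t. x + t *\<^sub>R b", OF _ D]) (auto intro!: derivative_eq_intros)
      then have "((\<lambda>t. \<phi> (x + t *\<^sub>R b)) has_real_derivative G x \<bullet> b) (at 0)"
        by (simp add: has_field_derivative_def mult_commute_abs)
      then have lim: "((\<lambda>t. (\<phi> (x + t *\<^sub>R b) - \<phi> x) / t) \<longlongrightarrow> G x \<bullet> b) (at 0)"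
        by (simp add: DERIV_def)
      have "filterlim (\<lambda>n. 1 / real (Suc n)) (at 0) sequentially"
        by (intro filterlim_atI LIMSEQ_Suc[OF lim_1_over_n]) auto
      from filterlim_compose[OF lim this] show "(\<lambda>n. s n x) \<longlonglongrightarrow> G x \<bullet> b"
        by (simp add: s_def mult.commute)
    qed
  qed (use bound in auto)
  moreover have "(LINT x|lborel. s n x) = 0" for n
  proof -
    have "integrable lborel (\<lambda>x. indicator (cball 0 R) x *\<^sub>R \<phi> x)"
      using C1_gradient_continuous(1)[OF C1] by (intro borel_integrable_compact) (auto intro: continuous_on_subset)
    also have "(\<lambda>x. indicator (cball 0 R) x *\<^sub>R \<phi> x) = \<phi>"
      using supp by (auto simp: fun_eq_iff not_le split: split_indicator)
    finally have int: "integrable lborel \<phi>" .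
    have "has_bochner_integral (distr lborel borel ((+) w)) \<phi> (integral\<^sup>L lborel \<phi>)" for w
      using has_bochner_integral_integrable[OF int] by (simp only: lborel_distr_plus)
    then have shift: "has_bochner_integral lborel (\<lambda>x. \<phi> (w + x)) (integral\<^sup>L lborel \<phi>)" for w
      unfolding has_bochner_integral_iff by (simp add: integrable_distr_eq integral_distr)
    have "has_bochner_integral lborel (s n) (real (Suc n) * (integral\<^sup>L lborel \<phi> - integral\<^sup>L lborel \<phi>))"
      unfolding s_def using shift[of "(1 / real (Suc n)) *\<^sub>R b"] has_bochner_integral_integrable[OF int]
      by (intro has_bochner_integral_mult_right has_bochner_integral_diff) (auto simp: add.commute)
    then show ?thesis by (simp add: has_bochner_integral_iff)
  qed
  ultimately show ?thesis using LIMSEQ_unique[of "\<lambda>_. 0::real"] by simp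
qed


section \<open>The Poincare inequality for Sobolev functions with mean zero trace\<close>

lemma Lp_norm_powr:
  assumes "p > 0"
  shows "Lp_norm p M h powr p = (LINT x|M. norm (h x) powr p)"
  using assms by (simp add: Lp_norm_def powr_powr)

lemma Lp_norm_nonneg: "Lp_norm p M h \<ge> 0"
  by (simp add: Lp_norm_def)

lemma Lp_norm_tendsto_zero:
  assumes "p > 0" "(\<lambda>n. Lp_norm p M (h n)) \<longlonglongrightarrow> 0"
  shows "(\<lambda>n. LINT x|M. norm (h n x) powr p) \<longlonglongrightarrow> 0"
proof -
  have "(\<lambda>n. Lp_norm p M (h n) powr p) \<longlonglongrightarrow> 0 powr p"
    using assms by (intro tendsto_powr' tendsto_const) (auto simp: Lp_norm_nonneg)
  then show ?thesis using assms by (simp add: Lp_norm_powr)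
qed

lemma Lp_diff:
  fixes u v :: "'x \<Rightarrow> 'b::euclidean_space"
  assumes "p \<ge> 1" "u \<in> Lp p M" "v \<in> Lp p M"
  shows "(\<lambda>x. u x - v x) \<in> Lp p M"
proof -
  have [measurable]: "u \<in> borel_measurable M" "v \<in> borel_measurable M" using assms by (auto simp: Lp_def)
  have "integrable M (\<lambda>x. 2 powr p * (norm (u x) powr p + norm (v x) powr p))"
    using assms by (auto simp: Lp_def)
  then have "integrable M (\<lambda>x. norm (u x - v x) powr p)"
  proof (rule Bochner_Integration.integrable_bound)
    show "AE x in M. norm (norm (u x - v x) powr p) \<le> norm (2 powr p * (norm (u x) powr p + norm (v x) powr p))"
    proof (rule AE_I2)
      fix x
      have "norm (u x - v x) powr p \<le> (norm (u x) + norm (v x)) powr p"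
        using assms by (intro powr_mono2 norm_triangle_ineq4) auto
      also have "... \<le> 2 powr p * (norm (u x) powr p + norm (v x) powr p)"
        using assms by (intro powr_add_le) auto
      finally show "norm (norm (u x - v x) powr p) \<le> norm (2 powr p * (norm (u x) powr p + norm (v x) powr p))" by simp
    qed
  qed measurable
  then show ?thesis by (simp add: Lp_def)
qed

lemma bounded_in_Lp:
  assumes "finite_measure M" "h \<in> borel_measurable M" "p \<ge> 1" and b: "\<And>x. x \<in> space M \<Longrightarrow> norm (h x) \<le> b"
  shows "h \<in> Lp p M"
proof -
  interpret finite_measure M by fact
  have [measurable]: "h \<in> borel_measurable M" by fact
  have "integrable M (\<lambda>x. norm (h x) powr p)"
    using assms by (intro integrable_const_bound[where B = "b powr p"]) (auto intro!: AE_I2 powr_mono2)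
  then show ?thesis by (simp add: Lp_def)
qed

lemma Lp_imp_integrable:
  fixes h :: "'x \<Rightarrow> 'b::euclidean_space"
  assumes "finite_measure M" "h \<in> Lp p M" "p \<ge> 1"
  shows "integrable M h"
proof -
  interpret finite_measure M by fact
  have "integrable M (\<lambda>x. 1 + norm (h x) powr p)" using assms by (auto simp: Lp_def)
  then show ?thesis
  proof (rule Bochner_Integration.integrable_bound)
    show "h \<in> borel_measurable M" using assms by (simp add: Lp_def)
    show "AE x in M. norm (h x) \<le> norm (1 + norm (h x) powr p)"
      using le_add_powr[OF \<open>p \<ge> 1\<close>, of "norm (h _)" 1] by (intro AE_I2) simp
  qed
qed

lemma Lp_L1_bound:
  fixes h :: "'x \<Rightarrow> real"
  assumes "finite_measure M" "h \<in> Lp p M" "p \<ge> 1"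
  shows "(LINT x|M. \<bar>h x\<bar>) \<le> (measure M (space M) + 1) * Lp_norm p M h"
proof -
  interpret finite_measure M by fact
  have int: "integrable M h" by (rule Lp_imp_integrable[OF assms])
  have [measurable]: "h \<in> borel_measurable M" using assms by (simp add: Lp_def)
  have ip: "integrable M (\<lambda>x. \<bar>h x\<bar> powr p)" using assms by (simp add: Lp_def)
  have "ennreal (LINT x|M. \<bar>h x\<bar>) = (\<integral>\<^sup>+x\<in>space M. ennreal \<bar>h x\<bar> \<partial>M)"
    using int by (subst nn_integral_eq_integral[symmetric]) (auto intro!: nn_integral_cong)
  also have "... \<le> ennreal ((measure M (space M) + 1) * (LINT x|M. \<bar>h x\<bar> powr p) powr (1 / p))"
  proof (rule nn_set_integral_L1_le_Lp)
    show "(\<integral>\<^sup>+x\<in>space M. ennreal (\<bar>h x\<bar> powr p) \<partial>M) = ennreal (LINT x|M. \<bar>h x\<bar> powr p)"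
      using ip by (subst nn_integral_eq_integral[symmetric]) (auto intro!: nn_integral_cong)
    show "emeasure M (space M) = ennreal (measure M (space M))" by (rule emeasure_eq_measure)
  qed (use assms in auto)
  finally show ?thesis by (simp add: Lp_norm_def ennreal_le_iff)
qed

lemma finite_measure_lebesgue_on:
  fixes \<Omega> :: "'a::euclidean_space set"
  assumes "bounded \<Omega>" "open \<Omega>"
  shows "finite_measure (lebesgue_on \<Omega>)"
proof
  have "emeasure lborel \<Omega> < \<infinity>" using assms by (intro emeasure_bounded_finite)
  then show "emeasure (lebesgue_on \<Omega>) (space (lebesgue_on \<Omega>)) \<noteq> \<infinity>"
    using assms by (simp add: emeasure_restrict_space space_restrict_space)
qed

lemma nn_integral_lebesgue_on:
  assumes "open \<Omega>"
  shows "(\<integral>\<^sup>+x. k x \<partial>lebesgue_on \<Omega>) = (\<integral>\<^sup>+x\<in>\<Omega>. k x \<partial>lborel)"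
  using assms by (subst nn_integral_restrict_space) (auto simp: nn_integral_completion)

lemma pow_integral_eq_LINT:
  assumes "open \<Omega>" "h \<in> Lp p (lebesgue_on \<Omega>)"
  shows "pow_integral p \<Omega> h = ennreal (LINT x|lebesgue_on \<Omega>. norm (h x) powr p)"
  using assms unfolding pow_integral_def nn_integral_lebesgue_on[OF assms(1), symmetric]
  by (intro nn_integral_eq_integral) (auto simp: Lp_def)

lemma continuous_in_Lp_lebesgue_on:
  fixes h :: "'a::euclidean_space \<Rightarrow> 'b::euclidean_space"
  assumes "bounded \<Omega>" "open \<Omega>" "continuous_on UNIV h" "p \<ge> 1"
  shows "h \<in> Lp p (lebesgue_on \<Omega>)"
proof -
  obtain b where b: "\<And>x. x \<in> closure \<Omega> \<Longrightarrow> norm (h x) \<le> b"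
    by (rule continuous_bounded_on_closure[OF assms(1,3)]) (rule that)
  have "h \<in> borel_measurable borel" using assms by (intro borel_measurable_continuous_onI)
  then have "h \<in> borel_measurable (lebesgue_on \<Omega>)"
    by (intro measurable_restrict_space1 measurable_completion) simp
  then show ?thesis
    using assms b closure_subset[of \<Omega>]
    by (intro bounded_in_Lp[where b = b] finite_measure_lebesgue_on) (auto simp: space_restrict_space)
qed

lemma space_boundary_measure [simp]: "space (boundary_measure \<Omega>) = frontier \<Omega>"
  by (simp add: boundary_measure_def space_restrict_space)

lemma measurable_boundary_measure:
  "h \<in> borel_measurable borel \<Longrightarrow> h \<in> borel_measurable (boundary_measure \<Omega>)"
  unfolding boundary_measure_def by (intro measurable_restrict_space1) (simp cong: measurable_cong_sets)

lemma nn_integral_boundary_measure: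
  fixes \<Omega> :: "'a::euclidean_space set"
  shows "(\<integral>\<^sup>+x. k x \<partial>boundary_measure \<Omega>) = (\<integral>\<^sup>+x\<in>frontier \<Omega>. k x \<partial>hausdorff_measure (DIM('a) - 1))"
  unfolding boundary_measure_def by (subst nn_integral_restrict_space) (auto simp: borel_closed)

lemma emeasure_boundary_measure:
  fixes \<Omega> :: "'a::euclidean_space set"
  shows "emeasure (boundary_measure \<Omega>) (frontier \<Omega>) = emeasure (hausdorff_measure (DIM('a) - 1)) (frontier \<Omega>)"
  unfolding boundary_measure_def by (subst emeasure_restrict_space) (auto simp: borel_closed)

lemma finite_measure_boundary_measure:
  fixes \<Omega> :: "'a::euclidean_space set"
  assumes "bounded \<Omega>" "open \<Omega>" "lipschitz_boundary \<Omega>"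
  shows "finite_measure (boundary_measure \<Omega>)"
  using hausdorff_frontier_finite[OF assms] by (intro finite_measureI) (simp add: emeasure_boundary_measure)

lemma continuous_in_Lp_boundary:
  fixes h :: "'a::euclidean_space \<Rightarrow> 'b::euclidean_space"
  assumes "bounded \<Omega>" "open \<Omega>" "lipschitz_boundary \<Omega>" "continuous_on UNIV h" "p \<ge> 1"
  shows "h \<in> Lp p (boundary_measure \<Omega>)"
proof -
  obtain b where "\<And>x. x \<in> closure \<Omega> \<Longrightarrow> norm (h x) \<le> b"
    by (rule continuous_bounded_on_closure[OF assms(1,4)]) (rule that)
  then have "norm (h x) \<le> b" if "x \<in> frontier \<Omega>" for x using that by (simp add: frontier_def)
  moreover have "h \<in> borel_measurable borel" using assms by (intro borel_measurable_continuous_onI)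
  ultimately show ?thesis
    using assms by (intro bounded_in_Lp[where b = b] finite_measure_boundary_measure measurable_boundary_measure) auto
qed

lemma measure_boundary_pos:
  fixes \<Omega> :: "'a::euclidean_space set"
  assumes "bounded \<Omega>" "open \<Omega>" "lipschitz_boundary \<Omega>" "\<Omega> \<noteq> {}"
  shows "measure (boundary_measure \<Omega>) (frontier \<Omega>) > 0"
proof -
  interpret finite_measure "boundary_measure \<Omega>" by (rule finite_measure_boundary_measure[OF assms(1-3)])
  have "emeasure (boundary_measure \<Omega>) (frontier \<Omega>) = hausdorff_outer (DIM('a) - 1) (frontier \<Omega>)"
    by (simp add: emeasure_boundary_measure emeasure_hausdorff_measure borel_closed)
  then have "emeasure (boundary_measure \<Omega>) (frontier \<Omega>) > 0"
    using hausdorff_outer_frontier_pos[OF assms(1,2,4)] by simp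
  then show ?thesis by (simp add: emeasure_eq_measure)
qed

lemma trace_inequality_LINT:
  fixes \<Omega> :: "'a::euclidean_space set"
  assumes "bounded \<Omega>" "open \<Omega>" "lipschitz_boundary \<Omega>" and p: "p \<ge> 1"
  shows "\<exists>C\<ge>0. \<forall>\<phi> G. C1_gradient \<phi> G \<longrightarrow>
    (LINT x|boundary_measure \<Omega>. \<bar>\<phi> x\<bar>) \<le> C * (Lp_norm p (lebesgue_on \<Omega>) \<phi> + Lp_norm p (lebesgue_on \<Omega>) G)"
proof -
  let ?M = "lebesgue_on \<Omega>" and ?B = "boundary_measure \<Omega>"
  note fin = finite_measure_lebesgue_on[OF assms(1,2)] finite_measure_boundary_measure[OF assms(1-3)]
  obtain C where C: "C \<ge> 0" and CT: "\<forall>\<phi> G. C1_gradient \<phi> G \<longrightarrow>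
     (\<integral>\<^sup>+x\<in>frontier \<Omega>. ennreal \<bar>\<phi> x\<bar> \<partial>hausdorff_measure (DIM('a) - 1)) \<le> ennreal C * L1_norm_C1 \<Omega> \<phi> G"
    using trace_inequality[OF assms(1-3)] unfolding trace_controlled_def by blast
  define m where "m = measure ?M (space ?M) + 1"
  have m: "m \<ge> 0" by (simp add: m_def)
  have "(LINT x|?B. \<bar>\<phi> x\<bar>) \<le> C * m * (Lp_norm p ?M \<phi> + Lp_norm p ?M G)"
    if C1: "C1_gradient \<phi> G" for \<phi> G
  proof -
    note cont = C1_gradient_continuous[OF C1]
    have contn: "continuous_on UNIV (\<lambda>x. norm (G x))" using cont by (intro continuous_intros)
    note L = continuous_in_Lp_lebesgue_on[OF assms(1,2) cont(1) p] continuous_in_Lp_lebesgue_on[OF assms(1,2) contn p]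
    note I = L[THEN Lp_imp_integrable[OF fin(1) _ p]]
    have "ennreal (LINT x|?B. \<bar>\<phi> x\<bar>) = (\<integral>\<^sup>+x. ennreal \<bar>\<phi> x\<bar> \<partial>?B)"
      using Lp_imp_integrable[OF fin(2) continuous_in_Lp_boundary[OF assms(1-3) cont(1) p] p]
      by (intro nn_integral_eq_integral[symmetric]) auto
    also have "... \<le> ennreal C * L1_norm_C1 \<Omega> \<phi> G"
      using CT C1 by (simp add: nn_integral_boundary_measure)
    also have "L1_norm_C1 \<Omega> \<phi> G = ennreal (LINT x|?M. \<bar>\<phi> x\<bar>) + ennreal (LINT x|?M. norm (G x))"
      unfolding L1_norm_C1_def nn_integral_lebesgue_on[OF assms(2), symmetric]
      using I by (intro arg_cong2[where f = "(+)"] nn_integral_eq_integral) auto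
    also have "ennreal C * ... = ennreal (C * ((LINT x|?M. \<bar>\<phi> x\<bar>) + (LINT x|?M. norm (G x))))"
      using C by (simp add: ennreal_mult)
    finally have "(LINT x|?B. \<bar>\<phi> x\<bar>) \<le> C * ((LINT x|?M. \<bar>\<phi> x\<bar>) + (LINT x|?M. norm (G x)))"
      using C by simp
    also have "... \<le> C * (m * Lp_norm p ?M \<phi> + m * Lp_norm p ?M G)"
    proof (intro mult_left_mono add_mono C)
      show "(LINT x|?M. \<bar>\<phi> x\<bar>) \<le> m * Lp_norm p ?M \<phi>"
        unfolding m_def by (rule Lp_L1_bound[OF fin(1) L(1) p])
      show "(LINT x|?M. norm (G x)) \<le> m * Lp_norm p ?M G"
        using Lp_L1_bound[OF fin(1) L(2) p] by (simp add: m_def Lp_norm_def)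
    qed
    finally show ?thesis by (simp add: algebra_simps)
  qed
  then show ?thesis using C m by (intro exI[of _ "C * m"]) auto
qed

text \<open>
  The constant \<open>c\<close> of the Poincare inequality is recovered from boundary values: by the trace inequality
  for \<open>\<phi> - c\<close>, the number \<open>c\<close> times the surface measure differs from the boundary integral of \<open>\<phi>\<close> by at
  most a multiple of the norm of the gradient. This determines \<open>c\<close> because the surface
  measure is positive.
\<close>

lemma poincare_trace_inequality_C1:
  fixes \<Omega> :: "'a::euclidean_space set"
  assumes "bounded \<Omega>" "open \<Omega>" "lipschitz_boundary \<Omega>" "connected \<Omega>" "\<Omega> \<noteq> {}" and p: "p \<ge> 1"
  shows "\<exists>C\<ge>0. \<forall>\<phi> G. C1_gradient \<phi> G \<longrightarrow>
    (LINT x|lebesgue_on \<Omega>. \<bar>\<phi> x\<bar> powr p) \<le> C * ((LINT x|lebesgue_on \<Omega>. norm (G x) powr p) + \<bar>LINT x|boundary_measure \<Omega>. \<phi> x\<bar> powr p)"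
proof -
  let ?M = "lebesgue_on \<Omega>" and ?B = "boundary_measure \<Omega>"
  note fin = finite_measure_lebesgue_on[OF assms(1,2)] finite_measure_boundary_measure[OF assms(1-3)]
  obtain P where P: "P \<ge> 0" and PI: "\<forall>\<phi> G. C1_gradient \<phi> G \<longrightarrow>
      (\<exists>c. pow_integral p \<Omega> (\<lambda>x. \<phi> x - c) \<le> ennreal P * pow_integral p \<Omega> G)"
    using poincare_inequality[OF assms(2,4,1,3) p] by blast
  obtain T where T: "T \<ge> 0" and TI: "\<forall>\<phi> G. C1_gradient \<phi> G \<longrightarrow>
    (LINT x|?B. \<bar>\<phi> x\<bar>) \<le> T * (Lp_norm p ?M \<phi> + Lp_norm p ?M G)"
    using trace_inequality_LINT[OF assms(1-3) p] by blast
  define h where "h = measure ?B (frontier \<Omega>)"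
  have h: "h > 0" unfolding h_def by (rule measure_boundary_pos[OF assms(1-3,5)])
  define m where "m = measure ?M (space ?M)"
  have m: "m \<ge> 0" by (simp add: m_def)
  define Q where "Q = (T * (P powr (1 / p) + 1)) powr p"
  have Q: "Q \<ge> 0" by (simp add: Q_def)
  define C where "C = 2 powr p * (P + m * (2 powr p * (1 + Q) / h powr p))"
  have "(LINT x|?M. \<bar>\<phi> x\<bar> powr p) \<le> C * ((LINT x|?M. norm (G x) powr p) + \<bar>LINT x|?B. \<phi> x\<bar> powr p)"
    if C1: "C1_gradient \<phi> G" for \<phi> G
  proof -
    define D where "D = (LINT x|?M. norm (G x) powr p)"
    define J where "J = \<bar>LINT x|?B. \<phi> x\<bar>"
    have D: "D \<ge> 0" by (simp add: D_def)
    obtain c where c: "pow_integral p \<Omega> (\<lambda>x. \<phi> x - c) \<le> ennreal P * pow_integral p \<Omega> G"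
      using PI C1 by blast
    note C1c = C1_gradient_diff_const[OF C1, of c]
    note L = continuous_in_Lp_lebesgue_on[OF assms(1,2) C1_gradient_continuous(1)[OF C1] p]
      continuous_in_Lp_lebesgue_on[OF assms(1,2) C1_gradient_continuous(2)[OF C1] p]
      continuous_in_Lp_lebesgue_on[OF assms(1,2) C1_gradient_continuous(1)[OF C1c] p]
    note B = continuous_in_Lp_boundary[OF assms(1-3) C1_gradient_continuous(1)[OF C1] p]
      continuous_in_Lp_boundary[OF assms(1-3) C1_gradient_continuous(1)[OF C1c] p]
    note BI = B[THEN Lp_imp_integrable[OF fin(2) _ p]]
    define N where "N = (LINT x|?M. \<bar>\<phi> x - c\<bar> powr p)"
    have "ennreal N \<le> ennreal (P * D)"
      using c P unfolding pow_integral_eq_LINT[OF assms(2) L(2)] pow_integral_eq_LINT[OF assms(2) L(3)]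
      by (simp add: N_def D_def ennreal_mult)
    then have N: "N \<le> P * D" using P D by simp
    have N0: "N \<ge> 0" by (simp add: N_def)
    have "(LINT x|?B. \<bar>\<phi> x - c\<bar>) \<le> T * (N powr (1 / p) + D powr (1 / p))"
      using TI[rule_format, OF C1c] by (simp add: Lp_norm_def N_def D_def)
    also have "... \<le> T * ((P * D) powr (1 / p) + D powr (1 / p))"
      using N N0 T p by (intro mult_left_mono add_right_mono powr_mono2) auto
    also have "... = T * (P powr (1 / p) + 1) * D powr (1 / p)"
      using P D by (simp add: powr_mult algebra_simps)
    finally have tr: "(LINT x|?B. \<bar>\<phi> x - c\<bar>) \<le> T * (P powr (1 / p) + 1) * D powr (1 / p)" .
    have "(LINT x|?B. \<phi> x) - (LINT x|?B. \<phi> x - c) = c * h"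
    proof -
      interpret finite_measure ?B by (rule fin)
      show ?thesis using BI by (subst Bochner_Integration.integral_diff[symmetric]) (auto simp: h_def)
    qed
    then have "\<bar>c\<bar> * h \<le> J + \<bar>LINT x|?B. \<phi> x - c\<bar>"
      using h unfolding J_def by (metis abs_mult abs_of_pos abs_triangle_ineq4)
    also have "\<bar>LINT x|?B. \<phi> x - c\<bar> \<le> (LINT x|?B. \<bar>\<phi> x - c\<bar>)"
      by (rule integral_abs_bound)
    also note tr
    finally have "\<bar>c\<bar> * h \<le> J + T * (P powr (1 / p) + 1) * D powr (1 / p)" by simp
    then have "(\<bar>c\<bar> * h) powr p \<le> (J + T * (P powr (1 / p) + 1) * D powr (1 / p)) powr p"
      using h p by (intro powr_mono2) auto
    also have "... \<le> 2 powr p * (J powr p + (T * (P powr (1 / p) + 1) * D powr (1 / p)) powr p)"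
      using p T by (intro powr_add_le) (auto simp: J_def)
    also have "(T * (P powr (1 / p) + 1) * D powr (1 / p)) powr p = Q * D"
      using T D p by (simp add: Q_def powr_mult powr_powr)
    also have "2 powr p * (J powr p + Q * D) \<le> 2 powr p * ((1 + Q) * (D + J powr p))"
      using Q D by (intro mult_left_mono) (auto simp: algebra_simps)
    finally have cp: "\<bar>c\<bar> powr p \<le> 2 powr p * (1 + Q) / h powr p * (D + J powr p)"
      using h by (simp add: powr_mult field_simps)
    have "(LINT x|?M. \<bar>\<phi> x\<bar> powr p) \<le> (LINT x|?M. 2 powr p * (\<bar>\<phi> x - c\<bar> powr p + \<bar>c\<bar> powr p))"
    proof (rule integral_mono)
      interpret finite_measure ?M by (rule fin)
      show "integrable ?M (\<lambda>x. \<bar>\<phi> x\<bar> powr p)" using L(1) by (simp add: Lp_def)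
      show "integrable ?M (\<lambda>x. 2 powr p * (\<bar>\<phi> x - c\<bar> powr p + \<bar>c\<bar> powr p))"
        using L(3) by (auto simp: Lp_def)
      show "\<bar>\<phi> x\<bar> powr p \<le> 2 powr p * (\<bar>\<phi> x - c\<bar> powr p + \<bar>c\<bar> powr p)" for x
        using norm_powr_triangle[OF p, of "\<phi> x" c] by (simp add: add.commute)
    qed
    also have "... = 2 powr p * (N + m * \<bar>c\<bar> powr p)"
    proof -
      interpret finite_measure ?M by (rule fin)
      show ?thesis using L(3) unfolding N_def m_def
        by (subst integral_mult_right_zero, subst Bochner_Integration.integral_add) (auto simp: Lp_def)
    qed
    also have "... \<le> 2 powr p * (P * (D + J powr p) + m * (2 powr p * (1 + Q) / h powr p * (D + J powr p)))"
    proof (intro mult_left_mono add_mono m cp)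
      have "P * D \<le> P * (D + J powr p)" using P by (intro mult_left_mono) auto
      with N show "N \<le> P * (D + J powr p)" by linarith
    qed simp
    also have "... = C * (D + J powr p)" by (simp add: C_def algebra_simps)
    finally show ?thesis by (simp add: D_def J_def)
  qed
  moreover have "C \<ge> 0" using P m Q by (simp add: C_def)
  ultimately show ?thesis by blast
qed

text \<open>
  The inequality for smooth functions passes to the limit along an approximating sequence, whose boundary
  integrals tend to the mean of the trace, which is \<open>0\<close>. All terms are kept as \<open>p\<close>-th powers with
  crude constants.
\<close>

lemma poincare_mean_zero_trace:
  fixes \<Omega> :: "'a::euclidean_space set"
  assumes "bounded \<Omega>" "open \<Omega>" "lipschitz_boundary \<Omega>" "connected \<Omega>" "\<Omega> \<noteq> {}" and p: "p \<ge> 1"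
  shows "\<exists>C\<ge>0. \<forall>u G g. has_trace p \<Omega> u G g \<and> (LINT x|boundary_measure \<Omega>. g x) = 0 \<longrightarrow>
    Lp_norm p (lebesgue_on \<Omega>) u \<le> C * Lp_norm p (lebesgue_on \<Omega>) G"
proof -
  let ?M = "lebesgue_on \<Omega>" and ?B = "boundary_measure \<Omega>"
  note fin = finite_measure_lebesgue_on[OF assms(1,2)] finite_measure_boundary_measure[OF assms(1-3)]
  obtain C where C: "C \<ge> 0" and PT: "\<forall>\<phi> G. C1_gradient \<phi> G \<longrightarrow>
    (LINT x|?M. \<bar>\<phi> x\<bar> powr p) \<le> C * ((LINT x|?M. norm (G x) powr p) + \<bar>LINT x|?B. \<phi> x\<bar> powr p)"
    using poincare_trace_inequality_C1[OF assms] by blast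
  define K where "K = 2 powr p * (C * 2 powr p)"
  have K: "K \<ge> 0" using C by (simp add: K_def)
  have "Lp_norm p ?M u \<le> K powr (1 / p) * Lp_norm p ?M G"
    if tr: "has_trace p \<Omega> u G g" and mean: "(LINT x|?B. g x) = 0" for u G g
  proof -
    obtain \<phi> where sm: "\<And>n. smooth (\<phi> n)"
      and lu: "(\<lambda>n. Lp_norm p ?M (\<lambda>x. \<phi> n x - u x)) \<longlonglongrightarrow> 0"
      and lG: "(\<lambda>n. Lp_norm p ?M (\<lambda>x. gradient (\<phi> n) x - G x)) \<longlonglongrightarrow> 0"
      and lg: "(\<lambda>n. Lp_norm p ?B (\<lambda>x. \<phi> n x - g x)) \<longlonglongrightarrow> 0"
      using tr unfolding has_trace_def by blast
    have uL: "u \<in> Lp p ?M" and GL: "G \<in> Lp p ?M" and gL: "g \<in> Lp p ?B"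
      using tr by (auto simp: has_trace_def has_sobolev_gradient_def)
    have le: "(LINT x|?M. norm (v x) powr p) \<le> 2 powr p * ((LINT x|?M. norm (w x) powr p) + (LINT x|?M. norm (w x - v x) powr p))"
      if "v \<in> Lp p ?M" "w \<in> Lp p ?M" for v w :: "'a \<Rightarrow> 'b::euclidean_space"
    proof -
      have i: "integrable ?M (\<lambda>x. norm (v x) powr p)" "integrable ?M (\<lambda>x. norm (w x) powr p)"
        "integrable ?M (\<lambda>x. norm (w x - v x) powr p)"
        using that Lp_diff[OF p that(2,1)] by (simp_all add: Lp_def)
      have "(LINT x|?M. norm (v x) powr p) \<le> (LINT x|?M. 2 powr p * (norm (w x) powr p + norm (w x - v x) powr p))"
        by (intro integral_mono i integrable_mult_right Bochner_Integration.integrable_add)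
          (metis norm_powr_triangle[OF p] norm_minus_commute)
      also have "... = 2 powr p * ((LINT x|?M. norm (w x) powr p) + (LINT x|?M. norm (w x - v x) powr p))"
        using i by simp
      finally show ?thesis .
    qed
    let ?a = "\<lambda>n. LINT x|?M. norm (\<phi> n x - u x) powr p" and ?b = "\<lambda>n. LINT x|?M. norm (gradient (\<phi> n) x - G x) powr p"
    let ?c = "\<lambda>n. (measure ?B (frontier \<Omega>) + 1) * Lp_norm p ?B (\<lambda>x. \<phi> n x - g x)"
    let ?D = "LINT x|?M. norm (G x) powr p"
    have bound: "(LINT x|?M. norm (u x) powr p) \<le> 2 powr p * (C * (2 powr p * (?D + ?b n) + ?c n powr p) + ?a n)" for n
    proof -
      note C1 = smooth_C1_gradient[OF sm[of n]]
      note cont = C1_gradient_continuous[OF C1]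
      have bL: "\<phi> n \<in> Lp p ?B" by (rule continuous_in_Lp_boundary[OF assms(1-3) cont(1) p])
      note I = Lp_imp_integrable[OF fin(2) bL p] Lp_imp_integrable[OF fin(2) gL p]
      have "\<bar>LINT x|?B. \<phi> n x\<bar> = \<bar>LINT x|?B. \<phi> n x - g x\<bar>"
        using I mean by simp
      also have "... \<le> (LINT x|?B. \<bar>\<phi> n x - g x\<bar>)" by (rule integral_abs_bound)
      also have "... \<le> ?c n" using Lp_L1_bound[OF fin(2) Lp_diff[OF p bL gL] p] by simp
      finally have J: "\<bar>LINT x|?B. \<phi> n x\<bar> powr p \<le> ?c n powr p"
        using p by (intro powr_mono2) auto
      have "(LINT x|?M. norm (u x) powr p) \<le> 2 powr p * ((LINT x|?M. norm (\<phi> n x) powr p) + ?a n)"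
        by (rule le[OF uL continuous_in_Lp_lebesgue_on[OF assms(1,2) cont(1) p]])
      also have "(LINT x|?M. norm (\<phi> n x) powr p) \<le> C * ((LINT x|?M. norm (gradient (\<phi> n) x) powr p) + \<bar>LINT x|?B. \<phi> n x\<bar> powr p)"
        using PT C1 by simp
      also have "... \<le> C * (2 powr p * (?D + ?b n) + ?c n powr p)"
        using le[OF continuous_in_Lp_lebesgue_on[OF assms(1,2) cont(2) p] GL] J
        by (intro mult_left_mono add_mono C) (auto simp: norm_minus_commute)
      finally show ?thesis by (simp add: mult_left_mono)
    qed
    have "p > 0" using p by simp
    have "(\<lambda>n. ?c n) \<longlonglongrightarrow> (measure ?B (frontier \<Omega>) + 1) * 0"
      by (intro tendsto_mult tendsto_const lg)
    then have lc: "(\<lambda>n. ?c n powr p) \<longlonglongrightarrow> 0 powr p"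
      using \<open>p > 0\<close> by (intro tendsto_powr' tendsto_const) (auto simp: Lp_norm_nonneg)
    have "(\<lambda>n. 2 powr p * (C * (2 powr p * (?D + ?b n) + ?c n powr p) + ?a n))
      \<longlonglongrightarrow> 2 powr p * (C * (2 powr p * (?D + 0) + 0 powr p) + 0)"
      by (intro tendsto_intros lc Lp_norm_tendsto_zero[OF \<open>p > 0\<close>] lu lG)
    then have "(LINT x|?M. norm (u x) powr p) \<le> 2 powr p * (C * (2 powr p * (?D + 0) + 0 powr p) + 0)"
      by (rule LIMSEQ_le_const) (use bound in blast)
    then have "(LINT x|?M. norm (u x) powr p) \<le> K * ?D" by (simp add: K_def)
    then have "(LINT x|?M. norm (u x) powr p) powr (1 / p) \<le> (K * ?D) powr (1 / p)"
      using p by (intro powr_mono2) auto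
    also have "... = K powr (1 / p) * ?D powr (1 / p)" using K by (simp add: powr_mult)
    finally show ?thesis by (simp add: Lp_norm_def)
  qed
  then show ?thesis by (intro exI[of _ "K powr (1 / p)"]) auto
qed


section \<open>Constants as competitors, and the energy bounds\<close>

lemma integral_test_function_derivative_zero:
  fixes \<Omega> :: "'a::euclidean_space set"
  assumes "bounded \<Omega>" "open \<Omega>" "test_function \<Omega> \<phi>" "b \<in> Basis"
  shows "(LINT x|lebesgue_on \<Omega>. frechet_derivative \<phi> (at x) b) = 0"
proof -
  have sm: "smooth \<phi>" and supp: "closure {x. \<phi> x \<noteq> 0} \<subseteq> \<Omega>"
    using assms by (auto simp: test_function_def)
  note C1 = smooth_C1_gradient[OF sm]
  have fd: "frechet_derivative \<phi> (at x) h = gradient \<phi> x \<bullet> h" for x h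
    using C1 frechet_derivative_at unfolding C1_gradient_def by metis
  have zero: "\<phi> x = 0 \<and> gradient \<phi> x = 0" if "x \<notin> \<Omega>" for x
  proof -
    have x: "x \<in> - closure {x. \<phi> x \<noteq> 0}" using that supp by blast
    have "(\<phi> has_derivative (\<lambda>h. 0)) (at x)"
    proof (rule has_derivative_transform_within_open[OF _ _ x])
      show "((\<lambda>_. 0) has_derivative (\<lambda>h. 0)) (at x)" by (rule has_derivative_const)
      show "0 = \<phi> y" if "y \<in> - closure {x. \<phi> x \<noteq> 0}" for y
        using that closure_subset[of "{x. \<phi> x \<noteq> 0}"] by auto
    qed auto
    then have "(\<lambda>h. gradient \<phi> x \<bullet> h) = (\<lambda>h. 0)"
      using C1 has_derivative_unique unfolding C1_gradient_def by blast
    then have "gradient \<phi> x = 0" by (metis inner_eq_zero_iff)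
    moreover have "\<phi> x = 0" using x closure_subset[of "{x. \<phi> x \<noteq> 0}"] by auto
    ultimately show ?thesis by simp
  qed
  obtain R where R: "\<And>x. x \<in> \<Omega> \<Longrightarrow> norm x \<le> R" using \<open>bounded \<Omega>\<close> by (auto simp: bounded_iff)
  have [measurable]: "gradient \<phi> \<in> borel_measurable borel" by (rule C1_gradient_measurable[OF C1])
  have "(LINT x|lebesgue_on \<Omega>. gradient \<phi> x \<bullet> b) = (LINT x|lebesgue. indicator \<Omega> x *\<^sub>R (gradient \<phi> x \<bullet> b))"
    using \<open>open \<Omega>\<close> by (subst integral_restrict_space) auto
  also have "... = (LINT x|lebesgue. gradient \<phi> x \<bullet> b)"
    using zero by (intro Bochner_Integration.integral_cong) (auto split: split_indicator)
  also have "... = (LINT x|lborel. gradient \<phi> x \<bullet> b)"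
    by (rule integral_completion) measurable
  also have "... = 0"
  proof (rule integral_partial_derivative_zero[OF C1])
    show "\<phi> x = 0 \<and> gradient \<phi> x = 0" if "norm x > R" for x
      using zero[of x] R[of x] that by force
  qed (use assms in simp)
  finally show ?thesis by (simp add: fd)
qed

text \<open>
  Constants have weak gradient zero because the derivative of a test function has integral zero.
\<close>

lemma has_sobolev_gradient_diff_const:
  fixes \<Omega> :: "'a::euclidean_space set"
  assumes "bounded \<Omega>" "open \<Omega>" and p: "p \<ge> 1" and sob: "has_sobolev_gradient p \<Omega> u G"
  shows "has_sobolev_gradient p \<Omega> (\<lambda>x. u x - c) G"
proof -
  let ?M = "lebesgue_on \<Omega>"
  note fin = finite_measure_lebesgue_on[OF assms(1,2)]
  have uL: "u \<in> Lp p ?M" and GL: "G \<in> Lp p ?M" using sob by (auto simp: has_sobolev_gradient_def)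
  have cL: "(\<lambda>_. c) \<in> Lp p ?M"
    by (intro continuous_in_Lp_lebesgue_on assms continuous_intros)
  have "(LINT x|?M. (u x - c) * frechet_derivative \<phi> (at x) b) = - (LINT x|?M. (G x \<bullet> b) * \<phi> x)"
    if tf: "test_function \<Omega> \<phi>" and b: "b \<in> Basis" for \<phi> b
  proof -
    have sm: "smooth \<phi>" using tf by (simp add: test_function_def)
    note C1 = smooth_C1_gradient[OF sm]
    define d where "d x = frechet_derivative \<phi> (at x) b" for x
    have "(LINT x|?M. u x * d x) = - (LINT x|?M. (G x \<bullet> b) * \<phi> x)"
      using sob tf b by (auto simp: has_sobolev_gradient_def d_def)
    moreover have z: "(LINT x|?M. d x) = 0"
      unfolding d_def by (rule integral_test_function_derivative_zero[OF assms(1,2) tf b])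
    moreover have "d x = gradient \<phi> x \<bullet> b" for x
      using C1 frechet_derivative_at unfolding C1_gradient_def d_def by metis
    then have contd: "continuous_on UNIV d"
      using C1_gradient_continuous(2)[OF C1] by (simp add: continuous_on_inner cong: continuous_on_cong)
    then have dL: "d \<in> Lp p ?M" by (intro continuous_in_Lp_lebesgue_on assms)
    then have d_meas: "d \<in> borel_measurable ?M" by (simp add: Lp_def)
    have dint: "integrable ?M d" by (rule Lp_imp_integrable[OF fin dL p])
    obtain L where L: "\<And>x. x \<in> closure \<Omega> \<Longrightarrow> norm (d x) \<le> L"
      by (rule continuous_bounded_on_closure[OF assms(1) contd]) (rule that)
    have "integrable ?M (\<lambda>x. u x * d x)"
    proof (rule Bochner_Integration.integrable_bound)
      show "integrable ?M (\<lambda>x. L * u x)" using Lp_imp_integrable[OF fin uL p] by simp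
      show "(\<lambda>x. u x * d x) \<in> borel_measurable ?M"
        using uL d_meas by (intro borel_measurable_times) (auto simp: Lp_def)
      show "AE x in ?M. norm (u x * d x) \<le> norm (L * u x)"
      proof (rule AE_I2)
        fix x assume "x \<in> space ?M"
        then have "\<bar>d x\<bar> \<le> L" using L[of x] closure_subset[of \<Omega>] by (auto simp: space_restrict_space)
        then have "\<bar>u x\<bar> * \<bar>d x\<bar> \<le> \<bar>u x\<bar> * \<bar>L\<bar>" by (intro mult_left_mono) auto
        then show "norm (u x * d x) \<le> norm (L * u x)" by (simp add: abs_mult mult.commute)
      qed
    qed
    then have "(LINT x|?M. (u x - c) * d x) = (LINT x|?M. u x * d x) - c * (LINT x|?M. d x)"
      using dint by (simp add: left_diff_distrib)
    ultimately show ?thesis by (simp add: d_def)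
  qed
  then show ?thesis
    using Lp_diff[OF p uL cL] GL by (simp add: has_sobolev_gradient_def)
qed

lemma has_trace_diff_const:
  fixes \<Omega> :: "'a::euclidean_space set"
  assumes "bounded \<Omega>" "open \<Omega>" "lipschitz_boundary \<Omega>" and p: "p \<ge> 1" and tr: "has_trace p \<Omega> u G g"
  shows "has_trace p \<Omega> (\<lambda>x. u x - c) G (\<lambda>x. g x - c)"
proof -
  obtain \<phi> where sm: "\<And>n. smooth (\<phi> n)"
    and lim: "(\<lambda>n. Lp_norm p (lebesgue_on \<Omega>) (\<lambda>x. \<phi> n x - u x)) \<longlonglongrightarrow> 0"
      "(\<lambda>n. Lp_norm p (lebesgue_on \<Omega>) (\<lambda>x. gradient (\<phi> n) x - G x)) \<longlonglongrightarrow> 0"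
      "(\<lambda>n. Lp_norm p (boundary_measure \<Omega>) (\<lambda>x. \<phi> n x - g x)) \<longlonglongrightarrow> 0"
    using tr unfolding has_trace_def by blast
  have "has_sobolev_gradient p \<Omega> (\<lambda>x. u x - c) G"
    using tr by (intro has_sobolev_gradient_diff_const assms) (simp add: has_trace_def)
  moreover have "(\<lambda>x. g x - c) \<in> Lp p (boundary_measure \<Omega>)"
  proof (rule Lp_diff[OF p])
    show "g \<in> Lp p (boundary_measure \<Omega>)" using tr by (simp add: has_trace_def)
    show "(\<lambda>_. c) \<in> Lp p (boundary_measure \<Omega>)"
      by (intro continuous_in_Lp_boundary assms continuous_intros)
  qed
  ultimately show ?thesis
    unfolding has_trace_def using sm lim
    by (intro conjI exI[of _ "\<lambda>n x. \<phi> n x - c"]) (auto simp: gradient_diff_const smooth_diff_const)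
qed

lemma has_trace_zero: "has_trace p \<Omega> (\<lambda>_. 0) (\<lambda>_. 0) (\<lambda>_. 0)"
proof -
  have "gradient (\<lambda>_::'a::euclidean_space. 0) = (\<lambda>_. 0)" by (simp add: gradient_def fun_eq_iff)
  then show ?thesis
    unfolding has_trace_def has_sobolev_gradient_def
    by (auto simp: Lp_def Lp_norm_def smooth_zero intro!: exI[of _ "\<lambda>_ _. 0"])
qed

lemma has_trace_const:
  fixes \<Omega> :: "'a::euclidean_space set"
  assumes "bounded \<Omega>" "open \<Omega>" "lipschitz_boundary \<Omega>" "p \<ge> 1"
  shows "has_trace p \<Omega> (\<lambda>_. c) (\<lambda>_. 0) (\<lambda>_. c)"
  using has_trace_diff_const[OF assms has_trace_zero, of "- c"] by simp

lemma has_trace_sobolev: "has_trace p \<Omega> u G g \<Longrightarrow> u \<in> sobolev p \<Omega>"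
  by (auto simp: has_trace_def sobolev_def)

lemma sobolev_dual_const:
  assumes "f \<in> sobolev_dual p \<Omega>" "(\<lambda>_. 1) \<in> sobolev p \<Omega>"
  shows "f (\<lambda>_. c) = c * f (\<lambda>_. 1)"
proof -
  have "\<forall>c. \<forall>u\<in>sobolev p \<Omega>. f (\<lambda>x. c * u x) = c * f u"
    using assms(1) by (simp add: sobolev_dual_def)
  from this[rule_format, OF assms(2), of c] show ?thesis by simp
qed

lemma sobolev_dual_diff_const:
  fixes \<Omega> :: "'a::euclidean_space set"
  assumes "bounded \<Omega>" "open \<Omega>" "lipschitz_boundary \<Omega>" "p \<ge> 1" "f \<in> sobolev_dual p \<Omega>" "u \<in> sobolev p \<Omega>"
  shows "f (\<lambda>x. u x - c) = f u - c * f (\<lambda>_. 1)"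
proof -
  have const: "(\<lambda>_. k) \<in> sobolev p \<Omega>" for k
    by (rule has_trace_sobolev[OF has_trace_const[OF assms(1-4)]])
  have "\<forall>u\<in>sobolev p \<Omega>. \<forall>v\<in>sobolev p \<Omega>. f (\<lambda>x. u x + v x) = f u + f v"
    using assms(5) by (simp add: sobolev_dual_def)
  from this[rule_format, OF assms(6) const[of "- c"]] show ?thesis using sobolev_dual_const[OF assms(5) const, of "- c"] by simp
qed

text \<open>
  Young's inequality for \<open>\<alpha>\<^bsup>1/q\<^esup> |t|\<close> and \<open>|\<mu>| / \<alpha>\<^bsup>1/q\<^esup>\<close>; the scaling puts the weight \<open>\<alpha> / q\<close> of
  the boundary term in front of \<open>|t|\<^sup>q\<close>.
\<close>

lemma young_scaled:
  fixes \<alpha> q \<mu> t :: real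
  assumes "\<alpha> > 0" "q > 1"
  shows "\<mu> * t \<le> \<alpha> / q * \<bar>t\<bar> powr q + (q - 1) / q * (\<bar>\<mu>\<bar> powr (q / (q - 1)) / \<alpha> powr (1 / (q - 1)))"
proof -
  define a b where "a = \<alpha> powr (1 / q) * \<bar>t\<bar>" and "b = \<bar>\<mu>\<bar> / \<alpha> powr (1 / q)"
  have "\<mu> * t \<le> \<bar>\<mu> * t\<bar>" by simp
  also have "... = a * b" using assms by (simp add: a_def b_def abs_mult)
  also have "... \<le> a powr q / q + b powr (q / (q - 1)) / (q / (q - 1))"
    using assms by (intro Youngs_inequality) (auto simp: a_def b_def field_simps)
  also have "a powr q = \<alpha> * \<bar>t\<bar> powr q"
    using assms by (simp add: a_def powr_mult powr_powr)
  also have "b powr (q / (q - 1)) = \<bar>\<mu>\<bar> powr (q / (q - 1)) / \<alpha> powr (1 / (q - 1))"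
    using assms by (simp add: b_def powr_divide powr_powr)
  finally show ?thesis by (simp add: mult.commute)
qed

lemma mean_zero_energy_le_0:
  assumes "f \<in> sobolev_dual p \<Omega>"
  shows "mean_zero_energy p \<Omega> f \<le> 0"
proof -
  have "\<forall>c. \<forall>u\<in>sobolev p \<Omega>. f (\<lambda>x. c * u x) = c * f u"
    using assms by (simp add: sobolev_dual_def)
  from this[rule_format, OF has_trace_sobolev[OF has_trace_zero], of 0] have "f (\<lambda>_. 0) = 0" by simp
  then show ?thesis
    unfolding mean_zero_energy_def
    by (intro Inf_lower) (auto intro!: exI[of _ "\<lambda>_. 0"] simp: has_trace_zero zero_ereal_def)
qed

text \<open>
  On the empty set every function has norm zero, so a pairing of \<open>f\<close> with \<open>1\<close> that does not vanish forces the domain to be nonempty.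
\<close>

lemma sobolev_dual_empty:
  fixes f :: "('a::euclidean_space \<Rightarrow> real) \<Rightarrow> real"
  assumes "f \<in> sobolev_dual p {}"
  shows "f u = 0"
proof -
  have sp: "space (lebesgue_on {}) = {}" by (simp add: space_restrict_space)
  have int: "(LINT x|lebesgue_on {}. k x) = 0" for k :: "'a \<Rightarrow> real"
    by (subst Bochner_Integration.integral_cong[OF refl, of _ _ "\<lambda>_. 0"]) (auto simp: sp)
  have sob: "has_sobolev_gradient p {} u (\<lambda>_. 0)"
    unfolding has_sobolev_gradient_def by (auto simp: Lp_def int measurable_def sp integrable_iff_bounded nn_integral_empty)
  obtain C where C: "\<forall>u G. has_sobolev_gradient p {} u G \<longrightarrow>
      \<bar>f u\<bar> \<le> C * (Lp_norm p (lebesgue_on {}) u + Lp_norm p (lebesgue_on {}) G)"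
    using assms unfolding sobolev_dual_def by blast
  from C[rule_format, OF sob] have "\<bar>f u\<bar> \<le> C * (Lp_norm p (lebesgue_on {}) u + Lp_norm p (lebesgue_on {}) (\<lambda>_::'a. 0::'a))" .
  then show ?thesis by (simp add: Lp_norm_def int)
qed

text \<open>
  By the Poincare inequality the linear part is at most a multiple of the norm of the gradient, and the term of order \<open>p > 1\<close> dominates it.
\<close>

lemma mean_zero_energy_finite:
  fixes \<Omega> :: "'a::euclidean_space set"
  assumes "bounded \<Omega>" "open \<Omega>" "lipschitz_boundary \<Omega>" "connected \<Omega>" "\<Omega> \<noteq> {}" and p: "p > 1"
    and f: "f \<in> sobolev_dual p \<Omega>"
  shows "mean_zero_energy p \<Omega> f \<noteq> - \<infinity>"
proof -
  let ?M = "lebesgue_on \<Omega>"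
  obtain C where C: "C \<ge> 0" and PC: "\<forall>u G g. has_trace p \<Omega> u G g \<and> (LINT x|boundary_measure \<Omega>. g x) = 0 \<longrightarrow>
    Lp_norm p ?M u \<le> C * Lp_norm p ?M G"
    using poincare_mean_zero_trace[OF assms(1-5), of p] p by auto
  obtain D where D: "\<forall>u G. has_sobolev_gradient p \<Omega> u G \<longrightarrow> \<bar>f u\<bar> \<le> D * (Lp_norm p ?M u + Lp_norm p ?M G)"
    using f unfolding sobolev_dual_def by blast
  define K where "K = \<bar>D\<bar> * (C + 1)"
  have "ereal (- ((p - 1) / p * (\<bar>K\<bar> powr (p / (p - 1)) / 1 powr (1 / (p - 1))))) \<le> mean_zero_energy p \<Omega> f"
    unfolding mean_zero_energy_def
  proof (rule Inf_greatest, clarify)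
    fix v G g assume tr: "has_trace p \<Omega> v G g" and mean: "(LINT x|boundary_measure \<Omega>. g x) = 0"
    let ?t = "Lp_norm p ?M G"
    have "\<bar>f v\<bar> \<le> D * (Lp_norm p ?M v + ?t)" using D tr by (auto simp: has_trace_def)
    also have "... \<le> \<bar>D\<bar> * (Lp_norm p ?M v + ?t)"
      by (intro mult_right_mono) (auto simp: Lp_norm_nonneg)
    also have "... \<le> \<bar>D\<bar> * (C * ?t + ?t)"
      using PC tr mean by (intro mult_left_mono add_right_mono) auto
    also have "... = K * ?t" by (simp add: K_def algebra_simps)
    also have "... \<le> 1 / p * \<bar>?t\<bar> powr p + (p - 1) / p * (\<bar>K\<bar> powr (p / (p - 1)) / 1 powr (1 / (p - 1)))"
      by (rule young_scaled) (use p in auto)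
    also have "\<bar>?t\<bar> powr p = (LINT x|?M. norm (G x) powr p)"
      using p by (simp add: Lp_norm_nonneg Lp_norm_powr)
    finally show "ereal (- ((p - 1) / p * (\<bar>K\<bar> powr (p / (p - 1)) / 1 powr (1 / (p - 1)))))
       \<le> ereal (1 / p * (LINT x|?M. norm (G x) powr p) - f v)" by simp
  qed
  then show ?thesis by auto
qed

text \<open>
  The competitor is the constant that minimises the energy among constants, \<open>c = sgn a (|a| / (\<alpha> h))\<^bsup>1/(q-1)\<^esup>\<close>, where \<open>a\<close> is the pairing of \<open>f\<close> with \<open>1\<close>.
\<close>

lemma robin_energy_le:
  fixes \<Omega> :: "'a::euclidean_space set"
  assumes "bounded \<Omega>" "open \<Omega>" "lipschitz_boundary \<Omega>" "\<Omega> \<noteq> {}" and p: "p > 1" and q: "q > 1" and \<alpha>: "\<alpha> > 0"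
    and f: "f \<in> sobolev_dual p \<Omega>"
  shows "robin_energy p q \<Omega> f \<alpha> \<le> ereal (- leading_coeff q \<Omega> f / \<alpha> powr (1 / (q - 1)))"
proof -
  let ?B = "boundary_measure \<Omega>"
  have p1: "p \<ge> 1" using p by simp
  note trc = has_trace_const[OF assms(1-3) p1]
  interpret finite_measure ?B by (rule finite_measure_boundary_measure[OF assms(1-3)])
  define h where "h = measure ?B (frontier \<Omega>)"
  have h: "h > 0" unfolding h_def by (rule measure_boundary_pos[OF assms(1-4)])
  have hH: "measure (hausdorff_measure (DIM('a) - 1)) (frontier \<Omega>) = h"
    by (simp add: h_def measure_def emeasure_boundary_measure)
  define a where "a = f (\<lambda>_. 1)"
  define s where "s = \<bar>a\<bar> / (\<alpha> * h)"
  have s: "s \<ge> 0" using \<alpha> h by (simp add: s_def)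
  define \<gamma> where "\<gamma> = 1 / (q - 1)"
  have \<gamma>: "\<gamma> > 0" "\<gamma> * q = q / (q - 1)" "1 + \<gamma> = q / (q - 1)" using q by (simp_all add: \<gamma>_def field_simps)
  define c where "c = sgn a * s powr \<gamma>"
  have ca: "c * a = \<bar>a\<bar> * s powr \<gamma>" by (simp add: c_def sgn_mult_abs mult.commute abs_sgn)
  have cq: "\<bar>c\<bar> powr q = s powr (q / (q - 1))"
  proof (cases "a = 0")
    case True then show ?thesis by (simp add: c_def s_def)
  next
    case False then show ?thesis by (simp add: c_def abs_mult abs_sgn_eq powr_powr \<gamma>(2))
  qed
  have as: "\<bar>a\<bar> * s powr \<gamma> = \<alpha> * h * s powr (q / (q - 1))"
  proof (cases "s = 0")
    case True then show ?thesis using \<alpha> h by (simp add: s_def)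
  next
    case False
    have "\<bar>a\<bar> = \<alpha> * h * s" using \<alpha> h by (simp add: s_def)
    then have "\<bar>a\<bar> * s powr \<gamma> = \<alpha> * h * (s powr 1 * s powr \<gamma>)" using s by simp
    also have "s powr 1 * s powr \<gamma> = s powr (q / (q - 1))" by (simp only: \<gamma>(3)[symmetric] powr_add)
    finally show ?thesis .
  qed
  have lead: "leading_coeff q \<Omega> f / \<alpha> powr \<gamma> = (q - 1) / q * (\<alpha> * h * s powr (q / (q - 1)))"
  proof -
    have "(\<alpha> * h) powr (q / (q - 1)) = (\<alpha> * h) powr 1 * (\<alpha> * h) powr \<gamma>" by (simp only: \<gamma>(3)[symmetric] powr_add)
    then have "\<alpha> * h * s powr (q / (q - 1)) = \<bar>a\<bar> powr (q / (q - 1)) / (\<alpha> * h) powr \<gamma>"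
      using \<alpha> h by (simp add: s_def powr_divide)
    then show ?thesis
      unfolding leading_coeff_def a_def[symmetric] hH \<gamma>_def[symmetric] using \<alpha> h by (simp add: powr_mult)
  qed
  have fc: "f (\<lambda>_. c) = c * a"
    unfolding a_def by (rule sobolev_dual_const[OF f has_trace_sobolev[OF trc]])
  have "(\<integral>\<^sup>+x. ennreal (\<bar>c\<bar> powr q) \<partial>?B) = ennreal (\<bar>c\<bar> powr q * h)"
    by (simp add: h_def emeasure_eq_measure ennreal_mult)
  then have "ereal (1 / p * (LINT x|lebesgue_on \<Omega>. norm ((\<lambda>_. 0::'a) x) powr p))
      + ereal (\<alpha> / q) * enn2ereal (\<integral>\<^sup>+x. ennreal (\<bar>(\<lambda>_. c) x\<bar> powr q) \<partial>?B) - ereal (f (\<lambda>_. c))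
      = ereal (\<alpha> / q * (\<bar>c\<bar> powr q * h) - c * a)"
    using h by (simp add: fc enn2ereal_ennreal)
  also have "\<alpha> / q * (\<bar>c\<bar> powr q * h) - c * a = - leading_coeff q \<Omega> f / \<alpha> powr \<gamma>"
    using q unfolding minus_divide_left[symmetric] lead ca as cq by (simp add: field_simps)
  finally have eq: "ereal (1 / p * (LINT x|lebesgue_on \<Omega>. norm ((\<lambda>_. 0::'a) x) powr p))
      + ereal (\<alpha> / q) * enn2ereal (\<integral>\<^sup>+x. ennreal (\<bar>(\<lambda>_. c) x\<bar> powr q) \<partial>?B) - ereal (f (\<lambda>_. c))
      = ereal (- leading_coeff q \<Omega> f / \<alpha> powr \<gamma>)" .
  show ?thesis
    unfolding robin_energy_def \<gamma>_def[symmetric] eq[symmetric]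
    by (intro Inf_lower CollectI exI[of _ "\<lambda>_. c"] exI[of _ "\<lambda>_. 0::'a"] conjI refl trc)
qed

text \<open>
  Splitting off the boundary mean \<open>c\<close> leaves an admissible function for the mean zero problem. The
  slope \<open>a / h\<close> in Young's inequality is chosen so that the integral of the linear term is \<open>c a\<close>, the pairing of \<open>f\<close>
  with the constant that was removed.
\<close>

lemma robin_energy_ge:
  fixes \<Omega> :: "'a::euclidean_space set"
  assumes "bounded \<Omega>" "open \<Omega>" "lipschitz_boundary \<Omega>" "\<Omega> \<noteq> {}" and p: "p > 1" and q: "q > 1" and \<alpha>: "\<alpha> > 0"
    and f: "f \<in> sobolev_dual p \<Omega>"
  shows "mean_zero_energy p \<Omega> f + ereal (- leading_coeff q \<Omega> f / \<alpha> powr (1 / (q - 1))) \<le> robin_energy p q \<Omega> f \<alpha>"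
  unfolding robin_energy_def
proof (rule Inf_greatest, clarify)
  fix u G g assume tr: "has_trace p \<Omega> u G g"
  let ?B = "boundary_measure \<Omega>" and ?\<gamma> = "1 / (q - 1)" and ?E = "1 / p * (LINT x|lebesgue_on \<Omega>. norm (G x) powr p)"
  let ?N = "\<integral>\<^sup>+x. ennreal (\<bar>g x\<bar> powr q) \<partial>?B"
  have p1: "p \<ge> 1" using p by simp
  note fin = finite_measure_boundary_measure[OF assms(1-3)]
  interpret finite_measure ?B by (rule fin)
  define h where "h = measure ?B (frontier \<Omega>)"
  have h: "h > 0" unfolding h_def by (rule measure_boundary_pos[OF assms(1-4)])
  have hH: "measure (hausdorff_measure (DIM('a) - 1)) (frontier \<Omega>) = h"
    by (simp add: h_def measure_def emeasure_boundary_measure)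
  define a where "a = f (\<lambda>_. 1)"
  define L where "L = leading_coeff q \<Omega> f / \<alpha> powr ?\<gamma>"
  have gL: "g \<in> Lp p ?B" using tr by (simp add: has_trace_def)
  then have gm: "g \<in> borel_measurable ?B" by (simp add: Lp_def)
  have gi: "integrable ?B g" by (rule Lp_imp_integrable[OF fin gL p1])
  show "mean_zero_energy p \<Omega> f + ereal (- leading_coeff q \<Omega> f / \<alpha> powr ?\<gamma>)
     \<le> ereal ?E + ereal (\<alpha> / q) * enn2ereal ?N - ereal (f u)"
  proof (cases "?N = \<infinity>")
    case True
    have "ereal (\<alpha> / q) * \<infinity> = \<infinity>" using \<alpha> q by simp
    then show ?thesis unfolding True by simp
  next
    case False
    define c where "c = (LINT x|?B. g x) / h"
    have gq: "integrable ?B (\<lambda>x. \<bar>g x\<bar> powr q)"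
      using False gm by (intro integrableI_nonneg) (auto simp: less_top)
    define n where "n = (LINT x|?B. \<bar>g x\<bar> powr q)"
    have N: "?N = ennreal n" unfolding n_def using gq by (intro nn_integral_eq_integral) auto
    have n0: "n \<ge> 0" by (simp add: n_def)
    have tr': "has_trace p \<Omega> (\<lambda>x. u x - c) G (\<lambda>x. g x - c)"
      by (rule has_trace_diff_const[OF assms(1-3) p1 tr])
    have mean: "(LINT x|?B. g x - c) = 0"
      using gi h by (simp add: c_def h_def[symmetric])
    have "mean_zero_energy p \<Omega> f \<le> ereal (?E - f (\<lambda>x. u x - c))"
      unfolding mean_zero_energy_def
      by (intro Inf_lower CollectI exI[of _ "\<lambda>x. u x - c"] exI[of _ G] exI[of _ "\<lambda>x. g x - c"] conjI refl tr' mean)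
    also have "f (\<lambda>x. u x - c) = f u - c * a"
      unfolding a_def by (rule sobolev_dual_diff_const[OF assms(1-3) p1 f has_trace_sobolev[OF tr]])
    finally have m: "mean_zero_energy p \<Omega> f \<le> ereal (?E - (f u - c * a))" .
    define R where "R = (q - 1) / q * (\<bar>a / h\<bar> powr (q / (q - 1)) / \<alpha> powr ?\<gamma>)"
    have "(LINT x|?B. a / h * g x) \<le> (LINT x|?B. \<alpha> / q * \<bar>g x\<bar> powr q + R)"
      unfolding R_def using gi gq \<alpha> q by (intro integral_mono young_scaled) auto
    then have "c * a \<le> \<alpha> / q * n + h * R"
      using gi gq h by (simp add: c_def n_def h_def[symmetric] mult.commute)
    moreover have "h * R = L"
    proof -
      have "q / (q - 1) = 1 + ?\<gamma>" using q by (simp add: field_simps)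
      then have "h powr (q / (q - 1)) = h * h powr ?\<gamma>" using h by (simp add: powr_add)
      then have "h * \<bar>a / h\<bar> powr (q / (q - 1)) = \<bar>a\<bar> powr (q / (q - 1)) / h powr ?\<gamma>"
        using h by (simp add: abs_divide powr_divide)
      then show ?thesis
        unfolding R_def L_def leading_coeff_def hH a_def[symmetric] by (simp add: mult.left_commute[of h])
    qed
    ultimately have "?E - (f u - c * a) + - L \<le> ?E + \<alpha> / q * n - f u" by simp
    then have "ereal (?E - (f u - c * a)) + ereal (- L) \<le> ereal ?E + ereal (\<alpha> / q) * enn2ereal ?N - ereal (f u)"
      using n0 by (simp add: N enn2ereal_ennreal)
    moreover have "mean_zero_energy p \<Omega> f + ereal (- L) \<le> ereal (?E - (f u - c * a)) + ereal (- L)"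
      using m by (rule add_right_mono)
    ultimately show ?thesis unfolding L_def by (simp only: minus_divide_left)
  qed
qed

theorem theorem4p2:
  fixes \<Omega> :: "'a::euclidean_space set"
    and p q \<gamma> :: real
    and f :: "('a \<Rightarrow> real) \<Rightarrow> real"
  assumes "bounded \<Omega>" and "open \<Omega>" and "lipschitz_boundary \<Omega>"
    and "p > 1" and "q > 1"
    and "f \<in> sobolev_dual p \<Omega>" and "f (\<lambda>_. 1) \<noteq> 0"
    and "\<gamma> = 1 / (q - 1)"
  shows "(\<forall>\<alpha>>0.
            ereal (- leading_coeff q \<Omega> f) + ereal (\<alpha> powr \<gamma>) * mean_zero_energy p \<Omega> f
              \<le> ereal (\<alpha> powr \<gamma>) * robin_energy p q \<Omega> f \<alpha> \<and>
            ereal (\<alpha> powr \<gamma>) * robin_energy p q \<Omega> f \<alpha> \<le> ereal (- leading_coeff q \<Omega> f)) \<and>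
         (connected \<Omega> \<or> mean_zero_energy p \<Omega> f \<noteq> - \<infinity> \<longrightarrow>
            (\<exists>r. r \<in> o[at_right 0](\<lambda>\<alpha>. 1 / \<alpha> powr \<gamma>) \<and>
               (\<forall>\<alpha>>0. robin_energy p q \<Omega> f \<alpha> =
                  ereal (- (1 / \<alpha> powr \<gamma>) * leading_coeff q \<Omega> f + r \<alpha>))))"
proof -
  have ne: "\<Omega> \<noteq> {}" using sobolev_dual_empty assms(6,7) by blast
  have \<gamma>: "\<gamma> > 0" using assms by simp
  let ?L = "leading_coeff q \<Omega> f" and ?K = "mean_zero_energy p \<Omega> f" and ?E = "robin_energy p q \<Omega> f"
  have K0: "?K \<le> 0" by (rule mean_zero_energy_le_0[OF assms(6)])
  have upper: "?E \<alpha> \<le> ereal (- ?L / \<alpha> powr \<gamma>)" if "\<alpha> > 0" for \<alpha>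
    using robin_energy_le[OF assms(1-3) ne assms(4,5) that assms(6)] assms(8) by simp
  have lower: "?K + ereal (- ?L / \<alpha> powr \<gamma>) \<le> ?E \<alpha>" if "\<alpha> > 0" for \<alpha>
    using robin_energy_ge[OF assms(1-3) ne assms(4,5) that assms(6)] assms(8) by simp
  have bounds: "ereal (- ?L) + ereal (\<alpha> powr \<gamma>) * ?K \<le> ereal (\<alpha> powr \<gamma>) * ?E \<alpha> \<and>
      ereal (\<alpha> powr \<gamma>) * ?E \<alpha> \<le> ereal (- ?L)" if \<alpha>: "\<alpha> > 0" for \<alpha>
  proof
    have t: "\<alpha> powr \<gamma> > 0" using \<alpha> by simp
    have "ereal (\<alpha> powr \<gamma>) * ?E \<alpha> \<le> ereal (\<alpha> powr \<gamma>) * ereal (- ?L / \<alpha> powr \<gamma>)"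
      by (intro ereal_mult_left_mono upper \<alpha>) simp
    then show "ereal (\<alpha> powr \<gamma>) * ?E \<alpha> \<le> ereal (- ?L)" using t by simp
    have "ereal (\<alpha> powr \<gamma>) * (?K + ereal (- ?L / \<alpha> powr \<gamma>)) \<le> ereal (\<alpha> powr \<gamma>) * ?E \<alpha>"
      by (intro ereal_mult_left_mono lower \<alpha>) simp
    also have "ereal (\<alpha> powr \<gamma>) * (?K + ereal (- ?L / \<alpha> powr \<gamma>)) = ereal (- ?L) + ereal (\<alpha> powr \<gamma>) * ?K"
      using t K0 by (cases ?K) (auto simp: field_simps)
    finally show "ereal (- ?L) + ereal (\<alpha> powr \<gamma>) * ?K \<le> ereal (\<alpha> powr \<gamma>) * ?E \<alpha>" .
  qed
  have asymptotics: "\<exists>r. r \<in> o[at_right 0](\<lambda>\<alpha>. 1 / \<alpha> powr \<gamma>) \<and>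
       (\<forall>\<alpha>>0. ?E \<alpha> = ereal (- (1 / \<alpha> powr \<gamma>) * ?L + r \<alpha>))"
    if "connected \<Omega> \<or> ?K \<noteq> - \<infinity>"
  proof -
    have "?K \<noteq> - \<infinity>" using that mean_zero_energy_finite[OF assms(1-3) _ ne assms(4,6)] by blast
    then obtain k where k: "?K = ereal k" using K0 by (cases ?K) auto
    define r where "r \<alpha> = real_of_ereal (?E \<alpha>) + ?L / \<alpha> powr \<gamma>" for \<alpha>
    have Er: "?E \<alpha> = ereal (- (1 / \<alpha> powr \<gamma>) * ?L + r \<alpha>)" and r: "k \<le> r \<alpha>" "r \<alpha> \<le> 0" if pos: "\<alpha> > 0" for \<alpha>
    proof -
      obtain e where e: "?E \<alpha> = ereal e"
        using lower[OF pos] upper[OF pos] k by (cases "?E \<alpha>") auto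
      show "?E \<alpha> = ereal (- (1 / \<alpha> powr \<gamma>) * ?L + r \<alpha>)" by (simp add: r_def e)
      show "k \<le> r \<alpha>" "r \<alpha> \<le> 0" using lower[OF pos] upper[OF pos] by (simp_all add: r_def e k)
    qed
    have lim: "((\<lambda>\<alpha>. \<alpha> powr \<gamma>) \<longlongrightarrow> 0 powr \<gamma>) (at_right 0)"
      using \<gamma> eventually_at_right_less[of "0::real"]
      by (intro tendsto_powr' tendsto_const tendsto_ident_at) (auto elim: eventually_mono)
    have "((\<lambda>\<alpha>. r \<alpha> / (1 / \<alpha> powr \<gamma>)) \<longlongrightarrow> 0) (at_right 0)"
    proof (rule tendsto_sandwich)
      show "((\<lambda>\<alpha>. k * \<alpha> powr \<gamma>) \<longlongrightarrow> 0) (at_right 0)"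
        using tendsto_mult[OF tendsto_const lim, of k] by simp
      show "((\<lambda>_. 0::real) \<longlongrightarrow> 0) (at_right 0)" by simp
      show "eventually (\<lambda>\<alpha>. k * \<alpha> powr \<gamma> \<le> r \<alpha> / (1 / \<alpha> powr \<gamma>)) (at_right 0)"
        using eventually_at_right_less[of "0::real"] by eventually_elim (simp add: r mult_right_mono)
      show "eventually (\<lambda>\<alpha>. r \<alpha> / (1 / \<alpha> powr \<gamma>) \<le> 0) (at_right 0)"
        using eventually_at_right_less[of "0::real"] by eventually_elim (simp add: r mult_nonpos_nonneg)
    qed
    then have "r \<in> o[at_right 0](\<lambda>\<alpha>. 1 / \<alpha> powr \<gamma>)"
      using eventually_at_right_less[of "0::real"] by (intro smalloI_tendsto) (auto elim: eventually_mono)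
    then show ?thesis using Er by blast
  qed
  show ?thesis
  proof (rule conjI)
    show "\<forall>\<alpha>>0. ereal (- ?L) + ereal (\<alpha> powr \<gamma>) * ?K \<le> ereal (\<alpha> powr \<gamma>) * ?E \<alpha> \<and>
        ereal (\<alpha> powr \<gamma>) * ?E \<alpha> \<le> ereal (- ?L)"
      by (intro allI impI bounds)
    show "connected \<Omega> \<or> ?K \<noteq> - \<infinity> \<longrightarrow> (\<exists>r. r \<in> o[at_right 0](\<lambda>\<alpha>. 1 / \<alpha> powr \<gamma>) \<and>
       (\<forall>\<alpha>>0. ?E \<alpha> = ereal (- (1 / \<alpha> powr \<gamma>) * ?L + r \<alpha>)))"
      by (intro impI asymptotics)
  qed
qed

end
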